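(* Let $\mathbb{T} = \mathbb{R}^2/(4\pi\mathbb{Z}\oplus 2\pi\mathbb{Z})$ be the flat torus with coordinates $(x,y)$. Let $k\ge 2$, let $y_1,\dots,y_k \in \mathbb{R}/2\pi\mathbb{Z}$ be distinct, and for small $a>0$ let $\mathbb{T}_a = \mathbb{T}\setminus \bigcup_{j=1}^k \big([0,a]\times\{y_j\}\big)$ be the torus with $k$ cracks of length $a$ parallel to the $x$-axis. For all sufficiently small $a>0$, the Extended Courant Property for $\mathbb{T}_a$, with the Neumann condition on the cracks, is false; that is, there exist an integer $m\ge 1$ and a linear combination $v$ of eigenfunctions of $-\Delta$ in $\mathbb{T}_a$ (with the Neumann condition on the cracks) associated with eigenvalues less than or equal to $\lambda_m$ such that $\beta_0(v)>\kappa(\lambda_m)$.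
   Context: The realization of $-\Delta$ in $\mathbb{T}_a$ is the self-adjoint operator with the Neumann condition on (both sides of) the cracks, i.e. the operator associated with the quadratic form $\int_{\mathbb{T}_a}|\nabla u|^2$ on $H^1(\mathbb{T}_a)$. Its eigenvalues are listed in nondecreasing order, counted with multiplicity and starting with index $1$: $\lambda_1 < \lambda_2 \le \lambda_3 \le \cdots$. For an eigenvalue $\lambda$, set $\kappa(\lambda) = \min\{k \mid \lambda_k = \lambda\}$. For a real continuous function $v$ on $\Omega=\mathbb{T}_a$, the nodal set is $\mathcal{Z}(v) = \overline{\{x \in \Omega \mid v(x) = 0\}}$, and $\beta_0(v)$ denotes the number of connected components of $\Omega \setminus \mathcal{Z}(v)$ (nodal domains). The Extended Courant Property for $\Omega$ with the given boundary conditions is the assertion: for every $m \ge 1$ and every real linear combination $v$ of real eigenfunctions associated with eigenvalues $\le \lambda_m$, one has $\beta_0(v) \le \kappa(\lambda_m) \le m$. *)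

theory Defs
  imports "HOL-Analysis.Analysis" "HOL-Library.Real_Mod" "HOL-Library.Extended_Nat"
begin

section \<open>The flat torus\<close>

quotient_type torus = "real \<times> real" /
  "\<lambda>(x, y) (x', y'). [x = x'] (rmod 4 * pi) \<and> [y = y'] (rmod 2 * pi)"
  morphisms rep_torus to_torus
proof (rule equivpI)
  show "reflp (\<lambda>(x, y) (x', y'). [x = x'] (rmod 4 * pi) \<and> [y = y'] (rmod 2 * pi))"
    by (auto simp: reflp_def)
  show "symp (\<lambda>(x, y) (x', y'). [x = x'] (rmod 4 * pi) \<and> [y = y'] (rmod 2 * pi))"
    by (auto simp: symp_def intro: rcong_sym)
  show "transp (\<lambda>(x, y) (x', y'). [x = x'] (rmod 4 * pi) \<and> [y = y'] (rmod 2 * pi))"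
    by (auto simp: transp_def intro: rcong_trans)
qed

instantiation torus :: topological_space
begin

definition open_torus :: "torus set \<Rightarrow> bool" where
  "open_torus U \<longleftrightarrow> open (to_torus -` U)"

instance
proof
  show "open (UNIV :: torus set)"
    by (simp add: open_torus_def)
  show "open (S \<inter> T)" if "open S" "open T" for S T :: "torus set"
    using that by (simp add: open_torus_def open_Int)
  show "open (\<Union>K)" if "\<forall>S\<in>K. open S" for K :: "torus set set"
    using that by (auto simp: open_torus_def vimage_Union)
qed

end

definition torus_measure :: "torus measure" where
  "torus_measure =
     distr (restrict_space lborel ({0..<4 * pi} \<times> {0..<2 * pi})) borel to_torus"

definition domain_measure :: "torus set \<Rightarrow> torus measure" where
  "domain_measure \<Omega> = restrict_space torus_measure \<Omega>"

section \<open>Sobolev space on an open subset of the torus\<close>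

text \<open>Functions on an open set \<open>\<Omega>\<close> of the torus are total functions whose values outside \<open>\<Omega>\<close>
  are irrelevant; elements of \<open>L\<^sup>2(\<Omega>)\<close> are represented by measurable functions, and equality in
  \<open>L\<^sup>2(\<Omega>)\<close> is equality almost everywhere.\<close>

definition L2 :: "torus set \<Rightarrow> (torus \<Rightarrow> 'b::euclidean_space) \<Rightarrow> bool" where
  "L2 \<Omega> u \<longleftrightarrow> u \<in> borel_measurable (domain_measure \<Omega>) \<and>
     integrable (domain_measure \<Omega>) (\<lambda>p. (norm (u p))\<^sup>2)"

definition has_gradient :: "(torus \<Rightarrow> real) \<Rightarrow> (torus \<Rightarrow> real \<times> real) \<Rightarrow> bool" where
  "has_gradient \<phi> \<psi> \<longleftrightarrow> (\<forall>z. GDERIV (\<lambda>z. \<phi> (to_torus z)) z :> \<psi> (to_torus z))"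

text \<open>Being coinductive, \<open>smooth_torus\<close> says that all iterated partial derivatives exist and are
  (totally) differentiable, i.e. it is \<open>C\<^sup>\<infinity>\<close> smoothness.\<close>

coinductive smooth_torus :: "(torus \<Rightarrow> real) \<Rightarrow> bool" where
  "has_gradient \<phi> \<psi> \<Longrightarrow> smooth_torus (\<lambda>p. fst (\<psi> p)) \<Longrightarrow> smooth_torus (\<lambda>p. snd (\<psi> p)) \<Longrightarrow>
   smooth_torus \<phi>"

definition test_function :: "torus set \<Rightarrow> (torus \<Rightarrow> real) \<Rightarrow> bool" where
  "test_function \<Omega> \<phi> \<longleftrightarrow> smooth_torus \<phi> \<and>
     compact (closure {p. \<phi> p \<noteq> 0}) \<and> closure {p. \<phi> p \<noteq> 0} \<subseteq> \<Omega>"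

definition weak_gradient ::
  "torus set \<Rightarrow> (torus \<Rightarrow> real) \<Rightarrow> (torus \<Rightarrow> real \<times> real) \<Rightarrow> bool" where
  "weak_gradient \<Omega> u g \<longleftrightarrow>
     (\<forall>\<phi> \<psi>. test_function \<Omega> \<phi> \<and> has_gradient \<phi> \<psi> \<longrightarrow>
        (LINT p|domain_measure \<Omega>. u p *\<^sub>R \<psi> p) = - (LINT p|domain_measure \<Omega>. \<phi> p *\<^sub>R g p))"

text \<open>\<open>H1 \<Omega> u g\<close>: the function \<open>u\<close> belongs to \<open>H\<^sup>1(\<Omega>)\<close> and \<open>g\<close> is (a representative of) its
  gradient. Test functions are supported away from the cracks of \<open>\<Omega>\<close>, so \<open>u\<close> may jump there.\<close>

definition H1 :: "torus set \<Rightarrow> (torus \<Rightarrow> real) \<Rightarrow> (torus \<Rightarrow> real \<times> real) \<Rightarrow> bool" where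
  "H1 \<Omega> u g \<longleftrightarrow> L2 \<Omega> u \<and> L2 \<Omega> g \<and> weak_gradient \<Omega> u g"

section \<open>The Neumann Laplacian and its eigenvalues\<close>

text \<open>\<open>neumann_laplacian \<Omega> u f\<close>: the function \<open>u\<close> is in the domain of the self-adjoint operator
  associated with the quadratic form \<open>\<integral>\<bar>\<nabla>u\<bar>\<^sup>2\<close> with form domain \<open>H\<^sup>1(\<Omega>)\<close>, and this operator maps
  \<open>u\<close> to \<open>f\<close>.\<close>

definition neumann_laplacian ::
  "torus set \<Rightarrow> (torus \<Rightarrow> real) \<Rightarrow> (torus \<Rightarrow> real) \<Rightarrow> bool" where
  "neumann_laplacian \<Omega> u f \<longleftrightarrow> L2 \<Omega> f \<and>
     (\<exists>g. H1 \<Omega> u g \<and>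
       (\<forall>w h. H1 \<Omega> w h \<longrightarrow>
         (LINT p|domain_measure \<Omega>. g p \<bullet> h p) = (LINT p|domain_measure \<Omega>. f p * w p)))"

definition eigenspace :: "torus set \<Rightarrow> real \<Rightarrow> (torus \<Rightarrow> real) set" where
  "eigenspace \<Omega> \<mu> = {u. neumann_laplacian \<Omega> u (\<lambda>p. \<mu> * u p)}"

definition eigenfunction :: "torus set \<Rightarrow> real \<Rightarrow> (torus \<Rightarrow> real) \<Rightarrow> bool" where
  "eigenfunction \<Omega> \<mu> u \<longleftrightarrow> u \<in> eigenspace \<Omega> \<mu> \<and> \<not> (AE p in domain_measure \<Omega>. u p = 0)"

definition eigenvalue :: "torus set \<Rightarrow> real \<Rightarrow> bool" where
  "eigenvalue \<Omega> \<mu> \<longleftrightarrow> (\<exists>u. eigenfunction \<Omega> \<mu> u)"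

definition L2_independent :: "torus set \<Rightarrow> nat \<Rightarrow> (nat \<Rightarrow> torus \<Rightarrow> real) \<Rightarrow> bool" where
  "L2_independent \<Omega> n u \<longleftrightarrow>
     (\<forall>c :: nat \<Rightarrow> real. (AE p in domain_measure \<Omega>. (\<Sum>i<n. c i * u i p) = 0) \<longrightarrow> (\<forall>i<n. c i = 0))"

text \<open>The dimension of the eigenspace as a subspace of \<open>L\<^sup>2(\<Omega>)\<close>.\<close>

definition eigenvalue_multiplicity :: "torus set \<Rightarrow> real \<Rightarrow> enat" where
  "eigenvalue_multiplicity \<Omega> \<mu> =
     Sup {enat n |n. \<exists>u. (\<forall>i<n. u i \<in> eigenspace \<Omega> \<mu>) \<and> L2_independent \<Omega> n u}"

text \<open>The number of eigenvalues \<open>\<le> \<mu>\<close>, counted with multiplicity. It is the supremum over finite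
  sets because a sum over an infinite set would be \<open>0\<close> by convention.\<close>

definition eigenvalue_count :: "torus set \<Rightarrow> real \<Rightarrow> enat" where
  "eigenvalue_count \<Omega> \<mu> =
     (SUP F \<in> {F. finite F \<and> F \<subseteq> {\<nu>. eigenvalue \<Omega> \<nu> \<and> \<nu> \<le> \<mu>}}.
        \<Sum>\<nu>\<in>F. eigenvalue_multiplicity \<Omega> \<nu>)"

text \<open>The \<open>m\<close>-th entry (\<open>m \<ge> 1\<close>) of the nondecreasing list of eigenvalues repeated according to
  multiplicity.\<close>

definition nth_eigenvalue :: "torus set \<Rightarrow> nat \<Rightarrow> real" where
  "nth_eigenvalue \<Omega> m = (LEAST \<mu>. enat m \<le> eigenvalue_count \<Omega> \<mu>)"

definition kappa :: "torus set \<Rightarrow> real \<Rightarrow> nat" where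
  "kappa \<Omega> \<mu> = (LEAST k. k \<ge> 1 \<and> nth_eigenvalue \<Omega> k = \<mu>)"

section \<open>Nodal domains and the Extended Courant Property\<close>

definition nodal_set :: "torus set \<Rightarrow> (torus \<Rightarrow> real) \<Rightarrow> torus set" where
  "nodal_set \<Omega> v = closure {p \<in> \<Omega>. v p = 0}"

definition nodal_domain_count :: "torus set \<Rightarrow> (torus \<Rightarrow> real) \<Rightarrow> enat" where
  "nodal_domain_count \<Omega> v =
     (let C = components (\<Omega> - nodal_set \<Omega> v) in if finite C then enat (card C) else \<infinity>)"

text \<open>Linear combinations, taken with their continuous representative on \<open>\<Omega>\<close>.\<close>

definition eigenfunction_combination :: "torus set \<Rightarrow> real \<Rightarrow> (torus \<Rightarrow> real) \<Rightarrow> bool" where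
  "eigenfunction_combination \<Omega> \<Lambda> v \<longleftrightarrow> continuous_on \<Omega> v \<and>
     (\<exists>n (c :: nat \<Rightarrow> real) \<nu> u.
        (\<forall>i<n. \<nu> i \<le> \<Lambda> \<and> eigenfunction \<Omega> (\<nu> i) (u i)) \<and>
        (\<forall>p\<in>\<Omega>. v p = (\<Sum>i<n. c i * u i p)))"

definition extended_courant_property :: "torus set \<Rightarrow> bool" where
  "extended_courant_property \<Omega> \<longleftrightarrow>
     (\<forall>m\<ge>1. \<forall>v. eigenfunction_combination \<Omega> (nth_eigenvalue \<Omega> m) v \<longrightarrow>
        nodal_domain_count \<Omega> v \<le> enat (kappa \<Omega> (nth_eigenvalue \<Omega> m)) \<and>
        kappa \<Omega> (nth_eigenvalue \<Omega> m) \<le> m)"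

section \<open>The torus with cracks\<close>

definition cracked_torus :: "nat \<Rightarrow> (nat \<Rightarrow> real) \<Rightarrow> real \<Rightarrow> torus set" where
  "cracked_torus k y a = UNIV - (\<Union>j\<in>{1..k}. to_torus ` ({0..a} \<times> {y j}))"

end

theory Submission
  imports Defs
begin

text \<open>
  A function of \<open>x\<close> alone does not feel the cracks, because they are parallel to the \<open>x\<close>-axis: its
  normal derivative vanishes on both sides of each crack. Hence \<open>1\<close>, \<open>cos (x/2)\<close> and \<open>sin (x/2)\<close> stay
  eigenfunctions, with eigenvalues \<open>0\<close> and \<open>1/4\<close>, and
  \<open>v = cos (x/2 - a/4) - cos (a/4)\<close> is a combination of eigenfunctions with eigenvalues \<open>\<le> 1/4\<close>.
  Its zeros are the two circles \<open>x = 0\<close> and \<open>x = a\<close> that pass through the two ends of every crack.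
  The part \<open>0 < x < a\<close> of the torus, where \<open>v > 0\<close>, is therefore cut by the cracks into \<open>k \<ge> 2\<close>
  pieces, and with the part where \<open>v < 0\<close> there are at least three nodal domains
  (\<open>three_nodal_domains\<close>). It remains to see that \<open>1/4\<close> is the second eigenvalue, so that
  \<open>kappa\<close> is at most \<open>2\<close>; this is where the size of the cracks matters.

  Let \<open>u\<close> be an eigenfunction with eigenvalue \<open>\<mu> < 1/4\<close>. Symmetry of the operator makes \<open>u\<close> orthogonal
  to \<open>cos (n x/2 + \<theta>)\<close> for \<open>n \<ge> 1\<close>, so after subtraction of a constant the mean of \<open>u\<close> over almost
  every vertical circle is zero. On a vertical circle with \<open>x\<close> outside \<open>[0, a]\<close>, which meets no
  crack, the one-dimensional inequality for functions of mean zero bounds \<open>u\<close> by \<open>\<partial>\<^sub>y u\<close>. The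
  remaining vertical circles are broken by the cracks, but almost every horizontal circle
  is not, and along a horizontal circle of length \<open>4\<pi>\<close> the mass of \<open>u\<close> on \<open>[0, a]\<close> is at most a
  multiple of \<open>a\<close> times its \<open>H\<^sup>1\<close> norm. For \<open>a < 1/10\<close> the two bounds add up to
  \<open>\<integral>u\<^sup>2 \<le> 4 \<integral>|\<nabla>u|\<^sup>2\<close> (\<open>torus_poincare\<close>, \<open>poincare\<close>). The constant does not change the
  gradient, and for the eigenfunction \<open>u\<close> the right-hand side equals \<open>4 \<mu> \<integral>u\<^sup>2\<close>. If \<open>\<mu> = 0\<close>, then \<open>u\<close> is
  constant; otherwise \<open>u\<close> itself has mean zero, and \<open>4 \<mu> < 1\<close> forces \<open>u = 0\<close>
  (\<open>eigenspace_below_quarter\<close>).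

  The weak gradient is tested only against smooth functions supported away from the cracks. The
  derivative in \<open>x\<close> may nevertheless be tested against every trigonometric polynomial, because the
  cut-off near the cracks can be chosen to depend on \<open>y\<close> alone and is not differentiated; for the
  derivative in \<open>y\<close>, restricted to \<open>x\<close> outside \<open>[0, a]\<close>, the cut-off depends on \<open>x\<close> alone
  (\<open>weak_derivative_on_positive_set\<close>). Fubini and the uniqueness of Fourier coefficients
  (\<open>fourier_uniqueness\<close>) turn these integral identities into weak derivatives on almost every
  horizontal or vertical circle.
\<close>

section \<open>Uniqueness of Fourier coefficients on a circle\<close>

text \<open>The circle of length \<open>L\<close> is represented by the fundamental domain \<open>[0, L)\<close>, so that functions on
  it are plain functions of a real variable whose values elsewhere are irrelevant.\<close>

definition circle_measure :: "real \<Rightarrow> real measure" where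
  "circle_measure L = restrict_space lborel {0..<L}"

text \<open>The phase \<open>\<theta>\<close> treats sines and cosines uniformly: differentiation multiplies by the frequency
  and advances the phase by \<open>\<pi>/2\<close>.\<close>

definition wave :: "real \<Rightarrow> nat \<Rightarrow> real \<Rightarrow> real \<Rightarrow> real" where
  "wave L n \<theta> x = cos (real n * (2 * pi / L) * x + \<theta>)"

lemma space_circle_measure [simp]: "space (circle_measure L) = {0..<L}"
  by (simp add: circle_measure_def space_restrict_space)

lemma emeasure_circle_measure_space: "emeasure (circle_measure L) {0..<L} = ennreal L" if "L \<ge> 0"
  using that by (simp add: circle_measure_def emeasure_restrict_space)

lemma finite_measure_circle: "finite_measure (circle_measure L)"
  by (rule finite_measureI) (cases "L \<ge> 0"; simp add: emeasure_circle_measure_space)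

lemma measure_circle_measure_space: "measure (circle_measure L) {0..<L} = L" if "L \<ge> 0"
  using that by (simp add: measure_def emeasure_circle_measure_space)

lemma borel_measurable_circle [measurable (raw)]:
  "f \<in> borel_measurable borel \<Longrightarrow> f \<in> borel_measurable (circle_measure L)"
  by (simp add: circle_measure_def measurable_restrict_space1)

lemma integral_circle_eq:
  fixes f :: "real \<Rightarrow> 'b::{banach, second_countable_topology}"
  shows "(LINT x|circle_measure L. f x) = (LINT x|lborel. indicator {0..<L} x *\<^sub>R f x)"
  unfolding circle_measure_def by (subst integral_restrict_space) auto

lemma integrable_circle_eq:
  fixes f :: "real \<Rightarrow> 'b::{banach, second_countable_topology}"
  shows "integrable (circle_measure L) f \<longleftrightarrow> integrable lborel (\<lambda>x. indicator {0..<L} x *\<^sub>R f x)"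
  unfolding circle_measure_def by (subst integrable_restrict_space) auto

lemma integrable_mult_bounded:
  fixes f g :: "'a \<Rightarrow> real"
  assumes "integrable M f" "g \<in> borel_measurable M" "\<And>x. x \<in> space M \<Longrightarrow> \<bar>g x\<bar> \<le> B"
  shows "integrable M (\<lambda>x. f x * g x)"
proof (rule Bochner_Integration.integrable_bound[where f = "\<lambda>x. B * norm (f x)"])
  show "integrable M (\<lambda>x. B * norm (f x))" using assms(1) by auto
  show "(\<lambda>x. f x * g x) \<in> borel_measurable M" using assms by measurable
  show "AE x in M. norm (f x * g x) \<le> norm (B * norm (f x))"
  proof (rule AE_I2)
    fix x assume "x \<in> space M"
    then have "\<bar>g x\<bar> \<le> \<bar>B\<bar>" using assms(3)[of x] by linarith
    then show "norm (f x * g x) \<le> norm (B * norm (f x))"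
      by (simp add: abs_mult mult.commute[of "\<bar>f x\<bar>"] mult_right_mono)
  qed
qed

lemma integrable_circle_bounded:
  fixes g :: "real \<Rightarrow> real"
  assumes "g \<in> borel_measurable (circle_measure L)" "\<And>x. x \<in> {0..<L} \<Longrightarrow> \<bar>g x\<bar> \<le> B"
  shows "integrable (circle_measure L) g"
  using assms by (intro finite_measure.integrable_const_bound[OF finite_measure_circle, where B = B]) (auto intro!: AE_I2)

lemma wave_measurable [measurable]: "wave L n \<theta> \<in> borel_measurable borel"
  unfolding wave_def by measurable

lemma abs_wave_le: "\<bar>wave L n \<theta> x\<bar> \<le> 1"
  by (simp add: wave_def)

lemma wave_phase: "wave L n \<theta> x = cos \<theta> * wave L n 0 x + sin \<theta> * wave L n (pi / 2) x"
  by (simp add: wave_def cos_add algebra_simps)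

lemma wave_0: "wave L 0 \<theta> x = cos \<theta>"
  by (simp add: wave_def)

lemma DERIV_wave: "(wave L n \<theta> has_real_derivative real n * (2 * pi / L) * wave L n (\<theta> + pi / 2) x) (at x)"
proof -
  have "((\<lambda>x. cos (c * x + \<theta>)) has_real_derivative c * cos (c * x + (\<theta> + pi / 2))) (at x)" for c
    by (auto intro!: derivative_eq_intros simp: cos_add sin_add algebra_simps)
  then show ?thesis unfolding wave_def .
qed

lemma wave_periodic:
  assumes "L \<noteq> 0" shows "wave L n \<theta> (x + L) = wave L n \<theta> x"
proof -
  have "real n * (2 * pi / L) * (x + L) + \<theta> = real n * (2 * pi / L) * x + \<theta> + 2 * pi * real n"
    using assms by (simp add: field_simps)
  then show ?thesis
    using cos.plus_of_nat[of "real n * (2 * pi / L) * x + \<theta>" n]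
    by (simp only: wave_def of_real_eq_id id_apply mult.commute[of _ "real n"] mult.left_commute[of _ "real n"] mult.assoc)
qed

lemma integrable_mult_wave:
  assumes "integrable (circle_measure L) f"
  shows "integrable (circle_measure L) (\<lambda>x. f x * wave L n \<theta> x)"
  by (rule integrable_mult_bounded[OF assms _ abs_wave_le]) simp

text \<open>Powers of a cosine are trigonometric polynomials. The extra factor \<open>cos (n\<alpha>)\<close> makes the
  induction on the exponent work through the product formula
  \<open>cos \<alpha> cos (n\<alpha>) = (cos ((n+1)\<alpha>) + cos ((n-1)\<alpha>)) / 2\<close>.\<close>

lemma cos_power_orthogonal:
  assumes f: "integrable (circle_measure L) f"
    and orth: "\<And>n \<theta>. (LINT x|circle_measure L. f x * wave L n \<theta> x) = 0"
  shows "(LINT x|circle_measure L. f x * (cos (2 * pi / L * x + \<phi>) ^ k * cos (real n * (2 * pi / L * x + \<phi>)))) = 0"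
proof (induction k arbitrary: n)
  case 0
  have "cos (real n * (2 * pi / L * x + \<phi>)) = wave L n (real n * \<phi>) x" for x
    by (simp add: wave_def algebra_simps)
  then show ?case using orth[of n "real n * \<phi>"] by simp
next
  case (Suc k)
  let ?\<alpha> = "\<lambda>x. 2 * pi / L * x + \<phi>"
  let ?I = "\<lambda>n. LINT x|circle_measure L. f x * (cos (?\<alpha> x) ^ k * cos (real n * ?\<alpha> x))"
  have int: "integrable (circle_measure L) (\<lambda>x. f x * (cos (?\<alpha> x) ^ k * cos (real n * ?\<alpha> x)))" for n
  proof (rule integrable_mult_bounded[OF f])
    show "\<bar>cos (?\<alpha> x) ^ k * cos (real n * ?\<alpha> x)\<bar> \<le> 1" for x
      by (simp add: abs_mult power_abs mult_le_one power_le_one)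
  qed simp
  show ?case
  proof (cases n)
    case 0
    then show ?thesis using Suc.IH[of 1] by (simp add: mult.commute)
  next
    case (Suc m)
    have prod: "cos a * cos (real (Suc m) * a) = (cos (real (Suc (Suc m)) * a) + cos (real m * a)) / 2" for a
      using cos_times_cos[of "real (Suc m) * a" a] by (simp add: algebra_simps)
    have half: "c * ((A + B) / 2) = (c * A + c * B) / 2" for c A B :: real
      by (simp add: distrib_left)
    have key: "cos a ^ Suc k * cos (real n * a)
      = (cos a ^ k * cos (real (Suc (Suc m)) * a) + cos a ^ k * cos (real m * a)) / 2" for a
    proof -
      have "cos a ^ Suc k * cos (real n * a) = cos a ^ k * (cos a * cos (real (Suc m) * a))"
        unfolding Suc power_Suc by (simp only: mult_ac)
      then show ?thesis by (simp only: prod distrib_left times_divide_eq_right)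
    qed
    have "f x * (cos (?\<alpha> x) ^ Suc k * cos (real n * ?\<alpha> x))
      = (f x * (cos (?\<alpha> x) ^ k * cos (real (Suc (Suc m)) * ?\<alpha> x))
          + f x * (cos (?\<alpha> x) ^ k * cos (real m * ?\<alpha> x))) / 2" for x
      unfolding key by (rule half)
    then have "(LINT x|circle_measure L. f x * (cos (?\<alpha> x) ^ Suc k * cos (real n * ?\<alpha> x)))
       = (LINT x|circle_measure L. (f x * (cos (?\<alpha> x) ^ k * cos (real (Suc (Suc m)) * ?\<alpha> x))
            + f x * (cos (?\<alpha> x) ^ k * cos (real m * ?\<alpha> x))) / 2)"
      by (simp only:)
    also have "\<dots> = (?I (Suc (Suc m)) + ?I m) / 2"
      using int[of "Suc (Suc m)"] int[of m] by (simp only: integral_divide_zero Bochner_Integration.integral_add)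
    finally show ?thesis using Suc.IH[of "Suc (Suc m)"] Suc.IH[of m] by simp
  qed
qed

text \<open>By the previous lemma \<open>f\<close> is orthogonal to every polynomial in one cosine; by Weierstrass
  approximation on \<open>[-1, 1]\<close> it is then orthogonal to every continuous function of that cosine.\<close>

lemma continuous_cos_orthogonal:
  assumes f: "integrable (circle_measure L) f"
    and orth: "\<And>n \<theta>. (LINT x|circle_measure L. f x * wave L n \<theta> x) = 0"
    and g: "continuous_on UNIV (g :: real \<Rightarrow> real)"
  shows "(LINT x|circle_measure L. f x * g (cos (2 * pi / L * x + \<phi>))) = 0"
proof -
  let ?c = "\<lambda>x. cos (2 * pi / L * x + \<phi>)"
  have [measurable]: "f \<in> borel_measurable (circle_measure L)" using f by auto
  have [measurable]: "g \<in> borel_measurable borel" using g by (rule borel_measurable_continuous_onI)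
  have pw: "integrable (circle_measure L) (\<lambda>x. f x * ?c x ^ k)" for k
    by (rule integrable_mult_bounded[OF f, of _ 1]) (auto simp: power_abs power_le_one)
  have pw0: "(LINT x|circle_measure L. f x * ?c x ^ k) = 0" for k
    using cos_power_orthogonal[OF f orth, of \<phi> k 0] by simp
  have bdd: "\<bar>LINT x|circle_measure L. f x * g (?c x)\<bar> \<le> e * (LINT x|circle_measure L. \<bar>f x\<bar>)" if e: "e > 0" for e
  proof -
    obtain p where p: "real_polynomial_function p" "\<And>s. s \<in> {-1..1::real} \<Longrightarrow> \<bar>g s - p s\<bar> < e"
      using Stone_Weierstrass_real_polynomial_function[OF compact_Icc continuous_on_subset[OF g subset_UNIV] e]
      by metis
    obtain a n where an: "p = (\<lambda>x. \<Sum>i\<le>n. a i * x ^ i)"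
      using p(1) by (auto simp: real_polynomial_function_iff_sum)
    have pc: "f x * p (?c x) = (\<Sum>i\<le>n. a i * (f x * ?c x ^ i))" for x
      by (simp add: an sum_distrib_left algebra_simps)
    have ip: "integrable (circle_measure L) (\<lambda>x. f x * p (?c x))"
      unfolding pc using pw by (intro Bochner_Integration.integrable_sum integrable_mult_right) auto
    have p0: "(LINT x|circle_measure L. f x * p (?c x)) = 0"
      unfolding pc using pw pw0 by (subst Bochner_Integration.integral_sum) auto
    have [measurable]: "p \<in> borel_measurable borel" unfolding an by measurable
    have close: "\<bar>g (?c x) - p (?c x)\<bar> \<le> e" for x
      using p(2)[of "?c x"] by (auto simp: less_imp_le)
    have id: "integrable (circle_measure L) (\<lambda>x. f x * (g (?c x) - p (?c x)))"
      by (rule integrable_mult_bounded[OF f _ close]) simp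
    have "(LINT x|circle_measure L. f x * g (?c x)) =
        (LINT x|circle_measure L. f x * (g (?c x) - p (?c x)) + f x * p (?c x))"
      by (simp add: algebra_simps)
    also have "\<dots> = (LINT x|circle_measure L. f x * (g (?c x) - p (?c x)))"
      using ip id p0 by simp
    also have "\<bar>\<dots>\<bar> \<le> (LINT x|circle_measure L. e * \<bar>f x\<bar>)"
    proof (rule order_trans[OF integral_abs_bound integral_mono])
      show "\<bar>f x * (g (?c x) - p (?c x))\<bar> \<le> e * \<bar>f x\<bar>" for x
        using mult_left_mono[OF close[of x], of "\<bar>f x\<bar>"] by (simp add: abs_mult mult.commute)
    qed (use f id in auto)
    finally show ?thesis by simp
  qed
  have "\<bar>LINT x|circle_measure L. f x * g (?c x)\<bar> \<le> 0"
  proof (rule tendsto_lowerbound)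
    show "((\<lambda>e. e * (LINT x|circle_measure L. \<bar>f x\<bar>)) \<longlongrightarrow> 0) (at_right 0)"
      by (auto intro!: tendsto_eq_intros)
    show "\<forall>\<^sub>F e in at_right 0. \<bar>LINT x|circle_measure L. f x * g (?c x)\<bar> \<le> e * (LINT x|circle_measure L. \<bar>f x\<bar>)"
      using bdd by (auto simp: eventually_at_filter)
  qed simp
  then show ?thesis by simp
qed

lemma cos_le_cos_arc: "cos z \<le> cos b" if "0 \<le> b" "b \<le> z" "z \<le> 2 * pi - b"
proof (cases "z \<le> pi")
  case True then show ?thesis using that by (intro cos_monotone_0_pi_le) auto
next
  case False
  have "cos (2 * pi - z) \<le> cos b" using that False by (intro cos_monotone_0_pi_le) auto
  then show ?thesis by (simp add: cos_diff)
qed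

text \<open>The superlevel set of a cosine centred at \<open>t/2\<close> is an arc. This exhibits the indicator of
  \<open>(0, t)\<close> as a function of a single cosine.\<close>

lemma cos_arc_indicator:
  assumes "0 < t" "t < L" "x \<in> {0..<L}"
  shows "cos (2 * pi / L * (x - t / 2)) > cos (pi * t / L) \<longleftrightarrow> x \<in> {0<..<t}"
proof -
  let ?b = "pi * t / L" and ?z = "2 * pi / L * (x - t / 2)"
  have L: "L > 0" using assms by simp
  have b: "0 < ?b" "?b < pi" using assms by (auto simp: field_simps)
  show ?thesis
  proof
    assume "x \<in> {0<..<t}"
    then have "\<bar>x - t / 2\<bar> < t / 2" by (auto simp: abs_if)
    then have "2 * pi / L * \<bar>x - t / 2\<bar> < 2 * pi / L * (t / 2)" using L by (intro mult_strict_left_mono) auto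
    then have "\<bar>?z\<bar> < ?b" using L by (simp add: abs_mult abs_divide)
    then have "cos ?b < cos \<bar>?z\<bar>" using b by (intro cos_monotone_0_pi) auto
    then show "cos ?b < cos ?z" by (simp only: cos_abs_real)
  next
    assume a: "cos ?b < cos ?z"
    show "x \<in> {0<..<t}"
    proof (rule ccontr)
      assume "x \<notin> {0<..<t}"
      then consider "x = 0" | "t \<le> x" using assms by auto
      then show False
      proof cases
        case 1 then show ?thesis using a by simp
      next
        case 2
        have "2 * pi / L * (t / 2) \<le> ?z" using 2 L by (intro mult_left_mono) auto
        moreover have "?z \<le> 2 * pi / L * (L - t / 2)" using assms by (intro mult_left_mono) auto
        moreover have "2 * pi / L * (L - t / 2) = 2 * pi - ?b" using L by (simp add: field_simps)
        ultimately show ?thesis using cos_le_cos_arc[of ?b ?z] b a by simp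
      qed
    qed
  qed
qed

text \<open>The indicator of \<open>(0, t)\<close> is a discontinuous function of one cosine and hence a bounded pointwise
  limit of continuous functions of that cosine.\<close>

lemma interval_orthogonal:
  assumes f: "integrable (circle_measure L) f"
    and orth: "\<And>n \<theta>. (LINT x|circle_measure L. f x * wave L n \<theta> x) = 0"
    and t: "0 < t" "t < L"
  shows "(LINT x|circle_measure L. f x * indicator {0<..<t} x) = 0"
proof -
  let ?c = "\<lambda>x. cos (2 * pi / L * x + - pi * t / L)"
  let ?g = "\<lambda>(m::nat) s::real. min 1 (real m * max 0 (s - cos (pi * t / L)))"
  have [measurable]: "f \<in> borel_measurable (circle_measure L)" using f by auto
  have "(\<lambda>m. LINT x|circle_measure L. f x * ?g m (?c x)) \<longlonglongrightarrow>
     (LINT x|circle_measure L. f x * indicator {0<..<t} x)"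
  proof (rule integral_dominated_convergence[where w = "\<lambda>x. \<bar>f x\<bar>"])
    show "AE x in circle_measure L. (\<lambda>m. f x * ?g m (?c x)) \<longlonglongrightarrow> f x * indicator {0<..<t} x"
    proof (rule AE_I2)
      fix x assume x: "x \<in> space (circle_measure L)"
      have c: "?c x = cos (2 * pi / L * (x - t / 2))" by (simp add: right_diff_distrib)
      have "(\<lambda>m. ?g m (?c x)) \<longlonglongrightarrow> indicator {0<..<t} x"
      proof (cases "x \<in> {0<..<t}")
        case True
        then have d: "?c x - cos (pi * t / L) > 0" (is "?d > 0") using cos_arc_indicator[OF t, of x] x c by auto
        have "\<forall>\<^sub>F m in sequentially. real m \<ge> 1 / ?d"
          using filterlim_real_sequentially unfolding filterlim_at_top by blast
        then have "\<forall>\<^sub>F m in sequentially. ?g m (?c x) = indicator {0<..<t} x"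
          by eventually_elim (use True d in \<open>simp add: field_simps\<close>)
        then show ?thesis by (rule tendsto_eventually)
      next
        case False
        then have d: "?c x - cos (pi * t / L) \<le> 0" using cos_arc_indicator[OF t, of x] x c by auto
        then show ?thesis using False by (simp add: max_def)
      qed
      then show "(\<lambda>m. f x * ?g m (?c x)) \<longlonglongrightarrow> f x * indicator {0<..<t} x"
        by (rule tendsto_mult_left)
    qed
    show "AE x in circle_measure L. norm (f x * ?g m (?c x)) \<le> \<bar>f x\<bar>" for m
      by (intro AE_I2) (auto simp: abs_mult mult_left_le)
  qed (use f in auto)
  moreover have "(LINT x|circle_measure L. f x * ?g m (?c x)) = 0" for m
    by (rule continuous_cos_orthogonal[OF f orth]) (intro continuous_intros)
  ultimately show ?thesis by (simp add: LIMSEQ_const_iff)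
qed

text \<open>Orthogonality to all intervals means that the positive and the negative part of \<open>f\<close> are densities
  of the same measure.\<close>

lemma fourier_uniqueness:
  assumes f: "integrable (circle_measure L) f" and L: "L > 0"
    and orth: "\<And>n \<theta>. (LINT x|circle_measure L. f x * wave L n \<theta> x) = 0"
  shows "AE x in circle_measure L. f x = 0"
proof -
  let ?f = "\<lambda>x. indicator {0..<L} x * f x"
  have fi: "integrable lborel ?f" using f by (simp add: integrable_circle_eq)
  then have [measurable]: "?f \<in> borel_measurable borel" by auto
  have tail: "(LINT x|lborel. ?f x * indicator {t<..} x) = 0" for t
  proof -
    have all: "(LINT x|circle_measure L. f x) = 0" using orth[of 0 0] by (simp add: wave_0)
    have ii: "integrable (circle_measure L) (\<lambda>x. f x * indicator A x)" if "A \<in> sets borel" for A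
      using that by (intro integrable_mult_bounded[OF f, of _ 1]) (auto simp: indicator_def)
    consider "t < 0" | "t \<ge> L" | "0 \<le> t" "t < L" by linarith
    then have "(LINT x|circle_measure L. f x * indicator {t<..} x) = 0"
    proof cases
      case 1
      then have "(LINT x|circle_measure L. f x * indicator {t<..} x) = (LINT x|circle_measure L. f x)"
        by (intro Bochner_Integration.integral_cong) auto
      then show ?thesis using all by simp
    next
      case 2
      then have "(LINT x|circle_measure L. f x * indicator {t<..} x) = (LINT x|circle_measure L. 0)"
        by (intro Bochner_Integration.integral_cong) auto
      then show ?thesis by simp
    next
      case 3
      have z: "(LINT x|circle_measure L. f x * indicator {0<..<t} x) = 0"
        using interval_orthogonal[OF f orth, of t] 3 by (cases "t = 0") auto
      have "AE x in circle_measure L. x \<noteq> 0 \<and> x \<noteq> t"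
        unfolding circle_measure_def
        using AE_lborel_singleton[of 0] AE_lborel_singleton[of t] by (subst AE_restrict_space_iff) auto
      then have "(LINT x|circle_measure L. f x * indicator {t<..} x) = (LINT x|circle_measure L. f x - f x * indicator {0<..<t} x)"
      proof (intro integral_cong_AE borel_measurable_integrable Bochner_Integration.integrable_diff ii f)
        show "AE x in circle_measure L. f x * indicator {t<..} x = f x - f x * indicator {0<..<t} x"
          using \<open>AE x in circle_measure L. x \<noteq> 0 \<and> x \<noteq> t\<close> AE_space
          by eventually_elim (auto simp: indicator_def)
      qed auto
      also have "\<dots> = 0" using ii[of "{0<..<t}"] f z all by simp
      finally show ?thesis .
    qed
    then show ?thesis by (simp add: integral_circle_eq mult.assoc)
  qed
  let ?P = "density lborel (\<lambda>x. ennreal (?f x))" and ?N = "density lborel (\<lambda>x. ennreal (- ?f x))"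
  have em: "emeasure (density lborel (\<lambda>x. ennreal (g x))) {t<..} = ennreal (LINT x|lborel. max 0 (g x) * indicator {t<..} x)"
    if g: "integrable lborel g" for g :: "real \<Rightarrow> real" and t
  proof -
    have [measurable]: "g \<in> borel_measurable borel" using g by auto
    have i: "integrable lborel (\<lambda>x. max 0 (g x) * indicator {t<..} x)"
      using g by (intro Bochner_Integration.integrable_bound[OF g]) (auto simp: indicator_def intro!: AE_I2)
    have "emeasure (density lborel (\<lambda>x. ennreal (g x))) {t<..} = (\<integral>\<^sup>+x. ennreal (max 0 (g x) * indicator {t<..} x) \<partial>lborel)"
      by (subst emeasure_density) (auto intro!: nn_integral_cong simp: indicator_def max_def ennreal_neg)
    also have "\<dots> = ennreal (LINT x|lborel. max 0 (g x) * indicator {t<..} x)"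
      by (rule nn_integral_eq_integral[OF i]) auto
    finally show ?thesis .
  qed
  (* Rays generate the Borel sets, and on rays the two measures agree by the vanishing tails. *)
  have "?P = ?N"
  proof (rule measure_eqI_lessThan)
    fix t
    have i: "integrable lborel (\<lambda>x. max 0 (g x) * indicator {t<..} x)" if g: "integrable lborel g" for g :: "real \<Rightarrow> real"
      using g by (intro Bochner_Integration.integrable_bound[OF g]) (auto simp: indicator_def intro!: AE_I2)
    show "emeasure ?P {t<..} < \<infinity>" using em[OF fi] by simp
    have "(LINT x|lborel. ?f x * indicator {t<..} x) =
        (LINT x|lborel. max 0 (?f x) * indicator {t<..} x - max 0 (- ?f x) * indicator {t<..} x)"
      by (intro Bochner_Integration.integral_cong) (auto simp: indicator_def max_def)
    also have "\<dots> = (LINT x|lborel. max 0 (?f x) * indicator {t<..} x) - (LINT x|lborel. max 0 (- ?f x) * indicator {t<..} x)"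
      using i[OF fi] i[of "\<lambda>x. - ?f x"] fi by (subst Bochner_Integration.integral_diff) auto
    finally show "emeasure ?P {t<..} = emeasure ?N {t<..}" using em[OF fi] em[of "\<lambda>x. - ?f x"] fi tail by simp
  qed auto
  then have "AE x in lborel. ennreal (?f x) = ennreal (- ?f x)"
    by (intro sigma_finite_measure.density_unique[OF sigma_finite_lborel]) auto
  then have "AE x in lborel. x \<in> {0..<L} \<longrightarrow> f x = 0"
  proof eventually_elim
    case (elim x)
    show ?case
    proof
      assume "x \<in> {0..<L}"
      then have e: "ennreal (f x) = ennreal (- f x)" using elim by simp
      show "f x = 0"
      proof (cases "f x \<ge> 0")
        case True
        then have "ennreal (f x) = 0" using e by (simp add: ennreal_neg)
        then show ?thesis using True by (simp add: ennreal_eq_0_iff)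
      next
        case False
        then have "ennreal (- f x) = 0" using e by (simp add: ennreal_neg)
        then show ?thesis using False by (simp add: ennreal_eq_0_iff)
      qed
    qed
  qed
  then show ?thesis unfolding circle_measure_def by (subst AE_restrict_space_iff) auto
qed

section \<open>Weakly differentiable functions on a circle\<close>

text \<open>Here \<open>h\<close> is the weak derivative of \<open>f\<close>, tested against trigonometric functions only; by
  Fourier uniqueness these suffice.\<close>

definition circle_weak_derivative :: "real \<Rightarrow> (real \<Rightarrow> real) \<Rightarrow> (real \<Rightarrow> real) \<Rightarrow> bool" where
  "circle_weak_derivative L f h \<longleftrightarrow>
     integrable (circle_measure L) f \<and> integrable (circle_measure L) h \<and>
     (\<forall>n \<theta>. (LINT x|circle_measure L. f x * (real n * (2 * pi / L) * wave L n (\<theta> + pi / 2) x)) =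
            - (LINT x|circle_measure L. h x * wave L n \<theta> x))"

lemma fst_circle_measurable [measurable]: "fst \<in> borel_measurable (circle_measure L \<Otimes>\<^sub>M M)"
  using measurable_compose[OF measurable_fst borel_measurable_circle[OF measurable_ident]] by (simp add: id_def)

lemma snd_circle_measurable [measurable]: "snd \<in> borel_measurable (M \<Otimes>\<^sub>M circle_measure L)"
  using measurable_compose[OF measurable_snd borel_measurable_circle[OF measurable_ident]] by (simp add: id_def)

lemma integral_circle_const: "L \<ge> 0 \<Longrightarrow> (LINT x|circle_measure L. (c :: real)) = L * c"
  by (simp add: measure_circle_measure_space)

lemma integral_circle_derivative_tail:
  fixes F f :: "real \<Rightarrow> real"
  assumes s: "0 \<le> s" "s < L" and F: "\<And>x. (F has_real_derivative f x) (at x)" and f: "continuous_on UNIV f"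
  shows "(LINT x|circle_measure L. (if s < x then f x else 0)) = F L - F s"
proof -
  have [measurable]: "f \<in> borel_measurable borel" using f by (rule borel_measurable_continuous_onI)
  have "(LINT x|circle_measure L. (if s < x then f x else 0)) = (LINT x|lborel. indicator {s..L} x *\<^sub>R f x)"
    unfolding integral_circle_eq
  proof (rule integral_cong_AE)
    show "AE x in lborel. indicator {0..<L} x *\<^sub>R (if s < x then f x else 0) = indicator {s..L} x *\<^sub>R f x"
      using AE_lborel_singleton[of s] AE_lborel_singleton[of L]
      by eventually_elim (use s in \<open>auto simp: indicator_def\<close>)
  qed measurable
  also have "\<dots> = F L - F s"
  proof (rule integral_FTC_atLeastAtMost)
    show "(F has_vector_derivative f x) (at x within {s..L})" for x
      using F has_field_derivative_at_within has_real_derivative_iff_has_vector_derivative by blast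
    show "continuous_on {s..L} f" using f by (rule continuous_on_subset) simp
  qed (use s in auto)
  finally show ?thesis .
qed

corollary integral_circle_derivative:
  fixes F f :: "real \<Rightarrow> real"
  assumes L: "L > 0" and F: "\<And>x. (F has_real_derivative f x) (at x)" and f: "continuous_on UNIV f"
  shows "(LINT x|circle_measure L. f x) = F L - F 0"
proof -
  have [measurable]: "f \<in> borel_measurable borel" using f by (rule borel_measurable_continuous_onI)
  have "(LINT x|circle_measure L. f x) = (LINT x|circle_measure L. (if 0 < x then f x else 0))"
  proof (rule integral_cong_AE)
    show "AE x in circle_measure L. f x = (if 0 < x then f x else 0)"
      unfolding circle_measure_def using AE_lborel_singleton[of 0]
      by (subst AE_restrict_space_iff) (auto elim!: eventually_mono)
  qed measurable
  also have "\<dots> = F L - F 0" using L by (intro integral_circle_derivative_tail F f) auto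
  finally show ?thesis .
qed

lemma continuous_wave_derivative: "continuous_on UNIV (\<lambda>x. c * wave L n \<theta> x)"
  unfolding wave_def by (intro continuous_intros)

text \<open>The primitive of \<open>h\<close> has the same weak derivative as \<open>f\<close>, so by Fourier uniqueness it differs from
  \<open>f\<close> by a constant. Two points bound two complementary arcs over which the integrals of \<open>h\<close> are
  opposite; averaging the two estimates gives the factor \<open>1/2\<close>.\<close>

lemma weak_derivative_representative:
  assumes L: "L > 0" and wd: "circle_weak_derivative L f h"
  obtains F where "AE x in circle_measure L. f x = F x"
    "\<And>x x'. x \<in> {0..<L} \<Longrightarrow> x' \<in> {0..<L} \<Longrightarrow> \<bar>F x - F x'\<bar> \<le> (LINT s|circle_measure L. \<bar>h s\<bar>) / 2"
proof -
  interpret finite_measure "circle_measure L" by (rule finite_measure_circle)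
  interpret P: pair_sigma_finite "circle_measure L" "circle_measure L" ..
  have f: "integrable (circle_measure L) f" and h: "integrable (circle_measure L) h"
    and weak: "\<And>n \<theta>. (LINT x|circle_measure L. f x * (real n * (2 * pi / L) * wave L n (\<theta> + pi / 2) x)) =
            - (LINT x|circle_measure L. h x * wave L n \<theta> x)"
    using wd by (auto simp: circle_weak_derivative_def)
  have [measurable]: "f \<in> borel_measurable (circle_measure L)" "h \<in> borel_measurable (circle_measure L)"
    using f h by auto
  (* The constant test function shows that a derivative on a circle has mean zero. *)
  have h0: "(LINT x|circle_measure L. h x) = 0"
    using weak[of 0 0] by (simp add: wave_0)
  have hS: "integrable (circle_measure L) (\<lambda>s. if s \<in> S then h s else 0)" if [measurable]: "S \<in> sets borel" for S
    using h by (rule Bochner_Integration.integrable_bound) (auto intro!: AE_I2)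
  define H where "H x = (LINT s|circle_measure L. (if s < x then h s else 0))" for x
  have Hm [measurable]: "H \<in> borel_measurable (circle_measure L)"
    unfolding H_def by (rule borel_measurable_lebesgue_integral) measurable
  have Hb: "\<bar>H x\<bar> \<le> (LINT s|circle_measure L. \<bar>h s\<bar>)" for x
    unfolding H_def using h hS[of "{..<x}"]
    by (intro order_trans[OF integral_abs_bound integral_mono]) auto
  have Hi: "integrable (circle_measure L) H"
    by (rule integrable_circle_bounded[OF Hm Hb])
  have osc: "\<bar>H x - H x'\<bar> \<le> (LINT s|circle_measure L. \<bar>h s\<bar>) / 2" if "x' \<le> x" for x x'
  proof -
    (* D and E are the integrals of h over the two arcs between x' and x; they add up to zero. *)
    let ?D = "LINT s|circle_measure L. (if s \<in> {x'..<x} then h s else 0)"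
    let ?E = "LINT s|circle_measure L. (if s \<in> - {x'..<x} then h s else 0)"
    have "H x - H x' = (LINT s|circle_measure L. (if s < x then h s else 0) - (if s < x' then h s else 0))"
      unfolding H_def using hS[of "{..<x}"] hS[of "{..<x'}"] by simp
    also have "\<dots> = ?D" using that by (intro Bochner_Integration.integral_cong) auto
    finally have D: "H x - H x' = ?D" .
    have "?D + ?E = (LINT s|circle_measure L. (if s \<in> {x'..<x} then h s else 0) + (if s \<in> - {x'..<x} then h s else 0))"
      using hS[of "{x'..<x}"] hS[of "- {x'..<x}"] by simp
    also have "\<dots> = (LINT s|circle_measure L. h s)" by (intro Bochner_Integration.integral_cong) auto
    finally have "?D + ?E = 0" using h0 by simp
    moreover have "\<bar>?D\<bar> + \<bar>?E\<bar> \<le> (LINT s|circle_measure L. \<bar>if s \<in> {x'..<x} then h s else 0\<bar>)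
        + (LINT s|circle_measure L. \<bar>if s \<in> - {x'..<x} then h s else 0\<bar>)"
      by (intro add_mono integral_abs_bound)
    moreover have "\<dots> = (LINT s|circle_measure L. \<bar>if s \<in> {x'..<x} then h s else 0\<bar> + \<bar>if s \<in> - {x'..<x} then h s else 0\<bar>)"
      using hS[of "{x'..<x}"] hS[of "- {x'..<x}"] by simp
    moreover have "\<dots> = (LINT s|circle_measure L. \<bar>h s\<bar>)" by (intro Bochner_Integration.integral_cong) auto
    ultimately show ?thesis using D by linarith
  qed
  have parts: "(LINT x|circle_measure L. H x * (real n * (2 * pi / L) * wave L n (\<theta> + pi / 2) x)) =
            - (LINT x|circle_measure L. h x * wave L n \<theta> x)" for n \<theta>
  proof -
    let ?w = "\<lambda>x. real n * (2 * pi / L) * wave L n (\<theta> + pi / 2) x"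
    have wb: "\<bar>?w x\<bar> \<le> real n * (2 * pi / L)" for x
      using mult_left_mono[OF abs_wave_le[of L n "\<theta> + pi / 2" x], of "real n * (2 * pi / L)"] L
      by (simp add: abs_mult)
    have int: "integrable (circle_measure L \<Otimes>\<^sub>M circle_measure L) (\<lambda>(x, s). h s * (if s < x then ?w x else 0))"
    proof (rule Bochner_Integration.integrable_bound[where f = "\<lambda>(x, s). \<bar>h s\<bar> * (real n * (2 * pi / L))"])
      show "integrable (circle_measure L \<Otimes>\<^sub>M circle_measure L) (\<lambda>(x, s). \<bar>h s\<bar> * (real n * (2 * pi / L)))"
        by (rule P.Fubini_integrable)
          (use h finite_measure.integrable_const[OF finite_measure_circle] in \<open>auto simp: split_beta'\<close>)
      show "AE p in circle_measure L \<Otimes>\<^sub>M circle_measure L.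
          norm (case p of (x, s) \<Rightarrow> h s * (if s < x then ?w x else 0)) \<le> norm (case p of (x, s) \<Rightarrow> \<bar>h s\<bar> * (real n * (2 * pi / L)))"
      proof (rule AE_I2)
        fix p :: "real \<times> real"
        obtain x s where p: "p = (x, s)" by (cases p)
        have "0 \<le> real n * (2 * pi / L)" using L by simp
        then have "\<bar>if s < x then ?w x else 0\<bar> \<le> \<bar>real n * (2 * pi / L)\<bar>" using wb[of x] by (simp only: abs_of_nonneg split: if_split) simp
        then have "\<bar>h s\<bar> * \<bar>if s < x then ?w x else 0\<bar> \<le> \<bar>h s\<bar> * \<bar>real n * (2 * pi / L)\<bar>" by (rule mult_left_mono) simp
        then show "norm (case p of (x, s) \<Rightarrow> h s * (if s < x then ?w x else 0)) \<le> norm (case p of (x, s) \<Rightarrow> \<bar>h s\<bar> * (real n * (2 * pi / L)))"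
          unfolding p real_norm_def prod.case abs_mult abs_idempotent .
      qed
    qed measurable
    have "(LINT x|circle_measure L. H x * ?w x) = (LINT x|circle_measure L. LINT s|circle_measure L. h s * (if s < x then ?w x else 0))"
    proof (intro Bochner_Integration.integral_cong refl)
      fix x
      have "H x * ?w x = (LINT s|circle_measure L. (if s < x then h s else 0) * ?w x)"
        unfolding H_def by (rule integral_mult_left_zero[symmetric])
      also have "\<dots> = (LINT s|circle_measure L. h s * (if s < x then ?w x else 0))"
        by (intro Bochner_Integration.integral_cong) auto
      finally show "H x * ?w x = \<dots>" .
    qed
    also have "\<dots> = (LINT s|circle_measure L. LINT x|circle_measure L. h s * (if s < x then ?w x else 0))"
      using P.Fubini_integral[of "\<lambda>x s. h s * (if s < x then ?w x else 0)"] int by simp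
    also have "\<dots> = (LINT s|circle_measure L. h s * (wave L n \<theta> L - wave L n \<theta> s))"
      by (intro Bochner_Integration.integral_cong refl) (simp add: integral_circle_derivative_tail[OF _ _ DERIV_wave continuous_wave_derivative])
    also have "\<dots> = (LINT s|circle_measure L. wave L n \<theta> L * h s - h s * wave L n \<theta> s)"
      by (simp add: algebra_simps)
    also have "\<dots> = - (LINT x|circle_measure L. h x * wave L n \<theta> x)"
      using h integrable_mult_wave[OF h] h0 by simp
    finally show ?thesis .
  qed
  define c where "c = (LINT x|circle_measure L. f x - H x) / L"
  have "AE x in circle_measure L. f x - H x - c = 0"
  proof (rule fourier_uniqueness[OF _ L])
    show fHc: "integrable (circle_measure L) (\<lambda>x. f x - H x - c)" using f Hi by simp
    show "(LINT x|circle_measure L. (f x - H x - c) * wave L n \<theta> x) = 0" for n \<theta>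
    proof (cases "n = 0")
      case True
      then show ?thesis using f Hi L by (simp add: wave_0 c_def integral_circle_const measure_circle_measure_space)
    next
      case False
      (* For n > 0 each wave is itself the derivative of a wave, so f and H integrate to the same value
         against it. *)
      let ?k = "real n * (2 * pi / L)"
      have k: "?k \<noteq> 0" using False L by simp
      have z: "(LINT x|circle_measure L. u x * wave L n \<theta> x) = (LINT x|circle_measure L. u x * (?k * wave L n (\<theta> - pi / 2 + pi / 2) x)) / ?k" for u
      proof -
        have "(LINT x|circle_measure L. u x * (?k * wave L n (\<theta> - pi / 2 + pi / 2) x))
            = (LINT x|circle_measure L. ?k * (u x * wave L n \<theta> x))"
          by (intro Bochner_Integration.integral_cong) (simp_all only: diff_add_cancel mult.left_commute)
        also have "\<dots> = ?k * (LINT x|circle_measure L. u x * wave L n \<theta> x)"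
          by (rule integral_mult_right_zero)
        finally show ?thesis using k by simp
      qed
      have c0: "(LINT x|circle_measure L. wave L n \<theta> x) = 0"
      proof -
        have "?k * (LINT x|circle_measure L. wave L n \<theta> x) = (LINT x|circle_measure L. ?k * wave L n (\<theta> - pi / 2 + pi / 2) x)"
          by simp
        also have "\<dots> = 0"
          using integral_circle_derivative[OF L DERIV_wave[of L n "\<theta> - pi / 2"] continuous_wave_derivative] wave_periodic[of L n "\<theta> - pi / 2" 0] L
          by simp
        finally show ?thesis using k by simp
      qed
      have "(LINT x|circle_measure L. (f x - H x - c) * wave L n \<theta> x) =
        (LINT x|circle_measure L. f x * wave L n \<theta> x - H x * wave L n \<theta> x - c * wave L n \<theta> x)"
        by (simp add: algebra_simps)
      also have "\<dots> = (LINT x|circle_measure L. f x * wave L n \<theta> x) - (LINT x|circle_measure L. H x * wave L n \<theta> x)"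
        using integrable_mult_wave[OF f] integrable_mult_wave[OF Hi] integrable_mult_wave[of L "\<lambda>_. c" n \<theta>] c0 by simp
      also have "\<dots> = 0" unfolding z[of f] z[of H] weak parts by simp
      finally show ?thesis .
    qed
  qed
  then have 1: "AE x in circle_measure L. f x = H x + c" by eventually_elim simp
  have 2: "\<bar>(H x + c) - (H x' + c)\<bar> \<le> (LINT s|circle_measure L. \<bar>h s\<bar>) / 2" for x x'
    using osc[of x x'] osc[of x' x] by (cases "x' \<le> x") (auto simp: abs_minus_commute)
  show thesis using that[OF 1] 2 by blast
qed

text \<open>Expand \<open>\<integral>(\<bar>h\<bar> - m)\<^sup>2 \<ge> 0\<close>, where \<open>m\<close> is the mean of \<open>\<bar>h\<bar>\<close>.\<close>

lemma circle_Cauchy_Schwarz: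
  assumes L: "L > 0" and h: "integrable (circle_measure L) h" "integrable (circle_measure L) (\<lambda>x. (h x)\<^sup>2)"
  shows "(LINT x|circle_measure L. \<bar>h x\<bar>)\<^sup>2 \<le> L * (LINT x|circle_measure L. (h x)\<^sup>2)"
proof -
  let ?I = "LINT x|circle_measure L. \<bar>h x\<bar>"
  let ?m = "?I / L"
  have c: "integrable (circle_measure L) (\<lambda>x. ?m\<^sup>2)"
    using finite_measure.integrable_const[OF finite_measure_circle] .
  have "0 \<le> (LINT x|circle_measure L. (\<bar>h x\<bar> - ?m)\<^sup>2)" by simp
  also have "\<dots> = (LINT x|circle_measure L. (h x)\<^sup>2 - 2 * ?m * \<bar>h x\<bar> + ?m\<^sup>2)"
    by (intro Bochner_Integration.integral_cong) (auto simp: power2_diff)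
  also have "\<dots> = (LINT x|circle_measure L. (h x)\<^sup>2) - 2 * ?m * ?I + L * ?m\<^sup>2"
    using h c L by (simp add: integral_circle_const measure_circle_measure_space)
  also have "\<dots> = (LINT x|circle_measure L. (h x)\<^sup>2) - ?I\<^sup>2 / L"
    using L by (simp add: field_simps power2_eq_square)
  finally show ?thesis using L by (simp add: field_simps)
qed

text \<open>The mean minimises \<open>\<integral>(f - c)\<^sup>2\<close> over all constants \<open>c\<close>, so \<open>c\<close> may be taken in the middle of the
  range of \<open>f\<close>, at distance at most a quarter of \<open>\<integral>\<bar>h\<bar>\<close> from all values. The constant \<open>L\<^sup>2/16\<close> is worse
  than the sharp \<open>L\<^sup>2/(4\<pi>\<^sup>2)\<close>, but for \<open>L = 2\<pi>\<close> it equals \<open>\<pi>\<^sup>2/4 < 4\<close>, which is good enough for the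
  spectral gap.\<close>

lemma circle_wirtinger:
  assumes L: "L > 0" and wd: "circle_weak_derivative L f h"
    and f2: "integrable (circle_measure L) (\<lambda>x. (f x)\<^sup>2)" and h2: "integrable (circle_measure L) (\<lambda>x. (h x)\<^sup>2)"
    and f0: "(LINT x|circle_measure L. f x) = 0"
  shows "(LINT x|circle_measure L. (f x)\<^sup>2) \<le> L\<^sup>2 / 16 * (LINT x|circle_measure L. (h x)\<^sup>2)"
proof -
  have f: "integrable (circle_measure L) f" and h: "integrable (circle_measure L) h"
    using wd by (auto simp: circle_weak_derivative_def)
  let ?J = "LINT s|circle_measure L. \<bar>h s\<bar>"
  obtain F where F: "AE x in circle_measure L. f x = F x"
    and osc: "\<And>x x'. x \<in> {0..<L} \<Longrightarrow> x' \<in> {0..<L} \<Longrightarrow> \<bar>F x - F x'\<bar> \<le> ?J / 2"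
    using weak_derivative_representative[OF L wd] by blast
  (* All values of F lie within a quarter of the integral of the midpoint c of [b, b + J / 2]. *)
  define b where "b = Inf (F ` {0..<L})"
  have ne: "F ` {0..<L} \<noteq> {}" using L by auto
  have bdd: "bdd_below (F ` {0..<L})"
  proof (rule bdd_belowI2)
    show "F 0 - ?J / 2 \<le> F x" if "x \<in> {0..<L}" for x
    proof -
      have "\<bar>F 0 - F x\<bar> \<le> ?J / 2" using osc[of 0 x] that L by simp
      then show ?thesis by linarith
    qed
  qed
  have lo: "b \<le> F x" if "x \<in> {0..<L}" for x unfolding b_def using bdd that by (intro cINF_lower)
  have up: "F x - ?J / 2 \<le> b" if x: "x \<in> {0..<L}" for x
    unfolding b_def
  proof (rule cINF_greatest)
    show "F x - ?J / 2 \<le> F x'" if "x' \<in> {0..<L}" for x' using osc[OF x that] by linarith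
  qed (use L in auto)
  define c where "c = b + ?J / 4"
  have c: "\<bar>F x - c\<bar> \<le> ?J / 4" if "x \<in> {0..<L}" for x
    using lo[OF that] up[OF that] unfolding c_def abs_le_iff by linarith
  have i: "integrable (circle_measure L) (\<lambda>x. (f x)\<^sup>2 - 2 * c * f x + c\<^sup>2)"
    by (intro Bochner_Integration.integrable_add Bochner_Integration.integrable_diff integrable_mult_right f f2
        finite_measure.integrable_const[OF finite_measure_circle])
  have "(LINT x|circle_measure L. (f x)\<^sup>2) \<le> (LINT x|circle_measure L. (f x)\<^sup>2) + L * c\<^sup>2" using L by simp
  also have "\<dots> = (LINT x|circle_measure L. (f x)\<^sup>2 - 2 * c * f x + c\<^sup>2)"
    using f f2 f0 L finite_measure.integrable_const[OF finite_measure_circle, of L "c\<^sup>2"]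
    by (simp add: measure_circle_measure_space)
  also have "\<dots> \<le> (LINT x|circle_measure L. (?J / 4)\<^sup>2)"
  proof (rule integral_mono_AE[OF i])
    show "integrable (circle_measure L) (\<lambda>x. (?J / 4)\<^sup>2)"
      using finite_measure.integrable_const[OF finite_measure_circle] .
    show "AE x in circle_measure L. (f x)\<^sup>2 - 2 * c * f x + c\<^sup>2 \<le> (?J / 4)\<^sup>2"
      using F AE_space
    proof eventually_elim
      case (elim x)
      then have "\<bar>f x - c\<bar>\<^sup>2 \<le> (?J / 4)\<^sup>2" using c[of x] by (intro power_mono) auto
      then show ?case by (simp add: power2_diff mult.commute mult.left_commute)
    qed
  qed
  also have "\<dots> = L / 16 * ?J\<^sup>2" using L by (simp add: measure_circle_measure_space power_divide)
  also have "\<dots> \<le> L / 16 * (L * (LINT x|circle_measure L. (h x)\<^sup>2))"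
    using circle_Cauchy_Schwarz[OF L h h2] L by (intro mult_left_mono) auto
  finally show ?thesis by (simp add: power2_eq_square)
qed

text \<open>A weakly differentiable function is bounded by its \<open>H\<^sup>1\<close> norm, so little of its mass lies on a small
  set.\<close>

lemma circle_local_bound:
  assumes L: "L > 0" and wd: "circle_weak_derivative L f h"
    and f2: "integrable (circle_measure L) (\<lambda>x. (f x)\<^sup>2)" and h2: "integrable (circle_measure L) (\<lambda>x. (h x)\<^sup>2)"
    and A [measurable]: "A \<in> sets (circle_measure L)"
  shows "(LINT x|circle_measure L. indicator A x * (f x)\<^sup>2) \<le>
    measure (circle_measure L) A *
      (2 / L * (LINT x|circle_measure L. (f x)\<^sup>2) + L / 2 * (LINT x|circle_measure L. (h x)\<^sup>2))"
proof -
  have f: "integrable (circle_measure L) f" and h: "integrable (circle_measure L) h"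
    using wd by (auto simp: circle_weak_derivative_def)
  let ?J = "LINT s|circle_measure L. \<bar>h s\<bar>"
  let ?K = "2 / L * (LINT x|circle_measure L. (f x)\<^sup>2) + L / 2 * (LINT x|circle_measure L. (h x)\<^sup>2)"
  obtain F where F: "AE x in circle_measure L. f x = F x"
    and osc: "\<And>x x'. x \<in> {0..<L} \<Longrightarrow> x' \<in> {0..<L} \<Longrightarrow> \<bar>F x - F x'\<bar> \<le> ?J / 2"
    using weak_derivative_representative[OF L wd] by blast
  have pt: "(F x)\<^sup>2 \<le> ?K" if x: "x \<in> {0..<L}" for x
  proof -
    have "L * (F x)\<^sup>2 = (LINT x'|circle_measure L. (F x)\<^sup>2)" using L by (simp add: measure_circle_measure_space)
    also have "\<dots> \<le> (LINT x'|circle_measure L. 2 * (f x')\<^sup>2 + ?J\<^sup>2 / 2)"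
    proof (rule integral_mono_AE)
      show "AE x' in circle_measure L. (F x)\<^sup>2 \<le> 2 * (f x')\<^sup>2 + ?J\<^sup>2 / 2"
        using F AE_space
      proof eventually_elim
        case (elim x')
        have "\<bar>F x - F x'\<bar>\<^sup>2 \<le> (?J / 2)\<^sup>2" using osc[of x x'] elim x by (intro power_mono) auto
        moreover have "(F x)\<^sup>2 \<le> 2 * (F x')\<^sup>2 + 2 * \<bar>F x - F x'\<bar>\<^sup>2"
          using zero_le_power2[of "F x - 2 * F x'"] by (simp add: power2_eq_square algebra_simps)
        ultimately show ?case using elim by (simp add: power_divide)
      qed
      show "integrable (circle_measure L) (\<lambda>x'. 2 * (f x')\<^sup>2 + ?J\<^sup>2 / 2)"
        by (intro Bochner_Integration.integrable_add integrable_mult_right f2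
            finite_measure.integrable_const[OF finite_measure_circle])
    qed (rule finite_measure.integrable_const[OF finite_measure_circle])
    also have "\<dots> = 2 * (LINT x|circle_measure L. (f x)\<^sup>2) + L * (?J\<^sup>2 / 2)"
      using f2 L finite_measure.integrable_const[OF finite_measure_circle]
      by (subst Bochner_Integration.integral_add) (auto simp: measure_circle_measure_space)
    also have "\<dots> \<le> 2 * (LINT x|circle_measure L. (f x)\<^sup>2) + L * (L * (LINT x|circle_measure L. (h x)\<^sup>2) / 2)"
      using circle_Cauchy_Schwarz[OF L h h2] L by simp
    also have "\<dots> = L * ?K" using L by (simp add: field_simps)
    finally show ?thesis using L by simp
  qed
  have "(LINT x|circle_measure L. indicator A x * (f x)\<^sup>2) \<le> (LINT x|circle_measure L. indicator A x * ?K)"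
  proof (rule integral_mono_AE)
    show "integrable (circle_measure L) (\<lambda>x. indicator A x * (f x)\<^sup>2)"
      using integrable_mult_indicator[OF A f2] by simp
    show "integrable (circle_measure L) (\<lambda>x. indicator A x * ?K)"
      using integrable_mult_indicator[OF A, of "\<lambda>_. ?K", OF finite_measure.integrable_const[OF finite_measure_circle]]
      by (simp only: real_scaleR_def)
    show "AE x in circle_measure L. indicator A x * (f x)\<^sup>2 \<le> indicator A x * ?K"
      using F AE_space
    proof eventually_elim
      case (elim x)
      show ?case by (rule mult_left_mono) (use pt[of x] elim in simp_all)
    qed
  qed
  also have "\<dots> = measure (circle_measure L) A * ?K"
    using sets.sets_into_space[OF A] by (simp add: Int_absorb2)
  finally show ?thesis .
qed

section \<open>A Poincare inequality on a product of two circles\<close>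

abbreviation rect_measure :: "real \<Rightarrow> real \<Rightarrow> (real \<times> real) measure" where
  "rect_measure A B \<equiv> circle_measure A \<Otimes>\<^sub>M circle_measure B"

lemma pair_sigma_finite_circle: "pair_sigma_finite (circle_measure A) (circle_measure B)"
proof -
  interpret M1: finite_measure "circle_measure A" by (rule finite_measure_circle)
  interpret M2: finite_measure "circle_measure B" by (rule finite_measure_circle)
  show ?thesis ..
qed

lemma finite_measure_circle_pair: "finite_measure (rect_measure A B)"
  by (intro finite_measure_pair_measure finite_measure_circle)

text \<open>By Fubini the integral over vertical slices is a function of \<open>x\<close> all of whose Fourier coefficients
  vanish.\<close>

lemma slice_mean_zero:
  assumes A: "A > 0" and U: "integrable (rect_measure A B) (\<lambda>(x, y). U x y)"
    and orth: "\<And>n \<theta>. (LINT (x, y)|rect_measure A B. U x y * wave A n \<theta> x) = 0"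
  shows "AE x in circle_measure A. (LINT y|circle_measure B. U x y) = (0 :: real)"
proof -
  interpret pair_sigma_finite "circle_measure A" "circle_measure B" by (rule pair_sigma_finite_circle)
  show ?thesis
  proof (rule fourier_uniqueness[OF _ A])
    show "integrable (circle_measure A) (\<lambda>x. LINT y|circle_measure B. U x y)"
      using integrable_fst[OF U] .
    fix n \<theta>
    have i: "integrable (rect_measure A B) (\<lambda>(x, y). U x y * wave A n \<theta> x)"
      using integrable_mult_bounded[OF U, of "\<lambda>(x, y). wave A n \<theta> x" 1] abs_wave_le
      by (simp add: split_beta')
    have "(LINT x|circle_measure A. (LINT y|circle_measure B. U x y) * wave A n \<theta> x)
       = (LINT x|circle_measure A. LINT y|circle_measure B. U x y * wave A n \<theta> x)"
      by simp
    also have "\<dots> = 0" using integral_fst[OF i] orth by simp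
    finally show "(LINT x|circle_measure A. (LINT y|circle_measure B. U x y) * wave A n \<theta> x) = 0" .
  qed
qed

text \<open>Two phases suffice, since every phase is a combination of them. The reduction to countably many
  test functions is what allows an almost-everywhere statement for slices.\<close>

lemma circle_weak_derivativeI:
  assumes f: "integrable (circle_measure L) f" and h: "integrable (circle_measure L) h"
    and "\<And>n. (LINT x|circle_measure L. f x * (real n * (2 * pi / L) * wave L n (0 + pi / 2) x) + h x * wave L n 0 x) = 0"
    and "\<And>n. (LINT x|circle_measure L. f x * (real n * (2 * pi / L) * wave L n (pi / 2 + pi / 2) x) + h x * wave L n (pi / 2) x) = 0"
  shows "circle_weak_derivative L f h"
  unfolding circle_weak_derivative_def
proof (intro conjI f h allI)
  fix n \<theta>
  let ?k = "real n * (2 * pi / L)"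
  define g where "g \<phi> x = f x * (?k * wave L n (\<phi> + pi / 2) x) + h x * wave L n \<phi> x" for \<phi> x
  have fw: "integrable (circle_measure L) (\<lambda>x. f x * (?k * wave L n \<phi> x))" for \<phi>
    using integrable_mult_right[OF integrable_mult_wave[OF f, of n \<phi>], of ?k] by (simp only: mult.left_commute)
  have gi: "integrable (circle_measure L) (g \<phi>)" for \<phi>
    unfolding g_def using fw integrable_mult_wave[OF h] by (intro Bochner_Integration.integrable_add)
  have w: "wave L n (\<theta> + pi / 2) x = cos \<theta> * wave L n (0 + pi / 2) x + sin \<theta> * wave L n (pi / 2 + pi / 2) x" for x
    by (simp add: wave_def cos_add sin_add algebra_simps)
  have "g \<theta> x = cos \<theta> * g 0 x + sin \<theta> * g (pi / 2) x" for x
    unfolding g_def w wave_phase[of L n \<theta>] by (simp add: algebra_simps)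
  then have "(LINT x|circle_measure L. g \<theta> x) = (LINT x|circle_measure L. cos \<theta> * g 0 x + sin \<theta> * g (pi / 2) x)"
    by simp
  also have "\<dots> = cos \<theta> * (LINT x|circle_measure L. g 0 x) + sin \<theta> * (LINT x|circle_measure L. g (pi / 2) x)"
    using gi by simp
  also have "\<dots> = 0" using assms(3)[of n] assms(4)[of n] unfolding g_def by simp
  finally have "(LINT x|circle_measure L. f x * (?k * wave L n (\<theta> + pi / 2) x)) + (LINT x|circle_measure L. h x * wave L n \<theta> x) = 0"
    unfolding g_def using fw integrable_mult_wave[OF h] by simp
  then show "(LINT x|circle_measure L. f x * (?k * wave L n (\<theta> + pi / 2) x)) = - (LINT x|circle_measure L. h x * wave L n \<theta> x)"
    by linarith
qed

text \<open>A weak partial derivative in the plane restricts to a weak derivative on almost every slice: for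
  each fixed \<open>m\<close> and \<open>\<phi>\<close> the defect of the identity on the slice over \<open>x\<close> is, as a function of \<open>x\<close>,
  orthogonal to all waves.\<close>

lemma slice_weak_derivative:
  assumes A: "A > 0" and B: "B > 0" and [measurable]: "S \<in> sets borel"
    and U: "integrable (rect_measure A B) (\<lambda>(x, y). U x y)"
    and G: "integrable (rect_measure A B) (\<lambda>(x, y). G x y)"
    and weak: "\<And>n \<theta> m \<phi>.
      (LINT (x, y)|rect_measure A B.
        indicator S x * U x y * (wave A n \<theta> x * (real m * (2 * pi / B) * wave B m (\<phi> + pi / 2) y)))
      = - (LINT (x, y)|rect_measure A B. indicator S x * G x y * (wave A n \<theta> x * wave B m \<phi> y))"
  shows "AE x in circle_measure A. x \<in> S \<longrightarrow> circle_weak_derivative B (U x) (G x)"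
proof -
  interpret pair_sigma_finite "circle_measure A" "circle_measure B" by (rule pair_sigma_finite_circle)
  let ?Q = "rect_measure A B"
  let ?W = "\<lambda>m \<phi> x y. indicator S x * (U x y * (real m * (2 * pi / B) * wave B m (\<phi> + pi / 2) y) + G x y * wave B m \<phi> y)"
  have bw: "\<bar>real m * (2 * pi / B) * wave B m \<phi> y\<bar> \<le> real m * (2 * pi / B)" for m \<phi> y
    using mult_left_mono[OF abs_wave_le[of B m \<phi> y], of "real m * (2 * pi / B)"] B by (simp add: abs_mult)
  have ind: "\<bar>indicator S x * c\<bar> \<le> \<bar>c\<bar>" for x and c :: real by (simp add: indicator_def)
  have "AE x in circle_measure A. (LINT y|circle_measure B. ?W m \<phi> x y) = 0" for m \<phi>
  proof (rule slice_mean_zero[OF A])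
    have UW: "integrable ?Q (\<lambda>p. (case p of (x, y) \<Rightarrow> U x y) * (indicator S (fst p) * (real m * (2 * pi / B) * wave B m \<phi>' (snd p))))" for \<phi>'
      by (rule integrable_mult_bounded[OF U _ order_trans[OF ind bw]]) measurable
    have GW: "integrable ?Q (\<lambda>p. (case p of (x, y) \<Rightarrow> G x y) * (indicator S (fst p) * wave B m \<phi>' (snd p)))" for \<phi>'
      by (rule integrable_mult_bounded[OF G _ order_trans[OF ind abs_wave_le]]) measurable
    have "?W m \<phi> (fst p) (snd p) = (case p of (x, y) \<Rightarrow> U x y) * (indicator S (fst p) * (real m * (2 * pi / B) * wave B m (\<phi> + pi / 2) (snd p)))
       + (case p of (x, y) \<Rightarrow> G x y) * (indicator S (fst p) * wave B m \<phi> (snd p))" for p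
      by (simp add: split_beta' algebra_simps)
    then show Wi: "integrable ?Q (\<lambda>(x, y). ?W m \<phi> x y)"
      using Bochner_Integration.integrable_add[OF UW GW] by (simp add: split_beta')
    fix n \<theta>
    have wm: "(\<lambda>p. wave A n \<theta> (fst p)) \<in> borel_measurable ?Q" by measurable
    have e1: "integrable ?Q (\<lambda>(x, y). indicator S x * U x y * (wave A n \<theta> x * (real m * (2 * pi / B) * wave B m (\<phi> + pi / 2) y)))"
      using integrable_mult_bounded[OF UW[of "\<phi> + pi / 2"] wm abs_wave_le] by (simp add: split_beta' algebra_simps)
    have e2: "integrable ?Q (\<lambda>(x, y). indicator S x * G x y * (wave A n \<theta> x * wave B m \<phi> y))"
      using integrable_mult_bounded[OF GW[of \<phi>] wm abs_wave_le] by (simp add: split_beta' algebra_simps)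
    have "(LINT (x, y)|?Q. ?W m \<phi> x y * wave A n \<theta> x) =
      (LINT p|?Q. (case p of (x, y) \<Rightarrow> indicator S x * U x y * (wave A n \<theta> x * (real m * (2 * pi / B) * wave B m (\<phi> + pi / 2) y)))
        + (case p of (x, y) \<Rightarrow> indicator S x * G x y * (wave A n \<theta> x * wave B m \<phi> y)))"
      by (intro Bochner_Integration.integral_cong refl) (simp add: split_beta' algebra_simps)
    also have "\<dots> = 0" unfolding Bochner_Integration.integral_add[OF e1 e2] using weak[of n \<theta> m \<phi>] by simp
    finally show "(LINT (x, y)|?Q. ?W m \<phi> x y * wave A n \<theta> x) = 0" .
  qed
  then have "AE x in circle_measure A. \<forall>m. (LINT y|circle_measure B. ?W m 0 x y) = 0"
    and "AE x in circle_measure A. \<forall>m. (LINT y|circle_measure B. ?W m (pi / 2) x y) = 0"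
    unfolding AE_all_countable by blast+
  then show ?thesis using AE_integrable_fst[OF U] AE_integrable_fst[OF G]
  proof eventually_elim
    case (elim x)
    show ?case
    proof
      assume "x \<in> S"
      then show "circle_weak_derivative B (U x) (G x)"
        using elim by (intro circle_weak_derivativeI) auto
    qed
  qed
qed

text \<open>The derivative in \<open>y\<close> is assumed to exist only over \<open>x \<in> S\<close>, that is, away from the cracks. Over
  \<open>S\<close> the vertical slices have mean zero and satisfy \<open>circle_wirtinger\<close>; over the complement of
  \<open>S\<close> the function is controlled along the horizontal slices by \<open>circle_local_bound\<close>, at the price
  of the measure of that complement.\<close>

lemma torus_poincare:
  assumes A: "A > 0" and B: "B > 0" and S [measurable]: "S \<in> sets borel"
    and [measurable]: "(\<lambda>(x, y). U x y) \<in> borel_measurable (rect_measure A B)"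
      "(\<lambda>(x, y). G x y) \<in> borel_measurable (rect_measure A B)"
      "(\<lambda>(x, y). H x y) \<in> borel_measurable (rect_measure A B)"
    and U2: "integrable (rect_measure A B) (\<lambda>(x, y). (U x y)\<^sup>2)"
    and G2: "integrable (rect_measure A B) (\<lambda>(x, y). (G x y)\<^sup>2)"
    and H2: "integrable (rect_measure A B) (\<lambda>(x, y). (H x y)\<^sup>2)"
    and weak_x: "\<And>n \<theta> m \<phi>.
      (LINT (x, y)|rect_measure A B.
        U x y * ((real n * (2 * pi / A) * wave A n (\<theta> + pi / 2) x) * wave B m \<phi> y))
      = - (LINT (x, y)|rect_measure A B. G x y * (wave A n \<theta> x * wave B m \<phi> y))"
    and weak_y: "\<And>n \<theta> m \<phi>.
      (LINT (x, y)|rect_measure A B.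
        indicator S x * U x y * (wave A n \<theta> x * (real m * (2 * pi / B) * wave B m (\<phi> + pi / 2) y)))
      = - (LINT (x, y)|rect_measure A B. indicator S x * H x y * (wave A n \<theta> x * wave B m \<phi> y))"
    and orth: "\<And>n \<theta>. (LINT (x, y)|rect_measure A B. U x y * wave A n \<theta> x) = 0"
  shows "(LINT (x, y)|rect_measure A B. (U x y)\<^sup>2)
    \<le> B\<^sup>2 / 16 * (LINT (x, y)|rect_measure A B. (H x y)\<^sup>2)
      + measure (circle_measure A) ({0..<A} - S) *
        (2 / A * (LINT (x, y)|rect_measure A B. (U x y)\<^sup>2)
          + A / 2 * (LINT (x, y)|rect_measure A B. (G x y)\<^sup>2))"
proof -
  interpret P: pair_sigma_finite "circle_measure A" "circle_measure B" by (rule pair_sigma_finite_circle)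
  let ?Q = "rect_measure A B"
  let ?T = "{0..<A} - S"
  let ?\<mu> = "measure (circle_measure A) ?T"
  have square: "integrable ?Q (\<lambda>(x, y). f x y)" if "(\<lambda>(x, y). f x y) \<in> borel_measurable ?Q" "integrable ?Q (\<lambda>(x, y). (f x y)\<^sup>2)" for f :: "real \<Rightarrow> real \<Rightarrow> real"
  proof -
    have "(\<lambda>p. (case p of (x, y) \<Rightarrow> f x y)\<^sup>2) = (\<lambda>(x, y). (f x y)\<^sup>2)" by auto
    then show ?thesis
      using finite_measure.square_integrable_imp_integrable[OF finite_measure_circle_pair that(1)] that(2) by simp
  qed
  have U: "integrable ?Q (\<lambda>(x, y). U x y)" and G: "integrable ?Q (\<lambda>(x, y). G x y)" and H: "integrable ?Q (\<lambda>(x, y). H x y)"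
    by (rule square[OF _ U2], measurable, rule square[OF _ G2], measurable, rule square[OF _ H2], measurable)
  have [measurable]: "S \<inter> {0..<A} \<in> sets (circle_measure A)" "?T \<in> sets (circle_measure A)"
    using S by (auto simp: circle_measure_def sets_restrict_space_iff)
  have meas: "(\<lambda>p. indicator S (fst p) :: real) \<in> borel_measurable ?Q" "(\<lambda>p. indicator ?T (fst p) :: real) \<in> borel_measurable ?Q"
    by measurable
  have Si: "integrable ?Q (\<lambda>(x, y). indicator S x * (f x y)\<^sup>2)" "integrable ?Q (\<lambda>(x, y). indicator ?T x * (f x y)\<^sup>2)"
    if f: "integrable ?Q (\<lambda>(x, y). (f x y)\<^sup>2)" for f :: "real \<Rightarrow> real \<Rightarrow> real"
  proof -
    have "(\<lambda>p. (case p of (x, y) \<Rightarrow> (f x y)\<^sup>2) * indicator R (fst p)) = (\<lambda>(x, y). indicator R x * (f x y)\<^sup>2)" for R :: "real set"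
      by auto
    then have "integrable ?Q (\<lambda>(x, y). indicator R x * (f x y)\<^sup>2)"
      if "(\<lambda>p. indicator R (fst p) :: real) \<in> borel_measurable ?Q" for R
      using integrable_mult_bounded[OF f that, of 1] by (simp only: indicator_abs_le_1)
    from this[OF meas(1)] this[OF meas(2)]
    show "integrable ?Q (\<lambda>(x, y). indicator S x * (f x y)\<^sup>2)" "integrable ?Q (\<lambda>(x, y). indicator ?T x * (f x y)\<^sup>2)" .
  qed
  have outer: "(LINT (x, y)|?Q. indicator S x * (U x y)\<^sup>2) \<le> B\<^sup>2 / 16 * (LINT (x, y)|?Q. (H x y)\<^sup>2)"
  proof -
    have sl: "AE x in circle_measure A. (LINT y|circle_measure B. indicator S x * (U x y)\<^sup>2) \<le> B\<^sup>2 / 16 * (LINT y|circle_measure B. (H x y)\<^sup>2)"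
      using slice_mean_zero[OF A U orth] slice_weak_derivative[OF A B S U H weak_y]
        P.AE_integrable_fst[OF U2] P.AE_integrable_fst[OF H2]
    proof eventually_elim
      case (elim x)
      show ?case
      proof (cases "x \<in> S")
        case True
        then show ?thesis using circle_wirtinger[OF B _ elim(3,4,1)] elim(2) by simp
      qed simp
    qed
    have "(LINT (x, y)|?Q. indicator S x * (U x y)\<^sup>2) = (LINT x|circle_measure A. LINT y|circle_measure B. indicator S x * (U x y)\<^sup>2)"
      using P.integral_fst[OF Si(1)[OF U2]] by simp
    also have "\<dots> \<le> (LINT x|circle_measure A. B\<^sup>2 / 16 * (LINT y|circle_measure B. (H x y)\<^sup>2))"
      using P.integrable_fst[OF Si(1)[OF U2]] P.integrable_fst[OF H2] by (intro integral_mono_AE sl) auto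
    also have "\<dots> = B\<^sup>2 / 16 * (LINT (x, y)|?Q. (H x y)\<^sup>2)"
      using P.integral_fst[OF H2] by simp
    finally show ?thesis .
  qed
  have inner: "(LINT (x, y)|?Q. indicator ?T x * (U x y)\<^sup>2) \<le> ?\<mu> *
        (2 / A * (LINT (x, y)|?Q. (U x y)\<^sup>2) + A / 2 * (LINT (x, y)|?Q. (G x y)\<^sup>2))"
  proof -
    (* Horizontal slices are vertical slices after an exchange of the two circles. *)
    have swap: "integrable (rect_measure B A) (\<lambda>(y, x). f x y)" if "integrable ?Q (\<lambda>(x, y). f x y)" for f :: "real \<Rightarrow> real \<Rightarrow> real"
      using P.integrable_product_swap[OF that] by (simp add: split_beta')
    have swapi: "(LINT (y, x)|rect_measure B A. f x y) = (LINT (x, y)|?Q. f x y)"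
      if "(\<lambda>(x, y). f x y) \<in> borel_measurable ?Q" for f :: "real \<Rightarrow> real \<Rightarrow> real"
      using P.integral_product_swap[OF that] by (simp add: split_beta')
    have wd: "AE y in circle_measure B. y \<in> UNIV \<longrightarrow> circle_weak_derivative A (\<lambda>x. U x y) (\<lambda>x. G x y)"
    proof (rule slice_weak_derivative[OF B A _ swap[OF U] swap[OF G]])
      fix n \<theta> m \<phi>
      have "(LINT (y, x)|rect_measure B A. indicator UNIV y * U x y * (wave B n \<theta> y * (real m * (2 * pi / A) * wave A m (\<phi> + pi / 2) x)))
       = (LINT (x, y)|?Q. U x y * ((real m * (2 * pi / A) * wave A m (\<phi> + pi / 2) x) * wave B n \<theta> y))"
        by (subst swapi) (simp_all add: mult_ac)
      also have "\<dots> = - (LINT (x, y)|?Q. G x y * (wave A m \<phi> x * wave B n \<theta> y))" by (rule weak_x)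
      also have "\<dots> = - (LINT (y, x)|rect_measure B A. indicator UNIV y * G x y * (wave B n \<theta> y * wave A m \<phi> x))"
        by (subst swapi) (simp_all add: mult_ac)
      finally show "(LINT (y, x)|rect_measure B A. indicator UNIV y * U x y * (wave B n \<theta> y * (real m * (2 * pi / A) * wave A m (\<phi> + pi / 2) x)))
        = - (LINT (y, x)|rect_measure B A. indicator UNIV y * G x y * (wave B n \<theta> y * wave A m \<phi> x))" .
    qed simp
    have sl: "AE y in circle_measure B. (LINT x|circle_measure A. indicator ?T x * (U x y)\<^sup>2) \<le> ?\<mu> * (2 / A * (LINT x|circle_measure A. (U x y)\<^sup>2) + A / 2 * (LINT x|circle_measure A. (G x y)\<^sup>2))"
      using wd P.AE_integrable_snd[OF U2] P.AE_integrable_snd[OF G2]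
      by eventually_elim (rule circle_local_bound[OF A], auto)
    have iU: "integrable (circle_measure B) (\<lambda>y. LINT x|circle_measure A. (U x y)\<^sup>2)"
      and iG: "integrable (circle_measure B) (\<lambda>y. LINT x|circle_measure A. (G x y)\<^sup>2)"
      using P.integrable_snd[OF U2] P.integrable_snd[OF G2] by auto
    have "(LINT (x, y)|?Q. indicator ?T x * (U x y)\<^sup>2) = (LINT y|circle_measure B. LINT x|circle_measure A. indicator ?T x * (U x y)\<^sup>2)"
      using P.integral_snd[OF Si(2)[OF U2]] by simp
    also have "\<dots> \<le> (LINT y|circle_measure B. ?\<mu> * (2 / A * (LINT x|circle_measure A. (U x y)\<^sup>2) + A / 2 * (LINT x|circle_measure A. (G x y)\<^sup>2)))"
    proof (rule integral_mono_AE[OF P.integrable_snd[OF Si(2)[OF U2]] _ sl])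
      show "integrable (circle_measure B) (\<lambda>y. ?\<mu> * (2 / A * (LINT x|circle_measure A. (U x y)\<^sup>2) + A / 2 * (LINT x|circle_measure A. (G x y)\<^sup>2)))"
        by (intro integrable_mult_right Bochner_Integration.integrable_add iU iG)
    qed
    also have "\<dots> = ?\<mu> * (2 / A * (LINT (x, y)|?Q. (U x y)\<^sup>2) + A / 2 * (LINT (x, y)|?Q. (G x y)\<^sup>2))"
      unfolding integral_mult_right_zero Bochner_Integration.integral_add[OF integrable_mult_right[OF iU] integrable_mult_right[OF iG]]
        P.integral_snd[OF U2] P.integral_snd[OF G2] ..
    finally show ?thesis .
  qed
  have "(LINT (x, y)|?Q. (U x y)\<^sup>2) = (LINT p|?Q. (case p of (x, y) \<Rightarrow> indicator S x * (U x y)\<^sup>2) + (case p of (x, y) \<Rightarrow> indicator ?T x * (U x y)\<^sup>2))"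
    by (intro Bochner_Integration.integral_cong refl) (auto simp: space_pair_measure indicator_def)
  also have "\<dots> = (LINT (x, y)|?Q. indicator S x * (U x y)\<^sup>2) + (LINT (x, y)|?Q. indicator ?T x * (U x y)\<^sup>2)"
    by (rule Bochner_Integration.integral_add[OF Si[OF U2]])
  finally show ?thesis using outer inner by linarith
qed

section \<open>Topology and measure of the flat torus\<close>

lemma to_torus_eq_iff: "to_torus (x, y) = to_torus (x', y') \<longleftrightarrow> [x = x'] (rmod 4 * pi) \<and> [y = y'] (rmod 2 * pi)"
  by (simp add: torus.abs_eq_iff)

lemma rcong_imp_wave_eq:
  assumes "L > 0" "[x = x'] (rmod L)"
  shows "wave L n \<theta> x = wave L n \<theta> x'"
proof -
  obtain k :: int where k: "x' = x + of_int k * L" using assms(2) by (auto simp: rcong_altdef)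
  have "2 * pi / L * (of_int k * L) = 2 * pi * of_int k" using assms(1) by simp
  then have "real n * (2 * pi / L) * x' = real n * (2 * pi / L) * x + real n * (2 * pi * of_int k)"
    unfolding k distrib_left mult.assoc by simp
  then have "real n * (2 * pi / L) * x' + \<theta> = (real n * (2 * pi / L) * x + \<theta>) + of_int (int n * k) * (2 * pi)"
    by simp
  then show ?thesis unfolding wave_def
    using cos.plus_of_int[of "real n * (2 * pi / L) * x + \<theta>" "int n * k"] by (simp only: of_real_eq_id id_apply)
qed

text \<open>The functions \<open>wave\<close> descend to the torus. The choice of representative in the definition does
  not matter by periodicity, which \<open>wave_x_to_torus\<close> and \<open>wave_y_to_torus\<close> make available.\<close>

definition wave_x :: "nat \<Rightarrow> real \<Rightarrow> torus \<Rightarrow> real" where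
  "wave_x n \<theta> p = wave (4 * pi) n \<theta> (fst (rep_torus p))"

definition wave_y :: "nat \<Rightarrow> real \<Rightarrow> torus \<Rightarrow> real" where
  "wave_y n \<theta> p = wave (2 * pi) n \<theta> (snd (rep_torus p))"

lemma rep_to_torus: "[fst (rep_torus (to_torus (x, y))) = x] (rmod 4 * pi)"
    "[snd (rep_torus (to_torus (x, y))) = y] (rmod 2 * pi)"
proof -
  have "to_torus (rep_torus (to_torus (x, y))) = to_torus (x, y)"
    by (rule Quotient3_abs_rep[OF Quotient3_torus])
  then show "[fst (rep_torus (to_torus (x, y))) = x] (rmod 4 * pi)" "[snd (rep_torus (to_torus (x, y))) = y] (rmod 2 * pi)"
    by (cases "rep_torus (to_torus (x, y))"; auto simp: to_torus_eq_iff)+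
qed

lemma wave_x_to_torus [simp]: "wave_x n \<theta> (to_torus z) = wave (4 * pi) n \<theta> (fst z)"
  by (cases z) (auto simp: wave_x_def intro!: rcong_imp_wave_eq rep_to_torus)

lemma wave_y_to_torus [simp]: "wave_y n \<theta> (to_torus z) = wave (2 * pi) n \<theta> (snd z)"
  by (cases z) (auto simp: wave_y_def intro!: rcong_imp_wave_eq rep_to_torus)

lemma torus_cases:
  obtains x y where "p = to_torus (x, y)" "x \<in> {0..<4 * pi}" "y \<in> {0..<2 * pi}"
proof -
  obtain z where p: "p = to_torus z" by (metis Quotient3_abs_rep[OF Quotient3_torus])
  obtain x y where z: "z = (x, y)" by (cases z)
  have "p = to_torus (x rmod (4 * pi), y rmod (2 * pi))"
    unfolding p z to_torus_eq_iff by (auto simp: rcong_def)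
  then show thesis by (rule that) (simp_all add: rmod_less rmod_nonneg)
qed

lemma continuous_to_torus: "continuous_on UNIV to_torus"
  by (auto simp: continuous_on_open_vimage open_torus_def)

lemma continuous_on_torusI:
  assumes "continuous_on UNIV (\<lambda>z. f (to_torus z))"
  shows "continuous_on UNIV (f :: torus \<Rightarrow> 'a :: topological_space)"
  using assms by (auto simp: continuous_on_open_vimage open_torus_def vimage_def)

lemma compact_torus: "compact (UNIV :: torus set)"
proof -
  have "UNIV = to_torus ` ({0..4 * pi} \<times> {0..2 * pi})"
  proof (intro equalityI subsetI UNIV_I)
    fix p show "p \<in> to_torus ` ({0..4 * pi} \<times> {0..2 * pi})"
      by (rule torus_cases[of p]) auto
  qed
  then show ?thesis
    using compact_continuous_image[OF continuous_on_subset[OF continuous_to_torus] compact_Times[OF compact_Icc compact_Icc]]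
    by (metis subset_UNIV)
qed

lemma bounded_torus_function:
  assumes "continuous_on UNIV (f :: torus \<Rightarrow> 'a :: real_normed_vector)"
  obtains B where "\<And>p. norm (f p) \<le> B"
  using compact_imp_bounded[OF compact_continuous_image[OF assms compact_torus]] by (auto simp: bounded_iff)

abbreviation torus_rect :: "(real \<times> real) measure" where
  "torus_rect \<equiv> rect_measure (4 * pi) (2 * pi)"

text \<open>Integrals over the torus become iterated integrals over the two circles.\<close>

lemma rect_measure_eq: "restrict_space lborel ({0..<A} \<times> {0..<B}) = rect_measure A B"
proof (rule sym, rule pair_measure_eqI)
  show "sigma_finite_measure (circle_measure A)" "sigma_finite_measure (circle_measure B)"
    using pair_sigma_finite_circle unfolding pair_sigma_finite_def by auto
  show "sets (rect_measure A B) = sets (restrict_space lborel ({0..<A} \<times> {0..<B}))"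
  proof
    show "sets (rect_measure A B) \<subseteq> sets (restrict_space lborel ({0..<A} \<times> {0..<B}))"
      by (rule sets_pair_in_sets)
        (auto simp: circle_measure_def sets_restrict_space_iff borel_Times)
    show "sets (restrict_space lborel ({0..<A} \<times> {0..<B})) \<subseteq> sets (rect_measure A B)"
    proof
      fix Z assume "Z \<in> sets (restrict_space lborel ({0..<A} \<times> {0..<B}))"
      then have Z: "Z \<in> sets borel" "Z \<subseteq> {0..<A} \<times> {0..<B}"
        by (auto simp: sets_restrict_space_iff borel_Times)
      have "(\<lambda>p. (fst p, snd p)) \<in> borel_measurable (rect_measure A B)"
        by (rule borel_measurable_Pair) measurable
      from measurable_sets[OF this Z(1)] Z(2) show "Z \<in> sets (rect_measure A B)"
        by (simp add: space_pair_measure Int_absorb2 vimage_def)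
    qed
  qed
  fix X Y assume X: "X \<in> sets (circle_measure A)" and Y: "Y \<in> sets (circle_measure B)"
  have [simp]: "X \<subseteq> {0..<A}" "Y \<subseteq> {0..<B}" using sets.sets_into_space[OF X] sets.sets_into_space[OF Y] by simp_all
  have XY: "X \<in> sets lborel" "Y \<in> sets lborel"
    using X Y by (auto simp: circle_measure_def sets_restrict_space_iff)
  have "emeasure (restrict_space lborel ({0..<A} \<times> {0..<B})) (X \<times> Y) = emeasure lborel (X \<times> Y)"
    by (rule emeasure_restrict_space) (simp_all add: borel_Times Sigma_mono)
  also have "\<dots> = emeasure (lborel \<Otimes>\<^sub>M lborel) (X \<times> Y)" by (simp only: lborel_prod)
  also have "\<dots> = emeasure lborel X * emeasure lborel Y"
    using XY by (simp add: lborel.emeasure_pair_measure_Times)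
  also have "\<dots> = emeasure (circle_measure A) X * emeasure (circle_measure B) Y"
    by (simp add: circle_measure_def emeasure_restrict_space)
  finally show "emeasure (circle_measure A) X * emeasure (circle_measure B) Y = emeasure (restrict_space lborel ({0..<A} \<times> {0..<B})) (X \<times> Y)" ..
qed

lemma torus_measure_eq: "torus_measure = distr torus_rect borel to_torus"
  by (simp add: torus_measure_def rect_measure_eq)

lemma borel_measurable_rect:
  "f \<in> borel \<rightarrow>\<^sub>M N \<Longrightarrow> f \<in> rect_measure A B \<rightarrow>\<^sub>M N"
  unfolding rect_measure_eq[symmetric] by (simp add: measurable_restrict_space1)

lemma to_torus_measurable: "to_torus \<in> torus_rect \<rightarrow>\<^sub>M borel"
  by (intro borel_measurable_rect borel_measurable_continuous_onI continuous_to_torus)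

lemma sets_torus_measure: "sets torus_measure = sets borel" and space_torus_measure: "space torus_measure = UNIV"
  by (simp_all add: torus_measure_def)

lemma domain_measurable_iff:
  fixes f :: "torus \<Rightarrow> 'b :: {banach, second_countable_topology}"
  assumes "\<Omega> \<in> sets borel"
  shows "f \<in> borel_measurable (domain_measure \<Omega>) \<longleftrightarrow> (\<lambda>p. indicator \<Omega> p *\<^sub>R f p) \<in> borel_measurable borel"
  unfolding domain_measure_def using assms
  by (subst borel_measurable_restrict_space_iff) (simp_all add: sets_torus_measure space_torus_measure cong: measurable_cong_sets)

lemma domain_integrable_iff:
  fixes f :: "torus \<Rightarrow> 'b :: {banach, second_countable_topology}"
  assumes "\<Omega> \<in> sets borel" "f \<in> borel_measurable (domain_measure \<Omega>)"
  shows "integrable (domain_measure \<Omega>) f \<longleftrightarrow> integrable torus_rect (\<lambda>z. indicator \<Omega> (to_torus z) *\<^sub>R f (to_torus z))"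
  using assms domain_measurable_iff[OF assms(1), of f] unfolding domain_measure_def
  by (subst integrable_restrict_space)
     (simp_all add: sets_torus_measure space_torus_measure torus_measure_eq integrable_distr_eq[OF to_torus_measurable])

lemma domain_integral_eq:
  fixes f :: "torus \<Rightarrow> 'b :: {banach, second_countable_topology}"
  assumes "\<Omega> \<in> sets borel" "f \<in> borel_measurable (domain_measure \<Omega>)"
  shows "(LINT p|domain_measure \<Omega>. f p) = (LINT z|torus_rect. indicator \<Omega> (to_torus z) *\<^sub>R f (to_torus z))"
  using assms domain_measurable_iff[OF assms(1), of f] unfolding domain_measure_def
  by (subst integral_restrict_space)
     (simp_all add: sets_torus_measure space_torus_measure torus_measure_eq integral_distr[OF to_torus_measurable])

lemma finite_domain_measure: "\<Omega> \<in> sets borel \<Longrightarrow> finite_measure (domain_measure \<Omega>)"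
proof -
  have "finite_measure torus_measure"
    unfolding torus_measure_eq by (rule finite_measure.finite_measure_distr[OF finite_measure_circle_pair to_torus_measurable])
  then show "finite_measure (domain_measure \<Omega>)" if "\<Omega> \<in> sets borel"
    unfolding domain_measure_def using that by (intro finite_measure_restrict_space) (simp_all add: sets_torus_measure space_torus_measure)
qed

lemma measurable_domain: "f \<in> borel_measurable borel \<Longrightarrow> f \<in> borel_measurable (domain_measure \<Omega>)"
  unfolding domain_measure_def by (intro measurable_restrict_space1) (simp add: sets_torus_measure cong: measurable_cong_sets)

section \<open>Smooth functions on the torus\<close>

lemma has_gradient_const: "has_gradient (\<lambda>_. c) (\<lambda>_. 0)"
  by (simp add: has_gradient_def GDERIV_const)

lemma has_gradient_add:
  "has_gradient f f' \<Longrightarrow> has_gradient g g' \<Longrightarrow> has_gradient (\<lambda>p. f p + g p) (\<lambda>p. f' p + g' p)"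
  by (simp add: has_gradient_def GDERIV_add)

lemma has_gradient_mult:
  "has_gradient f f' \<Longrightarrow> has_gradient g g' \<Longrightarrow> has_gradient (\<lambda>p. f p * g p) (\<lambda>p. f p *\<^sub>R g' p + g p *\<^sub>R f' p)"
  unfolding has_gradient_def by (intro allI GDERIV_mult) blast+

lemma has_gradient_compose:
  "has_gradient f f' \<Longrightarrow> (\<And>t. DERIV h t :> h' t) \<Longrightarrow> has_gradient (\<lambda>p. h (f p)) (\<lambda>p. h' (f p) *\<^sub>R f' p)"
  unfolding has_gradient_def
  by (intro allI GDERIV_DERIV_compose[where f = "\<lambda>z. f (to_torus z)" and g = h]) blast+

lemma GDERIV_fst: "GDERIV fst z :> (1, 0)" and GDERIV_snd: "GDERIV snd z :> (0, 1)" for z :: "real \<times> real"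
  by (auto simp: gderiv_def inner_prod_def intro!: derivative_eq_intros)

lemma has_gradient_wave_x:
  "has_gradient (wave_x n \<theta>) (\<lambda>p. (real n * (2 * pi / (4 * pi)) * wave_x n (\<theta> + pi / 2) p, 0))"
  unfolding has_gradient_def
proof
  fix z
  show "GDERIV (\<lambda>z. wave_x n \<theta> (to_torus z)) z :> (real n * (2 * pi / (4 * pi)) * wave_x n (\<theta> + pi / 2) (to_torus z), 0)"
    using GDERIV_DERIV_compose[where f = fst and g = "wave (4 * pi) n \<theta>" and x = z, OF GDERIV_fst DERIV_wave] by simp
qed

lemma has_gradient_wave_y:
  "has_gradient (wave_y n \<theta>) (\<lambda>p. (0, real n * (2 * pi / (2 * pi)) * wave_y n (\<theta> + pi / 2) p))"
  unfolding has_gradient_def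
proof
  fix z
  show "GDERIV (\<lambda>z. wave_y n \<theta> (to_torus z)) z :> (0, real n * (2 * pi / (2 * pi)) * wave_y n (\<theta> + pi / 2) (to_torus z))"
    using GDERIV_DERIV_compose[where f = snd and g = "wave (2 * pi) n \<theta>" and x = z, OF GDERIV_snd DERIV_wave] by simp
qed

lemma has_gradient_unique:
  assumes "has_gradient f g" "has_gradient f h" shows "g = h"
proof
  fix p
  obtain z where p: "p = to_torus z" by (metis torus_cases)
  have "(\<lambda>k. k \<bullet> g p) = (\<lambda>k. k \<bullet> h p)"
    using assms unfolding has_gradient_def gderiv_def p by (blast intro: has_derivative_unique)
  then have "\<forall>k. k \<bullet> g p = k \<bullet> h p" by (simp add: fun_eq_iff)
  then show "g p = h p" by (simp only: vector_eq_ldot)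
qed

lemma has_gradient_continuous:
  assumes "has_gradient f g" shows "continuous_on UNIV f"
proof (rule continuous_on_torusI, rule continuous_at_imp_continuous_on, rule ballI)
  fix z
  have "((\<lambda>z. f (to_torus z)) has_derivative (\<lambda>h. h \<bullet> g (to_torus z))) (at z)"
    using assms unfolding has_gradient_def gderiv_def by blast
  then show "isCont (\<lambda>z. f (to_torus z)) z" by (rule has_derivative_continuous)
qed

lemma smooth_torus_continuous: assumes "smooth_torus f" shows "continuous_on UNIV f"
  using assms by cases (rule has_gradient_continuous)

lemma smooth_torus_gradient_continuous:
  assumes "smooth_torus f" "has_gradient f g" shows "continuous_on UNIV g"
  using assms(1)
proof cases
  case (1 h)
  have "g = h" using has_gradient_unique[OF assms(2) 1(1)] .
  then show ?thesis
    using continuous_on_Pair[OF smooth_torus_continuous[OF 1(2)] smooth_torus_continuous[OF 1(3)]] by simp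
qed

text \<open>The family of functions \<open>exp (- 1/t) / t\<^sup>k\<close>, continued by zero, is closed under differentiation up to
  linear combinations, which gives smoothness of cut-offs without higher derivatives.\<close>

definition flat_exp :: "nat \<Rightarrow> real \<Rightarrow> real" where
  "flat_exp k t = (if t > 0 then exp (- 1 / t) / t ^ k else 0)"

lemma flat_exp_pos: "t > 0 \<Longrightarrow> flat_exp k t = exp (- inverse t) * inverse t ^ k"
  by (simp add: flat_exp_def divide_inverse power_inverse)

lemma flat_exp_tendsto_0: "(flat_exp k \<longlongrightarrow> 0) (at 0)"
proof -
  have "((\<lambda>t. inverse t ^ k / exp (inverse t)) \<longlongrightarrow> 0) (at_right (0::real))"
    by (rule filterlim_compose[OF tendsto_power_div_exp_0 filterlim_inverse_at_top_right])
  then have "(flat_exp k \<longlongrightarrow> 0) (at_right 0)"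
  proof (rule Lim_transform_eventually)
    show "\<forall>\<^sub>F t in at_right 0. inverse t ^ k / exp (inverse t) = flat_exp k t"
      using eventually_at_right_less[of "0::real"]
      by eventually_elim (simp add: flat_exp_def exp_minus field_simps power_inverse)
  qed
  moreover have "(flat_exp k \<longlongrightarrow> 0) (at_left 0)"
  proof (rule tendsto_eventually)
    show "\<forall>\<^sub>F t in at_left 0. flat_exp k t = 0"
      by (auto simp: eventually_at_filter flat_exp_def)
  qed
  ultimately show ?thesis by (rule filterlim_split_at[rotated])
qed

lemma DERIV_flat_exp: "(flat_exp k has_real_derivative flat_exp (k + 2) t + (- real k) * flat_exp (k + 1) t) (at t)"
proof -
  consider "t > 0" | "t = 0" | "t < 0" by linarith
  then show ?thesis
  proof cases
    case 1
    have a: "((\<lambda>t. exp (- inverse t)) has_real_derivative exp (- inverse t) * (inverse t)\<^sup>2) (at t)"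
      using 1 by (auto intro!: derivative_eq_intros simp: power2_eq_square)
    have b: "((\<lambda>t. inverse t ^ k) has_real_derivative - real k * inverse t ^ (k + 1)) (at t)"
    proof (cases k)
      case (Suc m)
      show ?thesis
        using DERIV_power_Suc[OF DERIV_inverse, of t m UNIV] 1 unfolding Suc by (simp add: algebra_simps)
    qed simp
    have "exp (- inverse t) * (inverse t)\<^sup>2 * inverse t ^ k + - real k * inverse t ^ (k + 1) * exp (- inverse t)
      = flat_exp (k + 2) t + (- real k) * flat_exp (k + 1) t"
      using 1 by (simp add: flat_exp_pos power_add power2_eq_square)
    then have "((\<lambda>t. exp (- inverse t) * inverse t ^ k) has_real_derivative
        flat_exp (k + 2) t + (- real k) * flat_exp (k + 1) t) (at t)"
      using DERIV_mult[OF a b] by simp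
    then show ?thesis
      by (rule has_field_derivative_transform_within_open[of _ _ _ "{0<..}"]) (use 1 in \<open>auto simp: flat_exp_pos\<close>)
  next
    case 2
    have "(flat_exp k has_real_derivative 0) (at 0)"
      unfolding has_field_derivative_iff
    proof (rule Lim_transform_eventually[OF flat_exp_tendsto_0[of "k + 1"]])
      show "\<forall>\<^sub>F y in at 0. flat_exp (k + 1) y = (flat_exp k y - flat_exp k 0) / (y - 0)"
        by (rule always_eventually) (simp add: flat_exp_def)
    qed
    then show ?thesis using 2 by (simp add: flat_exp_def)
  next
    case 3
    have "((\<lambda>t. 0) has_real_derivative 0) (at t)" by simp
    then have "(flat_exp k has_real_derivative 0) (at t)"
      by (rule has_field_derivative_transform_within_open[of _ _ _ "{..<0}"]) (use 3 in \<open>auto simp: flat_exp_def\<close>)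
    then show ?thesis using 3 by (simp add: flat_exp_def)
  qed
qed

lemma flat_exp_0_bounds: "0 \<le> flat_exp 0 t" "flat_exp 0 t \<le> 1"
  by (auto simp: flat_exp_def)

lemma flat_exp_0_at_top: "(flat_exp 0 \<longlongrightarrow> 1) at_top"
proof -
  have "((\<lambda>t. exp (- inverse t)) \<longlongrightarrow> exp (- 0)) (at_top :: real filter)"
    by (intro tendsto_intros tendsto_inverse_0_at_top filterlim_ident)
  then have "((\<lambda>t. exp (- inverse t)) \<longlongrightarrow> 1) (at_top :: real filter)" by simp
  then show ?thesis
  proof (rule Lim_transform_eventually)
    show "\<forall>\<^sub>F t in at_top. exp (- inverse t) = flat_exp 0 t"
      using eventually_gt_at_top[of 0] by eventually_elim (simp add: flat_exp_def divide_inverse)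
  qed
qed

text \<open>A supply of smooth functions on the torus that contains the eigenfunctions and the cut-offs and is
  closed under partial derivatives; that closure is exactly the coinduction step for
  \<open>smooth_torus\<close>.\<close>

inductive_set elementary :: "(torus \<Rightarrow> real) set" where
  elementary_const: "(\<lambda>_. c) \<in> elementary"
| elementary_wave_x: "wave_x n \<theta> \<in> elementary"
| elementary_wave_y: "wave_y n \<theta> \<in> elementary"
| elementary_add: "f \<in> elementary \<Longrightarrow> g \<in> elementary \<Longrightarrow> (\<lambda>p. f p + g p) \<in> elementary"
| elementary_mult: "f \<in> elementary \<Longrightarrow> g \<in> elementary \<Longrightarrow> (\<lambda>p. f p * g p) \<in> elementary"
| elementary_flat_exp: "f \<in> elementary \<Longrightarrow> (\<lambda>p. flat_exp k (f p)) \<in> elementary"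

lemma elementary_cmult: "f \<in> elementary \<Longrightarrow> (\<lambda>p. c * f p) \<in> elementary"
  by (rule elementary_mult[OF elementary_const])

lemma elementary_gradient:
  assumes "f \<in> elementary"
  obtains g where "has_gradient f g" "(\<lambda>p. fst (g p)) \<in> elementary" "(\<lambda>p. snd (g p)) \<in> elementary"
proof -
  have "\<exists>g. has_gradient f g \<and> (\<lambda>p. fst (g p)) \<in> elementary \<and> (\<lambda>p. snd (g p)) \<in> elementary"
    using assms
  proof induction
    case (elementary_const c)
    show ?case using has_gradient_const[of c] elementary.elementary_const[of 0] by force
  next
    case (elementary_wave_x n \<theta>)
    show ?case
      by (rule exI, rule conjI[OF has_gradient_wave_x], unfold fst_conv snd_conv)
        (intro conjI elementary_cmult elementary.intros)
  next
    case (elementary_wave_y n \<theta>)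
    show ?case
      by (rule exI, rule conjI[OF has_gradient_wave_y], unfold fst_conv snd_conv)
        (intro conjI elementary_cmult elementary.intros)
  next
    case (elementary_add f g)
    then obtain f' g' where "has_gradient f f'" "(\<lambda>p. fst (f' p)) \<in> elementary" "(\<lambda>p. snd (f' p)) \<in> elementary"
      "has_gradient g g'" "(\<lambda>p. fst (g' p)) \<in> elementary" "(\<lambda>p. snd (g' p)) \<in> elementary" by blast
    then show ?case
      by (intro exI[of _ "\<lambda>p. f' p + g' p"]) (simp add: has_gradient_add elementary.elementary_add)
  next
    case (elementary_mult f g)
    then obtain f' g' where "has_gradient f f'" "(\<lambda>p. fst (f' p)) \<in> elementary" "(\<lambda>p. snd (f' p)) \<in> elementary"
      "has_gradient g g'" "(\<lambda>p. fst (g' p)) \<in> elementary" "(\<lambda>p. snd (g' p)) \<in> elementary" by blast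
    with elementary_mult.hyps show ?case
      by (intro exI[of _ "\<lambda>p. f p *\<^sub>R g' p + g p *\<^sub>R f' p"])
        (simp add: has_gradient_mult elementary.elementary_add elementary.elementary_mult)
  next
    case (elementary_flat_exp f k)
    then obtain f' where "has_gradient f f'" "(\<lambda>p. fst (f' p)) \<in> elementary" "(\<lambda>p. snd (f' p)) \<in> elementary" by blast
    moreover have "(\<lambda>p. flat_exp (k + 2) (f p) + (- real k) * flat_exp (k + 1) (f p)) \<in> elementary"
      using elementary_flat_exp.hyps by (intro elementary.elementary_add elementary_cmult elementary.elementary_flat_exp)
    ultimately show ?case
      using has_gradient_compose[OF \<open>has_gradient f f'\<close> DERIV_flat_exp[of k]]
      by (intro exI[of _ "\<lambda>p. (flat_exp (k + 2) (f p) + (- real k) * flat_exp (k + 1) (f p)) *\<^sub>R f' p"] conjI)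
        (simp_all only: fst_scaleR snd_scaleR real_scaleR_def elementary.elementary_mult)
  qed
  then show thesis using that by blast
qed

lemma elementary_smooth: "f \<in> elementary \<Longrightarrow> smooth_torus f"
proof (coinduction arbitrary: f)
  case smooth_torus
  obtain g where "has_gradient f g" "(\<lambda>p. fst (g p)) \<in> elementary" "(\<lambda>p. snd (g p)) \<in> elementary"
    using elementary_gradient[OF smooth_torus] .
  then show ?case by blast
qed

lemma elementary_continuous: "f \<in> elementary \<Longrightarrow> continuous_on UNIV f"
  by (intro smooth_torus_continuous elementary_smooth)

lemma elementary_measurable: "f \<in> elementary \<Longrightarrow> f \<in> borel_measurable borel"
  by (intro borel_measurable_continuous_onI elementary_continuous)

lemma elementary_prod: "finite J \<Longrightarrow> (\<And>j. j \<in> J \<Longrightarrow> f j \<in> elementary) \<Longrightarrow> (\<lambda>p. \<Prod>j\<in>J. f j p) \<in> elementary"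
  by (induction J rule: finite_induct) (auto intro: elementary.intros)

lemma L2_integrable:
  assumes "\<Omega> \<in> sets borel" "L2 \<Omega> u" shows "integrable (domain_measure \<Omega>) u"
proof -
  have [measurable]: "u \<in> borel_measurable (domain_measure \<Omega>)" using assms(2) by (simp add: L2_def)
  have "integrable (domain_measure \<Omega>) (\<lambda>p. norm (u p))"
  proof (rule finite_measure.square_integrable_imp_integrable[OF finite_domain_measure[OF assms(1)]])
    show "integrable (domain_measure \<Omega>) (\<lambda>p. (norm (u p))\<^sup>2)" using assms(2) by (simp add: L2_def)
  qed measurable
  then show ?thesis by (rule integrable_norm_cancel) measurable
qed

lemma integrable_scaleR_bounded:
  fixes g :: "'a \<Rightarrow> 'b :: {banach, second_countable_topology}"
  assumes "integrable M (f :: 'a \<Rightarrow> real)" "g \<in> borel_measurable M" "\<And>x. norm (g x) \<le> B"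
  shows "integrable M (\<lambda>x. f x *\<^sub>R g x)"
proof (rule Bochner_Integration.integrable_bound[where f = "\<lambda>x. B * norm (f x)"])
  show "integrable M (\<lambda>x. B * norm (f x))" using assms(1) by auto
  show "(\<lambda>x. f x *\<^sub>R g x) \<in> borel_measurable M" using assms by measurable
  have "norm (f x *\<^sub>R g x) \<le> norm (B * norm (f x))" for x
    using mult_right_mono[OF order_trans[OF assms(3) abs_ge_self], of "\<bar>f x\<bar>" x] by (simp add: abs_mult mult.commute)
  then show "AE x in M. norm (f x *\<^sub>R g x) \<le> norm (B * norm (f x))" by simp
qed

section \<open>Weak gradients and cut-offs\<close>

lemma to_torus_periods: "to_torus (4 * pi, y) = to_torus (0, y)" "to_torus (x, 2 * pi) = to_torus (x, 0)"
  by (simp_all add: to_torus_eq_iff rcong_0_iff)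

lemma has_gradient_partial:
  assumes "has_gradient h \<eta>"
  shows "((\<lambda>x. h (to_torus (x, y))) has_real_derivative fst (\<eta> (to_torus (x, y)))) (at x)"
    "((\<lambda>y. h (to_torus (x, y))) has_real_derivative snd (\<eta> (to_torus (x, y)))) (at y)"
proof -
  have d: "((\<lambda>z. h (to_torus z)) has_derivative (\<lambda>k. k \<bullet> \<eta> (to_torus z))) (at z)" for z
    using assms unfolding has_gradient_def gderiv_def by blast
  have "((\<lambda>x. (x, y)) has_derivative (\<lambda>t. (t, 0))) (at x)" by (auto intro!: derivative_eq_intros)
  from has_derivative_compose[OF this d]
  show "((\<lambda>x. h (to_torus (x, y))) has_real_derivative fst (\<eta> (to_torus (x, y)))) (at x)"
    unfolding has_field_derivative_def by (simp add: inner_prod_def mult_commute_abs)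
  have "((\<lambda>y. (x, y)) has_derivative (\<lambda>t. (0, t))) (at y)" by (auto intro!: derivative_eq_intros)
  from has_derivative_compose[OF this d]
  show "((\<lambda>y. h (to_torus (x, y))) has_real_derivative snd (\<eta> (to_torus (x, y)))) (at y)"
    unfolding has_field_derivative_def by (simp add: inner_prod_def mult_commute_abs)
qed

lemma integrable_rect_continuous:
  fixes f :: "torus \<Rightarrow> 'a :: {banach, second_countable_topology}"
  assumes "continuous_on UNIV f"
  shows "integrable torus_rect (\<lambda>z. f (to_torus z))"
proof -
  obtain B where B: "\<And>p. norm (f p) \<le> B" using bounded_torus_function[OF assms] by blast
  have "(\<lambda>z. f (to_torus z)) \<in> borel_measurable torus_rect"
    using measurable_compose[OF to_torus_measurable borel_measurable_continuous_onI[OF assms]] .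
  then show ?thesis
    using B by (intro finite_measure.integrable_const_bound[OF finite_measure_circle_pair, where B = B]) auto
qed

text \<open>Integrated along closed coordinate lines, derivatives give zero. Applied to a product this is
  integration by parts on the torus.\<close>

lemma torus_integral_gradient:
  assumes h: "has_gradient h \<eta>" and \<eta>: "continuous_on UNIV \<eta>"
  shows "(LINT z|torus_rect. \<eta> (to_torus z)) = 0"
proof -
  interpret pair_sigma_finite "circle_measure (4 * pi)" "circle_measure (2 * pi)" by (rule pair_sigma_finite_circle)
  have i: "integrable torus_rect (\<lambda>z. \<eta> (to_torus z))" by (rule integrable_rect_continuous[OF \<eta>])
  have c: "continuous_on UNIV (\<lambda>z. \<eta> (to_torus z))"
    using continuous_on_compose2[OF \<eta> continuous_to_torus] by simp
  have cx: "continuous_on UNIV (\<lambda>x. \<eta> (to_torus (x, y)))" and cy: "continuous_on UNIV (\<lambda>y. \<eta> (to_torus (x, y)))" for x y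
    by (rule continuous_on_compose2[OF c], intro continuous_intros, simp)+
  have 1: "integrable torus_rect (\<lambda>(x, y). fst (\<eta> (to_torus (x, y))))" "integrable torus_rect (\<lambda>(x, y). snd (\<eta> (to_torus (x, y))))"
    using Bochner_Integration.integrable_fst[OF i] Bochner_Integration.integrable_snd[OF i] by (simp_all add: split_beta')
  have "fst (LINT z|torus_rect. \<eta> (to_torus z)) = (LINT (x, y)|torus_rect. fst (\<eta> (to_torus (x, y))))"
    using Bochner_Integration.integral_fst[OF i] by (simp add: split_beta')
  also have "\<dots> = (LINT y|circle_measure (2 * pi). LINT x|circle_measure (4 * pi). fst (\<eta> (to_torus (x, y))))"
    using integral_snd[OF 1(1)] by simp
  also have "\<dots> = 0"
    by (subst integral_circle_derivative[OF _ has_gradient_partial(1)[OF h] continuous_on_fst[OF cx]]) (simp_all add: to_torus_periods)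
  finally have f: "fst (LINT z|torus_rect. \<eta> (to_torus z)) = 0" .
  have "snd (LINT z|torus_rect. \<eta> (to_torus z)) = (LINT (x, y)|torus_rect. snd (\<eta> (to_torus (x, y))))"
    using Bochner_Integration.integral_snd[OF i] by (simp add: split_beta')
  also have "\<dots> = (LINT x|circle_measure (4 * pi). LINT y|circle_measure (2 * pi). snd (\<eta> (to_torus (x, y))))"
    using integral_fst[OF 1(2)] by simp
  also have "\<dots> = 0"
    by (subst integral_circle_derivative[OF _ has_gradient_partial(2)[OF h] continuous_on_snd[OF cy]]) (simp_all add: to_torus_periods)
  finally show ?thesis using f by (simp add: prod_eq_iff)
qed

lemma elementary_gradient_measurable: "f \<in> elementary \<Longrightarrow> has_gradient f g \<Longrightarrow> g \<in> borel_measurable borel"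
  by (intro borel_measurable_continuous_onI smooth_torus_gradient_continuous elementary_smooth)

lemma L2_continuous:
  fixes f :: "torus \<Rightarrow> 'a :: euclidean_space"
  assumes \<Omega>: "\<Omega> \<in> sets borel" and f: "continuous_on UNIV f"
  shows "L2 \<Omega> f"
proof -
  obtain B where B: "\<And>p. norm (f p) \<le> B" using bounded_torus_function[OF f] by blast
  have [measurable]: "f \<in> borel_measurable (domain_measure \<Omega>)"
    by (intro measurable_domain borel_measurable_continuous_onI f)
  have "(norm (f p))\<^sup>2 \<le> B\<^sup>2" for p using B[of p] by (intro power_mono) auto
  then show ?thesis unfolding L2_def
    by (intro conjI finite_measure.integrable_const_bound[OF finite_domain_measure[OF \<Omega>], where B = "B\<^sup>2"]) auto
qed

text \<open>Integration by parts is carried out on the whole torus, where the complement of \<open>\<Omega>\<close>, being null, does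
  not contribute to the integrals.\<close>

lemma H1_elementary:
  assumes \<Omega>: "\<Omega> \<in> sets borel" and null: "AE z in torus_rect. to_torus z \<in> \<Omega>"
    and f: "f \<in> elementary" and g: "has_gradient f g"
  shows "H1 \<Omega> f g"
proof -
  have cf: "continuous_on UNIV f" and cg: "continuous_on UNIV g"
    using f g by (auto intro: elementary_continuous smooth_torus_gradient_continuous elementary_smooth)
  have "weak_gradient \<Omega> f g"
    unfolding weak_gradient_def
  proof (intro allI impI, elim conjE)
    fix \<phi> \<psi> assume t: "test_function \<Omega> \<phi>" and \<psi>: "has_gradient \<phi> \<psi>"
    have c\<phi>: "continuous_on UNIV \<phi>" and c\<psi>: "continuous_on UNIV \<psi>"
      using t \<psi> by (auto simp: test_function_def intro: smooth_torus_continuous smooth_torus_gradient_continuous)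
    let ?F = "\<lambda>p. f p *\<^sub>R \<psi> p" and ?G = "\<lambda>p. \<phi> p *\<^sub>R g p"
    have c: "continuous_on UNIV ?F" "continuous_on UNIV ?G"
      using cf cg c\<phi> c\<psi> by (auto intro: continuous_on_scaleR)
    have eq: "(LINT p|domain_measure \<Omega>. h p) = (LINT z|torus_rect. h (to_torus z))" if h: "continuous_on UNIV h" for h :: "torus \<Rightarrow> real \<times> real"
    proof -
      have m: "h \<in> borel_measurable borel" by (rule borel_measurable_continuous_onI[OF h])
      have "(LINT p|domain_measure \<Omega>. h p) = (LINT z|torus_rect. indicator \<Omega> (to_torus z) *\<^sub>R h (to_torus z))"
        by (rule domain_integral_eq[OF \<Omega> measurable_domain[OF m]])
      also have "\<dots> = (LINT z|torus_rect. h (to_torus z))"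
      proof (rule integral_cong_AE)
        show "AE z in torus_rect. indicator \<Omega> (to_torus z) *\<^sub>R h (to_torus z) = h (to_torus z)"
          using null by eventually_elim simp
        have [measurable]: "(\<lambda>p. indicator \<Omega> p *\<^sub>R h p) \<in> borel_measurable borel" using \<Omega> m by measurable
        show "(\<lambda>z. indicator \<Omega> (to_torus z) *\<^sub>R h (to_torus z)) \<in> borel_measurable torus_rect"
          "(\<lambda>z. h (to_torus z)) \<in> borel_measurable torus_rect"
          using measurable_compose[OF to_torus_measurable, of "\<lambda>p. indicator \<Omega> p *\<^sub>R h p" borel]
            measurable_compose[OF to_torus_measurable m] \<Omega> m by auto
      qed
      finally show ?thesis .
    qed
    have "(LINT z|torus_rect. ?F (to_torus z) + ?G (to_torus z)) = 0"
      by (rule torus_integral_gradient[OF has_gradient_mult[OF g \<psi>]]) (intro continuous_on_add c)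
    then have "(LINT z|torus_rect. ?F (to_torus z)) + (LINT z|torus_rect. ?G (to_torus z)) = 0"
      using integrable_rect_continuous[OF c(1)] integrable_rect_continuous[OF c(2)] by simp
    then show "(LINT p|domain_measure \<Omega>. ?F p) = - (LINT p|domain_measure \<Omega>. ?G p)"
      unfolding eq[OF c(1)] eq[OF c(2)] by (simp add: eq_neg_iff_add_eq_0)
  qed
  then show ?thesis unfolding H1_def using L2_continuous[OF \<Omega> cf] L2_continuous[OF \<Omega> cg] by simp
qed

text \<open>The cut-off functions \<open>cut n \<circ> s\<close> are supported in \<open>{s \<ge> 1/(n+1)}\<close> and tend to the indicator of
  \<open>{s > 0}\<close>. Their derivatives blow up in the limit, but the derivative in direction \<open>e\<close> vanishes
  because \<open>s\<close> is constant in that direction.\<close>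

lemma weak_derivative_on_positive_set:
  fixes e :: "real \<times> real"
  assumes \<Omega>: "\<Omega> \<in> sets borel" and u: "H1 \<Omega> u g"
    and s: "s \<in> elementary" "has_gradient s \<sigma>" "\<And>p. \<sigma> p \<bullet> e = 0" "{p. s p > 0} \<subseteq> \<Omega>"
    and \<phi>: "\<phi> \<in> elementary" "has_gradient \<phi> \<psi>"
  shows "(LINT p|domain_measure \<Omega>. indicator {p. s p > 0} p * (u p * (\<psi> p \<bullet> e)))
    = - (LINT p|domain_measure \<Omega>. indicator {p. s p > 0} p * (\<phi> p * (g p \<bullet> e)))"
proof -
  let ?M = "domain_measure \<Omega>"
  have iu: "integrable ?M u" and ig: "integrable ?M g"
    using u \<Omega> by (auto simp: H1_def intro: L2_integrable)
  define cut where "cut n t = flat_exp 0 (real (Suc n) * (real (Suc n) * t - 1))" for n t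
  have [measurable]: "s \<in> borel_measurable ?M" "\<phi> \<in> borel_measurable ?M" "\<psi> \<in> borel_measurable ?M"
     "u \<in> borel_measurable ?M" "g \<in> borel_measurable ?M"
    using iu ig by (simp_all add: measurable_domain[OF elementary_measurable] s \<phi>
        measurable_domain[OF elementary_gradient_measurable[OF \<phi>]])
  have "continuous_on UNIV (flat_exp 0)"
    using DERIV_flat_exp by (intro DERIV_continuous_on) (auto intro: has_field_derivative_at_within)
  then have [measurable]: "flat_exp 0 \<in> borel_measurable borel" by (rule borel_measurable_continuous_onI)
  have [measurable]: "(\<lambda>p. cut n (s p)) \<in> borel_measurable ?M" for n unfolding cut_def by measurable
  have cut_le: "\<bar>cut n t\<bar> \<le> 1" for n t using flat_exp_0_bounds by (simp add: cut_def)
  obtain B where B: "\<And>p. norm (\<phi> p) \<le> B"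
    using bounded_torus_function[OF elementary_continuous[OF \<phi>(1)]] by blast
  obtain C where C: "\<And>p. norm (\<psi> p) \<le> C"
    using bounded_torus_function[OF smooth_torus_gradient_continuous[OF elementary_smooth[OF \<phi>(1)] \<phi>(2)]] by blast
  have lim: "(\<lambda>n. cut n (s p)) \<longlonglongrightarrow> indicator {p. s p > 0} p" for p
  proof (cases "s p > 0")
    case True
    have "LIM n sequentially. real (Suc n) * (s p) :> at_top"
      using True filterlim_compose[OF filterlim_real_sequentially filterlim_Suc]
      by (intro filterlim_at_top_mult_tendsto_pos[OF tendsto_const]) auto
    then have "LIM n sequentially. - 1 + real (Suc n) * s p :> at_top"
      by (rule filterlim_tendsto_add_at_top[OF tendsto_const])
    then have "LIM n sequentially. real (Suc n) * (- 1 + real (Suc n) * s p) :> at_top"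
      using filterlim_compose[OF filterlim_real_sequentially filterlim_Suc]
      by (intro filterlim_at_top_mult_at_top) auto
    then have "(\<lambda>n. flat_exp 0 (real (Suc n) * (- 1 + real (Suc n) * s p))) \<longlonglongrightarrow> 1"
      by (rule filterlim_compose[OF flat_exp_0_at_top])
    then show ?thesis using True by (simp add: cut_def)
  next
    case False
    have "real (Suc n) * (real (Suc n) * s p - 1) \<le> 0" for n
    proof -
      have "real (Suc n) * s p \<le> 0" using False by (intro mult_nonneg_nonpos) auto
      then have "real (Suc n) * s p - 1 \<le> 0" by linarith
      then show ?thesis by (intro mult_nonneg_nonpos) auto
    qed
    then have "cut n (s p) = 0" for n by (simp add: cut_def flat_exp_def not_less)
    then show ?thesis using False by simp
  qed
  have step: "(LINT p|?M. cut n (s p) * (u p * (\<psi> p \<bullet> e))) = - (LINT p|?M. cut n (s p) * (\<phi> p * (g p \<bullet> e)))" for n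
  proof -
    let ?N = "real (Suc n)"
    (* The summand 0 is the term with factor k in the derivative of flat_exp k, here for k = 0. *)
    let ?d = "\<lambda>t. (flat_exp 2 (?N * (?N * t - 1)) + 0) * (?N * ?N)"
    have cut_elem: "(\<lambda>p. cut n (s p)) \<in> elementary"
    proof -
      have "(\<lambda>p. flat_exp 0 (?N * (?N * s p + (- 1)))) \<in> elementary"
        by (intro elementary_flat_exp elementary_cmult elementary_add s elementary_const)
      then show ?thesis by (simp add: cut_def)
    qed
    have "DERIV (cut n) t :> ?d t" for t
    proof -
      have "DERIV (\<lambda>t. ?N * (?N * t - 1)) t :> ?N * ?N" by (auto intro!: derivative_eq_intros)
      from DERIV_chain2[OF DERIV_flat_exp this, of 0] show ?thesis unfolding cut_def by (simp add: numeral_2_eq_2)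
    qed
    from has_gradient_compose[OF s(2) this]
    have cut_grad: "has_gradient (\<lambda>p. cut n (s p)) (\<lambda>p. ?d (s p) *\<^sub>R \<sigma> p)" .
    let ?\<Phi> = "\<lambda>p. \<phi> p * cut n (s p)"
    let ?\<Psi> = "\<lambda>p. \<phi> p *\<^sub>R (?d (s p) *\<^sub>R \<sigma> p) + cut n (s p) *\<^sub>R \<psi> p"
    have grad: "has_gradient ?\<Phi> ?\<Psi>" by (rule has_gradient_mult[OF \<phi>(2) cut_grad])
    have elem: "?\<Phi> \<in> elementary" by (rule elementary_mult[OF \<phi>(1) cut_elem])
    have supp: "closure {p. ?\<Phi> p \<noteq> 0} \<subseteq> {p. s p \<ge> 1 / ?N}"
    proof (rule closure_minimal)
      show "{p. ?\<Phi> p \<noteq> 0} \<subseteq> {p. s p \<ge> 1 / ?N}"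
      proof (clarsimp, rule ccontr)
        fix p assume n0: "cut n (s p) \<noteq> 0" and "\<not> 1 / (1 + real n) \<le> s p"
        then have "?N * s p - 1 \<le> 0" by (simp add: field_simps)
        then have "?N * (?N * s p - 1) \<le> 0" by (intro mult_nonneg_nonpos) auto
        then show False using n0 by (simp add: cut_def flat_exp_def not_less)
      qed
      show "closed {p. s p \<ge> 1 / ?N}"
        by (rule closed_Collect_le[OF continuous_on_const elementary_continuous[OF s(1)]])
    qed
    have "test_function \<Omega> ?\<Phi>"
      unfolding test_function_def
    proof (intro conjI elementary_smooth elem)
      show "compact (closure {p. ?\<Phi> p \<noteq> 0})"
        using compact_Int_closed[OF compact_torus closed_closure] by simp
      have "{p. s p \<ge> 1 / ?N} \<subseteq> {p. s p > 0}"
      proof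
        fix p assume "p \<in> {p. s p \<ge> 1 / ?N}"
        moreover have "1 / ?N > 0" by simp
        ultimately show "p \<in> {p. s p > 0}" unfolding mem_Collect_eq by (rule less_le_trans[rotated])
      qed
      then show "closure {p. ?\<Phi> p \<noteq> 0} \<subseteq> \<Omega>" using supp s(4) by blast
    qed
    then have weak: "(LINT p|?M. u p *\<^sub>R ?\<Psi> p) = - (LINT p|?M. ?\<Phi> p *\<^sub>R g p)"
      using u grad unfolding H1_def weak_gradient_def by blast
    have c\<Psi>: "continuous_on UNIV ?\<Psi>"
      by (rule smooth_torus_gradient_continuous[OF elementary_smooth[OF elem] grad])
    obtain D where D: "\<And>p. norm (?\<Psi> p) \<le> D" using bounded_torus_function[OF c\<Psi>] by blast
    have i1: "integrable ?M (\<lambda>p. u p *\<^sub>R ?\<Psi> p)"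
      by (rule integrable_scaleR_bounded[OF iu measurable_domain[OF borel_measurable_continuous_onI[OF c\<Psi>]] D])
    have i2: "integrable ?M (\<lambda>p. ?\<Phi> p *\<^sub>R g p)"
    proof (rule Bochner_Integration.integrable_bound[where f = "\<lambda>p. B * norm (g p)"])
      show "AE p in ?M. norm (?\<Phi> p *\<^sub>R g p) \<le> norm (B * norm (g p))"
      proof (rule AE_I2)
        fix p
        have "\<bar>\<phi> p\<bar> * \<bar>cut n (s p)\<bar> \<le> \<bar>B\<bar> * 1" using B[of p] cut_le[of n "s p"] by (intro mult_mono) auto
        then show "norm (?\<Phi> p *\<^sub>R g p) \<le> norm (B * norm (g p))" by (simp add: abs_mult mult_right_mono)
      qed
    qed (use ig in auto)
    have "(LINT p|?M. cut n (s p) * (u p * (\<psi> p \<bullet> e))) = (LINT p|?M. (u p *\<^sub>R ?\<Psi> p) \<bullet> e)"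
      by (intro Bochner_Integration.integral_cong refl) (simp add: inner_add_left s(3))
    also have "\<dots> = (LINT p|?M. u p *\<^sub>R ?\<Psi> p) \<bullet> e" by (rule integral_inner_left[OF i1])
    also have "\<dots> = - ((LINT p|?M. ?\<Phi> p *\<^sub>R g p) \<bullet> e)" unfolding weak by simp
    also have "\<dots> = - (LINT p|?M. (?\<Phi> p *\<^sub>R g p) \<bullet> e)" by (simp only: integral_inner_left[OF i2])
    also have "\<dots> = - (LINT p|?M. cut n (s p) * (\<phi> p * (g p \<bullet> e)))" by (simp add: mult_ac)
    finally show ?thesis .
  qed
  have dom: "(\<lambda>n. LINT p|?M. cut n (s p) * f p) \<longlonglongrightarrow> (LINT p|?M. indicator {p. s p > 0} p * f p)" if f: "integrable ?M f" for f
  proof (rule integral_dominated_convergence[where w = "\<lambda>p. \<bar>f p\<bar>"])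
    have [measurable]: "f \<in> borel_measurable ?M" using f by simp
    have "{p. s p > 0} \<in> sets borel" using elementary_measurable[OF s(1)] by (simp add: borel_measurable_iff_greater)
    then have "(indicator {p. s p > 0} :: _ \<Rightarrow> real) \<in> borel_measurable borel" by auto
    then have [measurable]: "(indicator {p. s p > 0} :: _ \<Rightarrow> real) \<in> borel_measurable ?M" by (intro measurable_domain)
    show "(\<lambda>p. indicator {p. s p > 0} p * f p) \<in> borel_measurable ?M" by measurable
    show "(\<lambda>p. cut n (s p) * f p) \<in> borel_measurable ?M" for n by measurable
    show "AE p in ?M. (\<lambda>n. cut n (s p) * f p) \<longlonglongrightarrow> indicator {p. s p > 0} p * f p"
      by (intro AE_I2 tendsto_mult_right lim)
    show "AE p in ?M. norm (cut n (s p) * f p) \<le> \<bar>f p\<bar>" for n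
      using cut_le mult_right_mono[OF cut_le] by (intro AE_I2) (simp add: abs_mult)
  qed (use f in simp)
  have u\<psi>: "integrable ?M (\<lambda>p. u p * (\<psi> p \<bullet> e))"
  proof (rule integrable_mult_bounded[OF iu])
    show "\<bar>\<psi> p \<bullet> e\<bar> \<le> C * norm e" for p
      using Cauchy_Schwarz_ineq2[of "\<psi> p" e] mult_right_mono[OF C[of p], of "norm e"] by simp
  qed simp
  have g\<phi>: "integrable ?M (\<lambda>p. \<phi> p * (g p \<bullet> e))"
    using integrable_mult_bounded[OF integrable_inner_left[OF ig, of e], of \<phi> B] B by (simp add: mult.commute)
  have "(\<lambda>n. - (LINT p|?M. cut n (s p) * (\<phi> p * (g p \<bullet> e)))) \<longlonglongrightarrow> (LINT p|?M. indicator {p. s p > 0} p * (u p * (\<psi> p \<bullet> e)))"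
    using dom[OF u\<psi>] by (simp only: step)
  from LIMSEQ_unique[OF this tendsto_minus[OF dom[OF g\<phi>]]] show ?thesis .
qed

section \<open>A Poincare inequality on the cracked torus\<close>

lemma cos_less_cos_arc: "cos z < cos b" if "0 \<le> b" "b < z" "z < 2 * pi - b" for z :: real
proof (cases "z \<le> pi")
  case True then show ?thesis using that by (intro cos_monotone_0_pi) auto
next
  case False
  have "cos (2 * pi - z) < cos b" using that False by (intro cos_monotone_0_pi) auto
  then show ?thesis by (simp add: cos_diff)
qed

lemma gradient_fst_zero:
  assumes "has_gradient f g" "\<And>x x' y. f (to_torus (x, y)) = f (to_torus (x', y))"
  shows "g p \<bullet> (1, 0) = 0"
proof -
  obtain x y where p: "p = to_torus (x, y)" by (metis torus_cases)
  have "((\<lambda>x. f (to_torus (x, y))) has_real_derivative 0) (at x)"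
  proof -
    have "(\<lambda>x. f (to_torus (x, y))) = (\<lambda>_. f (to_torus (0, y)))" by (rule ext) (rule assms(2))
    then show ?thesis by (simp only: DERIV_const)
  qed
  then show ?thesis using has_gradient_partial(1)[OF assms(1), of y x] DERIV_unique
    unfolding p by (fastforce simp: inner_prod_def)
qed

lemma gradient_snd_zero:
  assumes "has_gradient f g" "\<And>x y y'. f (to_torus (x, y)) = f (to_torus (x, y'))"
  shows "g p \<bullet> (0, 1) = 0"
proof -
  obtain x y where p: "p = to_torus (x, y)" by (metis torus_cases)
  have "((\<lambda>y. f (to_torus (x, y))) has_real_derivative 0) (at y)"
  proof -
    have "(\<lambda>y. f (to_torus (x, y))) = (\<lambda>_. f (to_torus (x, 0)))" by (rule ext) (rule assms(2))
    then show ?thesis by (simp only: DERIV_const)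
  qed
  then show ?thesis using has_gradient_partial(2)[OF assms(1), of x y] DERIV_unique
    unfolding p by (fastforce simp: inner_prod_def)
qed

lemma borel_measurable_fst_snd:
  fixes g :: "'a \<Rightarrow> real \<times> real"
  assumes "g \<in> borel_measurable M"
  shows "(\<lambda>p. fst (g p)) \<in> borel_measurable M" "(\<lambda>p. snd (g p)) \<in> borel_measurable M"
  by (rule measurable_compose[OF assms], intro borel_measurable_continuous_onI continuous_intros)+

text \<open>The number \<open>1/10\<close> is one choice for which the error terms in \<open>poincare\<close> fit under its constant \<open>4\<close>.\<close>

locale cracks =
  fixes k :: nat and y :: "nat \<Rightarrow> real" and a :: real
  assumes a_pos: "a > 0" and a_small: "a < 1 / 10"
begin

definition \<Omega> :: "torus set" where "\<Omega> = cracked_torus k y a"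

text \<open>This is the combination of eigenfunctions whose nodal domains are counted. It also describes the
  range of \<open>x\<close> occupied by the cracks, which is the set where it is nonnegative.\<close>

definition strip :: "torus \<Rightarrow> real" where
  "strip p = wave_x 1 (- (a / 4)) p + - cos (a / 4)"

lemma strip_to_torus: "strip (to_torus (x, t)) = cos (x / 2 - a / 4) - cos (a / 4)"
  by (simp add: strip_def wave_def)

lemma strip_elementary: "strip \<in> elementary"
  unfolding strip_def[abs_def] by (intro elementary.intros)

lemma strip_continuous: "continuous_on UNIV strip"
  by (rule elementary_continuous[OF strip_elementary])

lemma strip_pos_iff:
  assumes "x \<in> {0..<4 * pi}" shows "strip (to_torus (x, t)) > 0 \<longleftrightarrow> x \<in> {0<..<a}"
proof -
  have "a < 4 * pi" using a_small pi_gt3 by linarith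
  then show ?thesis
    using cos_arc_indicator[of a "4 * pi" x] a_pos assms by (simp add: strip_to_torus diff_divide_distrib)
qed

lemma strip_neg_iff:
  assumes "x \<in> {0..<4 * pi}" shows "strip (to_torus (x, t)) < 0 \<longleftrightarrow> x > a"
proof
  assume "x > a"
  then have "cos (x / 2 - a / 4) < cos (a / 4)"
    using a_pos assms by (intro cos_less_cos_arc) auto
  then show "strip (to_torus (x, t)) < 0" by (simp add: strip_to_torus)
next
  assume n: "strip (to_torus (x, t)) < 0"
  have "x \<noteq> 0" "x \<noteq> a" using n by (auto simp: strip_to_torus)
  moreover have "x \<notin> {0<..<a}" using n strip_pos_iff[OF assms, of t] by auto
  ultimately show "x > a" using assms by auto
qed

text \<open>Since \<open>line j\<close> is at most \<open>1\<close>, with equality exactly on the horizontal circle containing the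
  \<open>j\<close>-th crack, each crack is cut out by the continuous functions \<open>strip\<close> and \<open>line j\<close>.\<close>

definition line :: "nat \<Rightarrow> torus \<Rightarrow> real" where
  "line j p = wave_y 1 (- y j) p"

lemma line_to_torus: "line j (to_torus (x, t)) = cos (t - y j)"
  by (simp add: line_def wave_def)

lemma line_le_1: "line j p \<le> 1"
  by (simp add: line_def wave_y_def wave_def)

lemma line_elementary: "line j \<in> elementary"
  unfolding line_def[abs_def] by (intro elementary.intros)

lemma line_eq_1_iff: "line j (to_torus (x, t)) = 1 \<longleftrightarrow> [t = y j] (rmod 2 * pi)"
proof -
  have "line j (to_torus (x, t)) = 1 \<longleftrightarrow> (\<exists>n::int. t - y j = of_int n * 2 * pi)"
    unfolding line_to_torus by (rule cos_one_2pi_int)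
  also have "\<dots> \<longleftrightarrow> (\<exists>n::int. t = y j + of_int n * (2 * pi))"
    by (simp add: algebra_simps)
  also have "\<dots> \<longleftrightarrow> [y j = t] (rmod 2 * pi)" unfolding rcong_altdef ..
  finally show ?thesis using rcong_sym by blast
qed

lemma mem_\<Omega>_iff: "p \<in> \<Omega> \<longleftrightarrow> (\<forall>j\<in>{1..k}. strip p < 0 \<or> line j p < 1)"
proof -
  have "p \<in> to_torus ` ({0..a} \<times> {y j}) \<longleftrightarrow> \<not> (strip p < 0 \<or> line j p < 1)" for j
  proof
    assume "p \<in> to_torus ` ({0..a} \<times> {y j})"
    then obtain x where x: "x \<in> {0..a}" "p = to_torus (x, y j)" by blast
    have "x < 4 * pi" using x a_small pi_gt3 by auto
    then have "\<not> strip p < 0" using strip_neg_iff[of x "y j"] x by auto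
    moreover have "line j p = 1" unfolding x by (simp add: line_eq_1_iff)
    ultimately show "\<not> (strip p < 0 \<or> line j p < 1)" by simp
  next
    assume *: "\<not> (strip p < 0 \<or> line j p < 1)"
    obtain x t where p: "p = to_torus (x, t)" "x \<in> {0..<4 * pi}" by (metis torus_cases)
    have "x \<in> {0..a}" using * strip_neg_iff[OF p(2), of t] p by auto
    moreover have "line j p = 1" using * line_le_1[of j p] by linarith
    then have "p = to_torus (x, y j)" unfolding p line_eq_1_iff by (simp add: to_torus_eq_iff)
    ultimately show "p \<in> to_torus ` ({0..a} \<times> {y j})" by blast
  qed
  then show ?thesis unfolding \<Omega>_def cracked_torus_def by auto
qed

lemma open_\<Omega>: "open \<Omega>"
proof -
  have "\<Omega> = (\<Inter>j\<in>{1..k}. {p. strip p < 0} \<union> {p. line j p < 1})"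
    using mem_\<Omega>_iff by auto
  moreover have "open {p. strip p < 0}"
    by (rule open_Collect_less[OF strip_continuous continuous_on_const])
  moreover have "open {p. line j p < 1}" for j
    by (rule open_Collect_less[OF elementary_continuous[OF line_elementary] continuous_on_const])
  ultimately show ?thesis by (auto intro!: open_INT)
qed

lemma \<Omega>_borel: "\<Omega> \<in> sets borel"
  using open_\<Omega> by (rule borel_open)

text \<open>A function of \<open>y\<close> alone that vanishes on all horizontal circles containing a crack and is positive
  elsewhere.\<close>

definition off_lines :: "torus \<Rightarrow> real" where
  "off_lines p = (\<Prod>j\<in>{1..k}. 1 + (-1) * line j p)"

lemma off_lines_elementary: "off_lines \<in> elementary"
  unfolding off_lines_def[abs_def]
  by (intro elementary_prod elementary_add elementary_cmult elementary_const line_elementary) simp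

lemma off_lines_pos_iff: "off_lines p > 0 \<longleftrightarrow> (\<forall>j\<in>{1..k}. line j p < 1)"
proof
  assume "off_lines p > 0"
  then have "1 + (-1) * line j p \<noteq> 0" if "j \<in> {1..k}" for j
    using that unfolding off_lines_def by (metis finite_atLeastAtMost less_irrefl prod_zero)
  then show "\<forall>j\<in>{1..k}. line j p < 1" using line_le_1 by (force simp: less_le)
qed (auto simp: off_lines_def intro!: prod_pos)

lemma off_lines_subset: "{p. off_lines p > 0} \<subseteq> \<Omega>"
  by (auto simp: mem_\<Omega>_iff off_lines_pos_iff)

lemma AE_off_lines: "AE z in torus_rect. off_lines (to_torus z) > 0"
proof -
  interpret pair_sigma_finite "circle_measure (4 * pi)" "circle_measure (2 * pi)" by (rule pair_sigma_finite_circle)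
  have line: "AE t in circle_measure (2 * pi). \<not> [t = y j] (rmod 2 * pi)" for j
  proof -
    have "{t. [t = y j] (rmod 2 * pi)} \<subseteq> range (\<lambda>n::int. y j + of_int n * (2 * pi))"
      using rcong_altdef rcong_sym by fastforce
    then have "countable {t. [t = y j] (rmod 2 * pi)}" by (rule countable_subset) simp
    then have "AE t in lborel. t \<notin> {t. [t = y j] (rmod 2 * pi)}"
      by (intro AE_not_in countable_imp_null_set_lborel)
    then show ?thesis unfolding circle_measure_def by (subst AE_restrict_space_iff) (auto elim: eventually_mono)
  qed
  have m: "(\<lambda>z. off_lines (to_torus z)) \<in> borel_measurable torus_rect"
    by (rule measurable_compose[OF to_torus_measurable elementary_measurable[OF off_lines_elementary]])
  show ?thesis
  proof (rule AE_pair_measure)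
    show "{z \<in> space torus_rect. off_lines (to_torus z) > 0} \<in> sets torus_rect"
      using m by measurable
    have *: "AE t in circle_measure (2 * pi). \<forall>j\<in>{1..k}. \<not> [t = y j] (rmod 2 * pi)"
      using line by (intro AE_finite_allI) auto
    show "AE x in circle_measure (4 * pi). AE t in circle_measure (2 * pi). off_lines (to_torus (x, t)) > 0"
    proof (rule AE_I2)
      fix x
      show "AE t in circle_measure (2 * pi). off_lines (to_torus (x, t)) > 0"
        using *
      proof eventually_elim
        case (elim t)
        have "line j (to_torus (x, t)) < 1" if "j \<in> {1..k}" for j
          using elim that line_le_1[of j "to_torus (x, t)"] line_eq_1_iff[of j x t] by (auto simp: less_le)
        then show ?case unfolding off_lines_pos_iff by blast
      qed
    qed
  qed
qed

lemma AE_\<Omega>: "AE z in torus_rect. to_torus z \<in> \<Omega>"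
  using AE_off_lines off_lines_subset by (auto elim!: eventually_mono)

lemma AE_domain_off_lines: "AE p in domain_measure \<Omega>. off_lines p > 0"
proof -
  have "AE p in torus_measure. off_lines p > 0"
    unfolding torus_measure_eq
  proof (subst AE_distr_iff[OF to_torus_measurable])
    show "{p \<in> space borel. off_lines p > 0} \<in> sets borel"
      using elementary_measurable[OF off_lines_elementary] by measurable
  qed (rule AE_off_lines)
  then show ?thesis unfolding domain_measure_def
    using \<Omega>_borel by (subst AE_restrict_space_iff) (auto simp: sets_torus_measure space_torus_measure elim: eventually_mono)
qed

text \<open>The cut-off is a function of \<open>off_lines\<close>, hence of \<open>y\<close> alone, and the set removed in the limit is
  null: the derivative in \<open>x\<close> does not see the cracks.\<close>

lemma horizontal_derivative:
  assumes u: "H1 \<Omega> u g" and \<phi>: "\<phi> \<in> elementary" "has_gradient \<phi> \<psi>"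
  shows "(LINT p|domain_measure \<Omega>. u p * fst (\<psi> p)) = - (LINT p|domain_measure \<Omega>. \<phi> p * fst (g p))"
proof -
  obtain \<sigma> where \<sigma>: "has_gradient off_lines \<sigma>" using elementary_gradient[OF off_lines_elementary] by blast
  have "\<sigma> p \<bullet> (1, 0) = 0" for p
    by (rule gradient_fst_zero[OF \<sigma>]) (simp add: off_lines_def line_to_torus)
  from weak_derivative_on_positive_set[OF \<Omega>_borel u off_lines_elementary \<sigma> this off_lines_subset \<phi>]
  have *: "(LINT p|domain_measure \<Omega>. indicator {p. off_lines p > 0} p * (u p * fst (\<psi> p)))
    = - (LINT p|domain_measure \<Omega>. indicator {p. off_lines p > 0} p * (\<phi> p * fst (g p)))"
    by (simp add: inner_prod_def)
  have m: "u \<in> borel_measurable (domain_measure \<Omega>)" "g \<in> borel_measurable (domain_measure \<Omega>)"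
     "\<phi> \<in> borel_measurable (domain_measure \<Omega>)" "\<psi> \<in> borel_measurable (domain_measure \<Omega>)"
    using u \<phi> by (auto simp: H1_def L2_def measurable_domain[OF elementary_measurable] measurable_domain[OF elementary_gradient_measurable[OF \<phi>]])
  have rem: "(LINT p|domain_measure \<Omega>. indicator {p. off_lines p > 0} p * f p) = (LINT p|domain_measure \<Omega>. f p)"
    if f: "f \<in> borel_measurable (domain_measure \<Omega>)" for f :: "torus \<Rightarrow> real"
  proof (rule integral_cong_AE)
    have "(indicator {p. off_lines p > 0} :: _ \<Rightarrow> real) \<in> borel_measurable borel"
      using elementary_measurable[OF off_lines_elementary] by (intro borel_measurable_indicator) (simp add: borel_measurable_iff_greater)
    then show "(\<lambda>p. indicator {p. off_lines p > 0} p * f p) \<in> borel_measurable (domain_measure \<Omega>)"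
      using f by (intro borel_measurable_times[OF measurable_domain])
    show "AE p in domain_measure \<Omega>. indicator {p. off_lines p > 0} p * f p = f p"
      using AE_domain_off_lines by eventually_elim simp
  qed (rule f)
  have "(\<lambda>p. u p * fst (\<psi> p)) \<in> borel_measurable (domain_measure \<Omega>)" "(\<lambda>p. \<phi> p * fst (g p)) \<in> borel_measurable (domain_measure \<Omega>)"
    using borel_measurable_fst_snd[OF m(2)] borel_measurable_fst_snd[OF m(4)] m by measurable
  with * show ?thesis by (simp only: rem)
qed

text \<open>Here the cut-off is a function of \<open>strip\<close>, hence of \<open>x\<close> alone, and the whole range of \<open>x\<close> occupied by
  the cracks is removed.\<close>

lemma vertical_derivative:
  assumes u: "H1 \<Omega> u g" and \<phi>: "\<phi> \<in> elementary" "has_gradient \<phi> \<psi>"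
  shows "(LINT p|domain_measure \<Omega>. indicator {p. strip p < 0} p * (u p * snd (\<psi> p)))
    = - (LINT p|domain_measure \<Omega>. indicator {p. strip p < 0} p * (\<phi> p * snd (g p)))"
proof -
  let ?s = "\<lambda>p. (-1) * strip p"
  have s: "?s \<in> elementary" by (rule elementary_cmult[OF strip_elementary])
  obtain \<sigma> where \<sigma>: "has_gradient ?s \<sigma>" using elementary_gradient[OF s] by blast
  have "\<sigma> p \<bullet> (0, 1) = 0" for p
    by (rule gradient_snd_zero[OF \<sigma>]) (simp add: strip_to_torus)
  moreover have "{p. ?s p > 0} \<subseteq> \<Omega>" by (auto simp: mem_\<Omega>_iff)
  ultimately show ?thesis
    using weak_derivative_on_positive_set[OF \<Omega>_borel u s \<sigma> _ _ \<phi>, of "(0, 1)"] by (simp add: inner_prod_def)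
qed

text \<open>The hypothesis says that the mean of \<open>u\<close> over almost every vertical circle is zero. The constant
  \<open>4\<close> is tuned to the eigenvalue \<open>1/4\<close>; \<open>torus_poincare\<close> would give any constant above \<open>\<pi>\<^sup>2/4\<close> for
  \<open>a\<close> small enough.\<close>

lemma poincare:
  assumes u: "H1 \<Omega> u g" and orth: "\<And>n \<theta>. (LINT p|domain_measure \<Omega>. u p * wave_x n \<theta> p) = 0"
  shows "(LINT p|domain_measure \<Omega>. (u p)\<^sup>2) \<le> 4 * (LINT p|domain_measure \<Omega>. g p \<bullet> g p)"
proof -
  let ?M = "domain_measure \<Omega>"
  have mu [measurable]: "u \<in> borel_measurable ?M" and mg [measurable]: "g \<in> borel_measurable ?M"
    and u2: "integrable ?M (\<lambda>p. (u p)\<^sup>2)" and g2: "integrable ?M (\<lambda>p. (norm (g p))\<^sup>2)"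
    using u by (auto simp: H1_def L2_def)
  note [measurable] = borel_measurable_fst_snd[OF mg]
  have fg2: "integrable ?M (\<lambda>p. (fst (g p))\<^sup>2)"
    by (rule Bochner_Integration.integrable_bound[OF g2]) (measurable, simp add: norm_prod_def)
  have sg2: "integrable ?M (\<lambda>p. (snd (g p))\<^sup>2)"
    by (rule Bochner_Integration.integrable_bound[OF g2]) (measurable, simp add: norm_prod_def)
  (* Extension by zero across the cracks makes measurability on the domain available on the
     whole rectangle. *)
  define pull where "pull f = (\<lambda>x t. indicator \<Omega> (to_torus (x, t)) * f (to_torus (x, t)) :: real)" for f
  have pull_m: "(\<lambda>(x, t). pull f x t) \<in> borel_measurable torus_rect" if "f \<in> borel_measurable ?M" for f
    using measurable_compose[OF to_torus_measurable, of "\<lambda>p. indicator \<Omega> p *\<^sub>R f p"] that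
    by (simp add: domain_measurable_iff[OF \<Omega>_borel] pull_def split_beta')
  have pull_i: "(LINT (x, t)|torus_rect. pull f x t) = (LINT p|?M. f p)" if "f \<in> borel_measurable ?M" for f
    using domain_integral_eq[OF \<Omega>_borel that] by (simp add: pull_def split_beta')
  have pull_int: "integrable torus_rect (\<lambda>(x, t). pull f x t)" if "integrable ?M f" for f
    using domain_integrable_iff[OF \<Omega>_borel, of f] that by (simp add: pull_def split_beta')
  have pull_sq: "(pull f x t)\<^sup>2 = pull (\<lambda>p. (f p)\<^sup>2) x t" for f x t
    by (simp add: pull_def power_mult_distrib indicator_def)
  have pull_mult: "pull f x t * h (to_torus (x, t)) = pull (\<lambda>p. f p * h p) x t" for f h x t
    by (simp add: pull_def)
  have wm [measurable]: "wave_x n \<theta> \<in> borel_measurable ?M" "wave_y n \<theta> \<in> borel_measurable ?M" for n \<theta>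
    by (intro measurable_domain elementary_measurable elementary.intros)+
  let ?S = "{x. cos (x / 2 - a / 4) - cos (a / 4) < 0}"
  have S: "?S \<in> sets borel"
  proof -
    have "open ?S" by (intro open_Collect_less continuous_intros) simp_all
    then show ?thesis by (rule borel_open)
  qed
  have indS: "indicator ?S x = (indicator {p. strip p < 0} (to_torus (x, t)) :: real)" for x t
    by (simp add: indicator_def strip_to_torus)
  have sm [measurable]: "(indicator {p. strip p < 0} :: _ \<Rightarrow> real) \<in> borel_measurable ?M"
  proof (rule measurable_domain)
    have "open {p. strip p < 0}" by (rule open_Collect_less[OF strip_continuous continuous_on_const])
    then show "(indicator {p. strip p < 0} :: _ \<Rightarrow> real) \<in> borel_measurable borel"
      by (intro borel_measurable_indicator borel_open)
  qed
  have prod_elem: "(\<lambda>p. wave_x n \<theta> p * wave_y m \<phi> p) \<in> elementary" for n \<theta> m \<phi>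
    by (intro elementary.intros)
  let ?kx = "\<lambda>n. real n * (2 * pi / (4 * pi))" and ?ky = "\<lambda>m. real m * (2 * pi / (2 * pi))"
  note prod_grad = has_gradient_mult[OF has_gradient_wave_x has_gradient_wave_y]
  have "(LINT (x, t)|torus_rect. (pull u x t)\<^sup>2)
    \<le> (2 * pi)\<^sup>2 / 16 * (LINT (x, t)|torus_rect. (pull (\<lambda>p. snd (g p)) x t)\<^sup>2)
      + measure (circle_measure (4 * pi)) ({0..<4 * pi} - ?S) *
        (2 / (4 * pi) * (LINT (x, t)|torus_rect. (pull u x t)\<^sup>2)
          + 4 * pi / 2 * (LINT (x, t)|torus_rect. (pull (\<lambda>p. fst (g p)) x t)\<^sup>2))"
  proof (rule torus_poincare[OF _ _ S])
    show "(\<lambda>(x, t). pull u x t) \<in> borel_measurable torus_rect" by (rule pull_m[OF mu])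
    show "(\<lambda>(x, t). pull (\<lambda>p. fst (g p)) x t) \<in> borel_measurable torus_rect"
      by (rule pull_m[OF borel_measurable_fst_snd(1)[OF mg]])
    show "(\<lambda>(x, t). pull (\<lambda>p. snd (g p)) x t) \<in> borel_measurable torus_rect"
      by (rule pull_m[OF borel_measurable_fst_snd(2)[OF mg]])
    show "integrable torus_rect (\<lambda>(x, t). (pull u x t)\<^sup>2)"
      unfolding pull_sq by (rule pull_int[OF u2])
    show "integrable torus_rect (\<lambda>(x, t). (pull (\<lambda>p. fst (g p)) x t)\<^sup>2)"
      unfolding pull_sq by (rule pull_int[OF fg2])
    show "integrable torus_rect (\<lambda>(x, t). (pull (\<lambda>p. snd (g p)) x t)\<^sup>2)"
      unfolding pull_sq by (rule pull_int[OF sg2])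
    show "(LINT (x, t)|torus_rect. pull u x t * wave (4 * pi) n \<theta> x) = 0" for n \<theta>
    proof -
      have "pull u x t * wave (4 * pi) n \<theta> x = pull (\<lambda>p. u p * wave_x n \<theta> p) x t" for x t
        by (simp flip: pull_mult)
      moreover have "(\<lambda>p. u p * wave_x n \<theta> p) \<in> borel_measurable ?M" by measurable
      ultimately show ?thesis using orth by (simp add: pull_i)
    qed
    fix n \<theta> m \<phi>
    show "(LINT (x, t)|torus_rect. pull u x t * (?kx n * wave (4 * pi) n (\<theta> + pi / 2) x * wave (2 * pi) m \<phi> t))
       = - (LINT (x, t)|torus_rect. pull (\<lambda>p. fst (g p)) x t * (wave (4 * pi) n \<theta> x * wave (2 * pi) m \<phi> t))"
    proof -
      let ?f = "\<lambda>p. u p * (?kx n * wave_x n (\<theta> + pi / 2) p * wave_y m \<phi> p)"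
      let ?h = "\<lambda>p. fst (g p) * (wave_x n \<theta> p * wave_y m \<phi> p)"
      have "(LINT p|?M. ?f p) = - (LINT p|?M. ?h p)"
        using horizontal_derivative[OF u prod_elem prod_grad, of n \<theta> m \<phi>] by (simp only: fst_add fst_scaleR fst_conv real_scaleR_def mult_zero_left mult_zero_right add_0_left mult.commute)
      moreover have "?f \<in> borel_measurable ?M" "?h \<in> borel_measurable ?M" by measurable
      moreover have "pull u x t * (?kx n * wave (4 * pi) n (\<theta> + pi / 2) x * wave (2 * pi) m \<phi> t) = pull ?f x t"
        "pull (\<lambda>p. fst (g p)) x t * (wave (4 * pi) n \<theta> x * wave (2 * pi) m \<phi> t) = pull ?h x t" for x t
        by (simp_all add: pull_def)
      ultimately show ?thesis by (simp only: pull_i)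
    qed
    show "(LINT (x, t)|torus_rect. indicator ?S x * pull u x t * (wave (4 * pi) n \<theta> x * (?ky m * wave (2 * pi) m (\<phi> + pi / 2) t)))
       = - (LINT (x, t)|torus_rect. indicator ?S x * pull (\<lambda>p. snd (g p)) x t * (wave (4 * pi) n \<theta> x * wave (2 * pi) m \<phi> t))"
    proof -
      let ?f = "\<lambda>p. indicator {p. strip p < 0} p * (u p * (wave_x n \<theta> p * (?ky m * wave_y m (\<phi> + pi / 2) p)))"
      let ?h = "\<lambda>p. indicator {p. strip p < 0} p * (snd (g p) * (wave_x n \<theta> p * wave_y m \<phi> p))"
      have "(LINT p|?M. ?f p) = - (LINT p|?M. ?h p)"
        using vertical_derivative[OF u prod_elem prod_grad, of n \<theta> m \<phi>] by (simp only: snd_add snd_scaleR snd_conv real_scaleR_def mult_zero_left mult_zero_right add_0_right mult.commute)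
      moreover have "?f \<in> borel_measurable ?M" "?h \<in> borel_measurable ?M" by measurable
      moreover have "indicator ?S x * pull u x t * (wave (4 * pi) n \<theta> x * (?ky m * wave (2 * pi) m (\<phi> + pi / 2) t)) = pull ?f x t"
        "indicator ?S x * pull (\<lambda>p. snd (g p)) x t * (wave (4 * pi) n \<theta> x * wave (2 * pi) m \<phi> t) = pull ?h x t" for x t
        unfolding indS[of x t] by (simp_all add: pull_def)
      ultimately show ?thesis by (simp only: pull_i)
    qed
  qed simp_all
  then have main: "(LINT p|?M. (u p)\<^sup>2) \<le> pi\<^sup>2 / 4 * (LINT p|?M. (snd (g p))\<^sup>2)
      + measure (circle_measure (4 * pi)) ({0..<4 * pi} - ?S) *
        (1 / (2 * pi) * (LINT p|?M. (u p)\<^sup>2) + 2 * pi * (LINT p|?M. (fst (g p))\<^sup>2))"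
    unfolding pull_sq by (simp add: pull_i power_mult_distrib)
  have "measure (circle_measure (4 * pi)) ({0..<4 * pi} - ?S) = a"
  proof -
    have "{0..<4 * pi} - ?S = {0..a}"
    proof -
      have "a < 4 * pi" using a_small pi_gt3 by linarith
      moreover have "x \<in> ?S \<longleftrightarrow> x > a" if "x \<in> {0..<4 * pi}" for x
        using strip_neg_iff[OF that] by (simp add: strip_to_torus)
      ultimately show ?thesis by force
    qed
    moreover have "{0..a} \<subseteq> {0..<4 * pi}" using a_small pi_gt3 by auto
    ultimately show ?thesis
      using a_pos by (simp add: circle_measure_def measure_restrict_space)
  qed
  moreover define U F S where "U = (LINT p|?M. (u p)\<^sup>2)" and "F = (LINT p|?M. (fst (g p))\<^sup>2)" and "S = (LINT p|?M. (snd (g p))\<^sup>2)"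
  ultimately have main: "U \<le> pi\<^sup>2 / 4 * S + a * (1 / (2 * pi) * U + 2 * pi * F)"
    using main by simp
  have nn: "U \<ge> 0" "F \<ge> 0" "S \<ge> 0" by (simp_all add: U_def F_def S_def)
  have pi: "pi > 3" "pi < 22 / 7" using pi_gt3 pi_less_4 pi_approx by auto
  have "pi\<^sup>2 \<le> (22 / 7)\<^sup>2" using pi by (intro power_mono) auto
  then have "pi\<^sup>2 / 4 \<le> 5 / 2" by (simp add: power2_eq_square)
  then have 1: "pi\<^sup>2 / 4 * S \<le> 5 / 2 * S" using nn by (intro mult_right_mono)
  have "a * (1 / (2 * pi)) \<le> 1 / 10 * (1 / 6)"
    using a_pos a_small pi by (intro mult_mono) (auto simp: field_simps)
  then have 2: "a * (1 / (2 * pi)) * U \<le> 1 / 10 * (1 / 6) * U" using nn by (intro mult_right_mono)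
  have "a * (2 * pi) \<le> 1 / 10 * (44 / 7)"
    using a_pos a_small pi by (intro mult_mono) auto
  then have 3: "a * (2 * pi) * F \<le> 1 / 10 * (44 / 7) * F" using nn by (intro mult_right_mono)
  have "a * (1 / (2 * pi) * U + 2 * pi * F) = a * (1 / (2 * pi)) * U + a * (2 * pi) * F"
    by (simp only: distrib_left mult.assoc)
  then have "U \<le> 5 / 2 * S + (1 / 10 * (1 / 6) * U + 1 / 10 * (44 / 7) * F)"
    using main add_mono[OF 1 add_mono[OF 2 3]] by (simp only:)
  then have "U \<le> 4 * (F + S)"
    using nn by simp
  also have "F + S = (LINT p|?M. g p \<bullet> g p)"
    unfolding F_def S_def using fg2 sg2 by (simp add: inner_prod_def power2_eq_square)
  finally show ?thesis unfolding U_def .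
qed

end

section \<open>The eigenvalues below one quarter\<close>

context cracks begin

lemma integrable_domain_continuous:
  fixes f :: "torus \<Rightarrow> real"
  assumes "continuous_on UNIV f" shows "integrable (domain_measure \<Omega>) f"
  by (rule L2_integrable[OF \<Omega>_borel L2_continuous[OF \<Omega>_borel assms]])

lemma H1_wave_x: "H1 \<Omega> (wave_x n \<theta>) (\<lambda>p. (real n / 2 * wave_x n (\<theta> + pi / 2) p, 0))"
  using H1_elementary[OF \<Omega>_borel AE_\<Omega> elementary_wave_x has_gradient_wave_x, of n \<theta>] by simp

lemma wave_x_derivative:
  assumes "H1 \<Omega> u g"
  shows "real n / 2 * (LINT p|domain_measure \<Omega>. u p * wave_x n (\<theta> + pi / 2) p)
    = - (LINT p|domain_measure \<Omega>. wave_x n \<theta> p * fst (g p))"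
  using horizontal_derivative[OF assms elementary_wave_x has_gradient_wave_x, of n \<theta>]
  by (simp add: mult.left_commute[of "u _"])

text \<open>Both derivatives fall on the wave, because it depends on \<open>x\<close> only.\<close>

lemma wave_x_weak_eigenfunction:
  assumes "H1 \<Omega> u g"
  shows "(LINT p|domain_measure \<Omega>. (real n / 2 * wave_x n (\<theta> + pi / 2) p, 0) \<bullet> g p)
    = (real n / 2)\<^sup>2 * (LINT p|domain_measure \<Omega>. wave_x n \<theta> p * u p)"
proof -
  have shift: "wave_x n (\<theta> + pi / 2 + pi / 2) p = - wave_x n \<theta> p" for p
    by (simp add: wave_x_def wave_def cos_add sin_add)
  have "(LINT p|domain_measure \<Omega>. (real n / 2 * wave_x n (\<theta> + pi / 2) p, 0) \<bullet> g p)
    = (LINT p|domain_measure \<Omega>. real n / 2 * (wave_x n (\<theta> + pi / 2) p * fst (g p)))"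
    by (simp only: inner_prod_def fst_conv snd_conv inner_real_def mult_zero_left add_0_right mult.assoc)
  also have "\<dots> = real n / 2 * (LINT p|domain_measure \<Omega>. wave_x n (\<theta> + pi / 2) p * fst (g p))"
    by (rule integral_mult_right_zero)
  also have "\<dots> = real n / 2 * - (real n / 2 * (LINT p|domain_measure \<Omega>. u p * wave_x n (\<theta> + pi / 2 + pi / 2) p))"
    using wave_x_derivative[OF assms, of n "\<theta> + pi / 2"] by simp
  also have "\<dots> = (real n / 2)\<^sup>2 * (LINT p|domain_measure \<Omega>. wave_x n \<theta> p * u p)"
    unfolding shift by (simp add: power2_eq_square mult.commute)
  finally show ?thesis .
qed

lemma wave_x_eigenspace: "wave_x n \<theta> \<in> eigenspace \<Omega> ((real n / 2)\<^sup>2)"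
proof -
  have "L2 \<Omega> (\<lambda>p. (real n / 2)\<^sup>2 * wave_x n \<theta> p)"
    by (intro L2_continuous \<Omega>_borel elementary_continuous elementary_cmult elementary_wave_x)
  moreover have "(LINT p|domain_measure \<Omega>. (real n / 2 * wave_x n (\<theta> + pi / 2) p, 0) \<bullet> h p)
      = (LINT p|domain_measure \<Omega>. (real n / 2)\<^sup>2 * wave_x n \<theta> p * w p)" if "H1 \<Omega> w h" for w h
    unfolding wave_x_weak_eigenfunction[OF that] by (simp only: mult.assoc integral_mult_right_zero)
  ultimately show ?thesis
    unfolding eigenspace_def neumann_laplacian_def using H1_wave_x by blast
qed

lemma measure_\<Omega>: "(LINT p|domain_measure \<Omega>. c) = 8 * pi\<^sup>2 * (c :: real)"
proof -
  interpret pair_sigma_finite "circle_measure (4 * pi)" "circle_measure (2 * pi)" by (rule pair_sigma_finite_circle)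
  have "(LINT p|domain_measure \<Omega>. c) = (LINT z|torus_rect. indicator \<Omega> (to_torus z) *\<^sub>R c)"
    by (rule domain_integral_eq[OF \<Omega>_borel]) simp
  also have "\<dots> = (LINT z|torus_rect. c)"
  proof (rule integral_cong_AE)
    show "(\<lambda>z. indicator \<Omega> (to_torus z) *\<^sub>R c) \<in> borel_measurable torus_rect"
      using measurable_compose[OF to_torus_measurable borel_measurable_indicator[OF \<Omega>_borel]] by (intro borel_measurable_scaleR) auto
    show "AE z in torus_rect. indicator \<Omega> (to_torus z) *\<^sub>R c = c" using AE_\<Omega> by eventually_elim simp
  qed simp
  also have "\<dots> = (LINT x|circle_measure (4 * pi). LINT t|circle_measure (2 * pi). c)"
  proof -
    have "(\<lambda>(x :: real, t :: real). c) = (\<lambda>_. c)" by auto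
    then show ?thesis
      using integral_fst[of "\<lambda>_ _. c"] finite_measure.integrable_const[OF finite_measure_circle_pair, of _ _ c]
      by (simp only:)
  qed
  also have "\<dots> = 8 * pi\<^sup>2 * c" by (simp add: measure_circle_measure_space power2_eq_square)
  finally show ?thesis .
qed

lemma wave_x_mean_zero: "(LINT p|domain_measure \<Omega>. wave_x n \<theta> p) = 0" if "n > 0"
proof -
  have "H1 \<Omega> (\<lambda>_. 1) (\<lambda>_. 0)"
    by (rule H1_elementary[OF \<Omega>_borel AE_\<Omega> elementary_const has_gradient_const])
  from wave_x_derivative[OF this, of n "\<theta> - pi / 2"] show ?thesis using that by simp
qed

text \<open>The mean of the square is \<open>1/2\<close> for \<open>n > 0\<close>, by the double-angle formula.\<close>

lemma wave_x_not_AE_zero: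
  assumes n: "n > 0 \<or> \<theta> = 0"
  shows "\<not> (AE p in domain_measure \<Omega>. wave_x n \<theta> p = 0)"
proof
  assume "AE p in domain_measure \<Omega>. wave_x n \<theta> p = 0"
  then have "(LINT p|domain_measure \<Omega>. (wave_x n \<theta> p)\<^sup>2) = 0"
    by (intro integral_eq_zero_AE) (auto elim: eventually_mono)
  moreover have "(wave_x n \<theta> p)\<^sup>2 = 1 / 2 + 1 / 2 * wave_x (2 * n) (2 * \<theta>) p" for p
    using cos_double_cos[of "real n * (fst (rep_torus p)) / 2 + \<theta>"]
    by (simp add: wave_x_def wave_def algebra_simps)
  moreover have "(LINT p|domain_measure \<Omega>. 1 / 2 + 1 / 2 * wave_x (2 * n) (2 * \<theta>) p) = 4 * pi\<^sup>2 + 1 / 2 * (LINT p|domain_measure \<Omega>. wave_x (2 * n) (2 * \<theta>) p)"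
    using measure_\<Omega>[of "1 / 2"] integrable_domain_continuous[OF elementary_continuous[OF elementary_wave_x]]
      integrable_domain_continuous[OF continuous_on_const, of "1 / 2"] by simp
  moreover have "(LINT p|domain_measure \<Omega>. wave_x (2 * n) (2 * \<theta>) p) \<ge> 0"
  proof (cases "n = 0")
    case True
    then show ?thesis using n by (simp add: wave_x_def wave_0)
  next
    case False
    then show ?thesis using wave_x_mean_zero[of "2 * n" "2 * \<theta>"] by simp
  qed
  moreover have "pi\<^sup>2 > 0" by simp
  ultimately show False by (simp add: add_pos_nonneg)
qed

lemma H1_add_const:
  assumes u: "H1 \<Omega> u g" shows "H1 \<Omega> (\<lambda>p. u p + c) g"
proof -
  let ?M = "domain_measure \<Omega>"
  have mu [measurable]: "u \<in> borel_measurable ?M" and u2: "integrable ?M (\<lambda>p. (u p)\<^sup>2)"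
    and wg: "weak_gradient \<Omega> u g"
    using u by (auto simp: H1_def L2_def)
  have iu: "integrable ?M u" using u by (intro L2_integrable[OF \<Omega>_borel]) (simp add: H1_def)
  have ic: "integrable ?M (\<lambda>p. b)" for b :: real by (rule integrable_domain_continuous) simp
  have "(u p + c)\<^sup>2 = (u p)\<^sup>2 + 2 * c * u p + c\<^sup>2" for p by (simp add: power2_sum)
  moreover have "integrable ?M (\<lambda>p. (u p)\<^sup>2 + 2 * c * u p + c\<^sup>2)"
    by (intro Bochner_Integration.integrable_add integrable_mult_right u2 iu ic)
  ultimately have L: "L2 \<Omega> (\<lambda>p. u p + c)" unfolding L2_def by simp
  have "weak_gradient \<Omega> (\<lambda>p. u p + c) g"
    unfolding weak_gradient_def
  proof (intro allI impI, elim conjE)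
    fix \<phi> \<psi> assume t: "test_function \<Omega> \<phi>" and \<psi>: "has_gradient \<phi> \<psi>"
    have c\<psi>: "continuous_on UNIV \<psi>"
      using t \<psi> by (auto simp: test_function_def intro: smooth_torus_gradient_continuous)
    obtain B where B: "\<And>p. norm (\<psi> p) \<le> B" using bounded_torus_function[OF c\<psi>] by blast
    have m\<psi>: "\<psi> \<in> borel_measurable ?M" by (rule measurable_domain[OF borel_measurable_continuous_onI[OF c\<psi>]])
    have "weak_gradient \<Omega> (\<lambda>_. c) (\<lambda>_. 0)"
      using H1_elementary[OF \<Omega>_borel AE_\<Omega> elementary_const has_gradient_const] by (simp add: H1_def)
    then have c0: "(LINT p|?M. c *\<^sub>R \<psi> p) = 0"
      using t \<psi> unfolding weak_gradient_def by fastforce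
    have "(LINT p|?M. (u p + c) *\<^sub>R \<psi> p) = (LINT p|?M. u p *\<^sub>R \<psi> p + c *\<^sub>R \<psi> p)"
      by (simp add: scaleR_add_left)
    also have "\<dots> = (LINT p|?M. u p *\<^sub>R \<psi> p)"
      using Bochner_Integration.integral_add[OF integrable_scaleR_bounded[OF iu m\<psi> B] integrable_scaleR_bounded[OF ic m\<psi> B]] c0 by simp
    also have "\<dots> = - (LINT p|?M. \<phi> p *\<^sub>R g p)"
      using wg t \<psi> unfolding weak_gradient_def by blast
    finally show "(LINT p|?M. (u p + c) *\<^sub>R \<psi> p) = - (LINT p|?M. \<phi> p *\<^sub>R g p)" .
  qed
  then show ?thesis using L u by (simp add: H1_def)
qed

text \<open>For \<open>n \<ge> 1\<close> the waves are eigenfunctions with eigenvalue \<open>n\<^sup>2/4 > \<mu>\<close>, hence orthogonal to \<open>u\<close>. Then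
  \<open>poincare\<close> applies to \<open>u\<close> minus its mean, and that mean is zero unless \<open>\<mu> = 0\<close>.\<close>

lemma eigenspace_below_quarter:
  assumes u: "u \<in> eigenspace \<Omega> \<mu>" and \<mu>: "\<mu> < 1 / 4"
  obtains c where "AE p in domain_measure \<Omega>. u p = c" "\<mu> = 0 \<or> c = 0"
proof -
  let ?M = "domain_measure \<Omega>"
  obtain g where H: "H1 \<Omega> u g" and eig: "\<And>w h. H1 \<Omega> w h \<Longrightarrow> (LINT p|?M. g p \<bullet> h p) = (LINT p|?M. \<mu> * u p * w p)"
    using u by (auto simp: eigenspace_def neumann_laplacian_def)
  have iu: "integrable ?M u" using H by (intro L2_integrable[OF \<Omega>_borel]) (simp add: H1_def)
  have ic: "integrable ?M (\<lambda>p. b)" for b :: real by (rule integrable_domain_continuous) simp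
  have orth: "\<mu> = (real n / 2)\<^sup>2 \<or> (LINT p|?M. wave_x n \<theta> p * u p) = 0" for n \<theta>
  proof -
    have "(LINT p|?M. (real n / 2 * wave_x n (\<theta> + pi / 2) p, 0) \<bullet> g p) = (LINT p|?M. g p \<bullet> (real n / 2 * wave_x n (\<theta> + pi / 2) p, 0))"
      by (simp add: inner_commute)
    also have "\<dots> = \<mu> * (LINT p|?M. wave_x n \<theta> p * u p)"
      using eig[OF H1_wave_x[of n \<theta>]] by (simp add: mult_ac)
    finally show ?thesis unfolding wave_x_weak_eigenfunction[OF H] by auto
  qed
  define c where "c = (LINT p|?M. u p) / (8 * pi\<^sup>2)"
  have c: "\<mu> = 0 \<or> c = 0"
    using orth[of 0 0] by (auto simp: c_def wave_x_def wave_0)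
  have mean: "(LINT p|?M. u p + - c) = 0"
    using Bochner_Integration.integral_add[OF iu ic[of "- c"]] unfolding measure_\<Omega> by (simp add: c_def)
  have orth': "(LINT p|?M. (u p + - c) * wave_x n \<theta> p) = 0" for n \<theta>
  proof (cases "n = 0")
    case True
    then show ?thesis using mean by (simp add: wave_x_def wave_0)
  next
    case False
    have "1 \<le> (real n)\<^sup>2" using False by (simp add: one_le_power)
    then have "(real n / 2)\<^sup>2 \<noteq> \<mu>" using \<mu> by (simp add: power_divide)
    then have z: "(LINT p|?M. wave_x n \<theta> p * u p) = 0" using orth[of n \<theta>] by auto
    have i: "integrable ?M (\<lambda>p. wave_x n \<theta> p * u p)"
      using integrable_mult_bounded[OF iu, of "wave_x n \<theta>" 1] measurable_domain[OF elementary_measurable[OF elementary_wave_x]]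
      by (simp add: mult.commute wave_x_def abs_wave_le)
    have "(LINT p|?M. (u p + - c) * wave_x n \<theta> p) = (LINT p|?M. wave_x n \<theta> p * u p - c * wave_x n \<theta> p)"
      by (simp add: algebra_simps)
    also have "\<dots> = 0"
      using i z wave_x_mean_zero[of n \<theta>] False integrable_domain_continuous[OF elementary_continuous[OF elementary_wave_x]] by simp
    finally show ?thesis .
  qed
  have iw: "integrable ?M (\<lambda>p. (u p + - c)\<^sup>2)"
    using H1_add_const[OF H, of "- c"] by (simp add: H1_def L2_def)
  have "(LINT p|?M. (u p + - c)\<^sup>2) \<le> 4 * (LINT p|?M. g p \<bullet> g p)"
    by (rule poincare[OF H1_add_const[OF H] orth'])
  also have "(LINT p|?M. g p \<bullet> g p) = \<mu> * (LINT p|?M. (u p)\<^sup>2)"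
    using eig[OF H] by (simp add: mult.assoc power2_eq_square)
  finally have le: "(LINT p|?M. (u p + - c)\<^sup>2) \<le> 4 * \<mu> * (LINT p|?M. (u p)\<^sup>2)" by simp
  have "(LINT p|?M. (u p + - c)\<^sup>2) \<le> 0"
  proof (cases "\<mu> = 0")
    case True
    then show ?thesis using le by simp
  next
    case False
    then have [simp]: "c = 0" using c by simp
    have "(1 - 4 * \<mu>) * (LINT p|?M. (u p)\<^sup>2) \<le> 0" using le by (simp add: algebra_simps)
    then show ?thesis using \<mu> by (simp add: mult_le_0_iff)
  qed
  then have "(LINT p|?M. (u p + - c)\<^sup>2) = 0" by (intro antisym) simp_all
  then have "AE p in ?M. (u p + - c)\<^sup>2 = 0"
    using integral_nonneg_eq_0_iff_AE[OF iw] by simp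
  then have "AE p in ?M. u p = c" by eventually_elim simp
  then show thesis using that c by blast
qed

lemma eigenvalue_below_quarter:
  assumes "eigenvalue \<Omega> \<mu>" "\<mu> < 1 / 4" shows "\<mu> = 0"
proof -
  obtain u where u: "u \<in> eigenspace \<Omega> \<mu>" "\<not> (AE p in domain_measure \<Omega>. u p = 0)"
    using assms(1) by (auto simp: eigenvalue_def eigenfunction_def)
  then show ?thesis using eigenspace_below_quarter[OF u(1) assms(2)] by metis
qed

text \<open>Any two almost constant functions are linearly dependent.\<close>

lemma multiplicity_0_le: "eigenvalue_multiplicity \<Omega> 0 \<le> 1"
  unfolding eigenvalue_multiplicity_def
proof (rule Sup_least, clarify)
  let ?M = "domain_measure \<Omega>"
  fix n u assume u: "\<forall>i<n. u i \<in> eigenspace \<Omega> 0" and ind: "L2_independent \<Omega> n u"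
  show "enat n \<le> 1"
  proof (rule ccontr)
    assume "\<not> enat n \<le> 1"
    then have n: "1 < n" by (simp add: one_enat_def)
    obtain c0 where c0: "AE p in ?M. u 0 p = c0"
      using eigenspace_below_quarter[of "u 0" 0] u n by (metis less_trans zero_less_one zero_less_divide_1_iff zero_less_numeral)
    obtain c1 where c1: "AE p in ?M. u 1 p = c1"
      using eigenspace_below_quarter[of "u 1" 0] u n by (metis zero_less_divide_1_iff zero_less_numeral)
    have two: "(\<Sum>i<n. (if i = 0 then s else if i = 1 then t else 0) * u i p) = s * u 0 p + t * u 1 p" for s t :: real and p
    proof -
      have "(\<Sum>i<n. (if i = 0 then s else if i = 1 then t else 0) * u i p) = (\<Sum>i\<in>{0, 1}. (if i = 0 then s else if i = 1 then t else 0) * u i p)"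
        using n by (intro sum.mono_neutral_right) auto
      then show ?thesis by simp
    qed
    have indep: "s = 0 \<and> t = 0" if "AE p in ?M. s * u 0 p + t * u 1 p = 0" for s t
      using ind[unfolded L2_independent_def, rule_format, of "\<lambda>i. if i = 0 then s else if i = 1 then t else 0" 0]
        ind[unfolded L2_independent_def, rule_format, of "\<lambda>i. if i = 0 then s else if i = 1 then t else 0" 1] that n
      unfolding two by simp
    have "AE p in ?M. c1 * u 0 p + (- c0) * u 1 p = 0"
      using c0 c1 by eventually_elim simp
    then have z: "c0 = 0" using indep[of c1 "- c0"] by auto
    have "AE p in ?M. 1 * u 0 p + 0 * u 1 p = 0" using c0 by eventually_elim (simp add: z)
    then show False using indep[of 1 0] by simp
  qed
qed

lemma multiplicity_ge: "1 \<le> eigenvalue_multiplicity \<Omega> \<mu>" if "eigenfunction \<Omega> \<mu> u"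
proof -
  have "L2_independent \<Omega> 1 (\<lambda>_. u)"
    unfolding L2_independent_def
  proof (intro allI impI)
    fix c :: "nat \<Rightarrow> real" and i :: nat
    assume "AE p in domain_measure \<Omega>. (\<Sum>i<1. c i * u p) = 0" and i: "i < 1"
    then have *: "AE p in domain_measure \<Omega>. c 0 * u p = 0" by simp
    show "c i = 0"
    proof (rule ccontr)
      assume "c i \<noteq> 0"
      have "AE p in domain_measure \<Omega>. u p = 0" using * by eventually_elim (use \<open>c i \<noteq> 0\<close> i in simp)
      then show False using that by (simp add: eigenfunction_def)
    qed
  qed
  then have "enat 1 \<in> {enat n |n. \<exists>u. (\<forall>i<n. u i \<in> eigenspace \<Omega> \<mu>) \<and> L2_independent \<Omega> n u}"
    using that by (auto simp: eigenfunction_def)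
  then show ?thesis unfolding eigenvalue_multiplicity_def one_enat_def by (rule Sup_upper)
qed

lemma eigenfunction_wave_x: "n > 0 \<or> \<theta> = 0 \<Longrightarrow> eigenfunction \<Omega> ((real n / 2)\<^sup>2) (wave_x n \<theta>)"
  using wave_x_eigenspace wave_x_not_AE_zero by (simp add: eigenfunction_def)

lemma second_eigenvalue: "nth_eigenvalue \<Omega> 2 = 1 / 4"
  unfolding nth_eigenvalue_def
proof (rule Least_equality)
  have e0: "eigenfunction \<Omega> 0 (wave_x 0 0)" and e1: "eigenfunction \<Omega> (1 / 4) (wave_x 1 0)"
    using eigenfunction_wave_x[of 0 0] eigenfunction_wave_x[of 1 0] by (simp_all add: power_divide)
  have "enat 2 \<le> 1 + (1 :: enat)" by (simp add: one_enat_def)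
  also have "\<dots> \<le> eigenvalue_multiplicity \<Omega> 0 + eigenvalue_multiplicity \<Omega> (1 / 4)"
    by (intro add_mono multiplicity_ge[OF e0] multiplicity_ge[OF e1])
  also have "\<dots> = (\<Sum>\<nu>\<in>{0, 1 / 4}. eigenvalue_multiplicity \<Omega> \<nu>)" by simp
  also have "\<dots> \<le> eigenvalue_count \<Omega> (1 / 4)"
    unfolding eigenvalue_count_def
    by (rule SUP_upper) (use e0 e1 in \<open>auto simp: eigenvalue_def\<close>)
  finally show "enat 2 \<le> eigenvalue_count \<Omega> (1 / 4)" .
next
  fix \<mu> assume 2: "enat 2 \<le> eigenvalue_count \<Omega> \<mu>"
  show "1 / 4 \<le> \<mu>"
  proof (rule ccontr)
    assume \<mu>: "\<not> 1 / 4 \<le> \<mu>"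
    have "eigenvalue_count \<Omega> \<mu> \<le> 1"
      unfolding eigenvalue_count_def
    proof (rule SUP_least)
      fix F assume F: "F \<in> {F. finite F \<and> F \<subseteq> {\<nu>. eigenvalue \<Omega> \<nu> \<and> \<nu> \<le> \<mu>}}"
      then have "F \<subseteq> {0}" using eigenvalue_below_quarter \<mu> by force
      then consider "F = {}" | "F = {0}" by blast
      then show "(\<Sum>\<nu>\<in>F. eigenvalue_multiplicity \<Omega> \<nu>) \<le> 1"
        by cases (use multiplicity_0_le in auto)
    qed
    then show False using 2 by (metis enat_ord_simps(1) one_enat_def order_trans numeral_le_one_iff semiring_norm(69) one_add_one)
  qed
qed

lemma kappa_second_eigenvalue: "kappa \<Omega> (nth_eigenvalue \<Omega> 2) \<le> 2"
  unfolding kappa_def by (rule Least_le) simp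

end

section \<open>Nodal domains\<close>

lemma connected_component_sign:
  fixes f :: "'a :: topological_space \<Rightarrow> real"
  assumes "connected C" "continuous_on C f" "p \<in> C" "q \<in> C" "f p < 0" "f q > 0"
  obtains r where "r \<in> C" "f r = 0"
proof -
  have "0 \<in> f ` C"
    by (rule connectedD_interval[OF connected_continuous_image[OF assms(2,1)], of "f p" "f q"]) (use assms in auto)
  then show thesis using that by auto
qed

context cracks begin

lemma eigenfunction_combination_strip: "eigenfunction_combination \<Omega> (1 / 4) strip"
  unfolding eigenfunction_combination_def
proof (intro conjI exI)
  show "continuous_on \<Omega> strip" by (rule continuous_on_subset[OF strip_continuous]) simp
  let ?u = "\<lambda>i::nat. if i = 0 then wave_x 1 (- (a / 4)) else wave_x 0 0"
  let ?\<nu> = "\<lambda>i::nat. if i = 0 then 1 / 4 else (0 :: real)"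
  let ?c = "\<lambda>i::nat. if i = 0 then 1 else - cos (a / 4)"
  show "\<forall>i<2. ?\<nu> i \<le> 1 / 4 \<and> eigenfunction \<Omega> (?\<nu> i) (?u i)"
    using eigenfunction_wave_x[of 1 "- (a / 4)"] eigenfunction_wave_x[of 0 0] by (simp add: power_divide)
  show "\<forall>p\<in>\<Omega>. strip p = (\<Sum>i<2. ?c i * ?u i p)"
    by (simp add: strip_def numeral_2_eq_2 wave_x_def wave_0)
qed

lemma complement_nodal_set: "\<Omega> - nodal_set \<Omega> strip = {p \<in> \<Omega>. strip p \<noteq> 0}"
proof -
  have "closed {p. strip p = 0}"
    by (rule closed_Collect_eq[OF strip_continuous continuous_on_const])
  then have "nodal_set \<Omega> strip \<subseteq> {p. strip p = 0}"
    unfolding nodal_set_def by (intro closure_minimal) auto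
  then show ?thesis
    unfolding nodal_set_def using closure_subset[of "{p \<in> \<Omega>. strip p = 0}"] by auto
qed

end

text \<open>Two distinct cracks already separate the strip; further cracks can only increase the number of
  nodal domains.\<close>

locale two_cracks = cracks +
  assumes k: "k \<ge> 2" and distinct: "\<not> [y 1 = y 2] (rmod 2 * pi)"
begin

text \<open>A function of \<open>y\<close> alone whose zeros are the two circles through the first two cracks and which
  has opposite signs on the two arcs between them.\<close>

definition sep :: "torus \<Rightarrow> real" where
  "sep p = wave_y 1 (- ((y 1 + y 2) / 2)) p + - cos ((y 1 - y 2) / 2)"

lemma sep_to_torus: "sep (to_torus (x, t)) = cos (t - (y 1 + y 2) / 2) - cos ((y 1 - y 2) / 2)"
  by (simp add: sep_def wave_def)

lemma sep_continuous: "continuous_on UNIV sep"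
  unfolding sep_def[abs_def] by (intro elementary_continuous elementary.intros)

lemma sep_zero:
  assumes "sep p = 0" shows "line 1 p = 1 \<or> line 2 p = 1"
proof -
  obtain x t where p: "p = to_torus (x, t)" by (metis torus_cases)
  have "cos (t - (y 1 + y 2) / 2) = cos ((y 1 - y 2) / 2)" using assms by (simp add: p sep_to_torus)
  then obtain n where n: "n \<in> \<int>" "t - (y 1 + y 2) / 2 = (y 1 - y 2) / 2 + 2 * n * pi \<or> t - (y 1 + y 2) / 2 = - ((y 1 - y 2) / 2) + 2 * n * pi"
    unfolding cos_eq by auto
  obtain i :: int where "n = of_int i" using n(1) by (auto elim: Ints_cases)
  then have "t = y 1 + of_int i * (2 * pi) \<or> t = y 2 + of_int i * (2 * pi)" using n(2) by (auto simp: field_simps)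
  then have "[y 1 = t] (rmod 2 * pi) \<or> [y 2 = t] (rmod 2 * pi)" unfolding rcong_altdef by blast
  then show ?thesis unfolding p line_eq_1_iff by (blast intro: rcong_sym)
qed

lemma sep_nonzero:
  assumes "p \<in> \<Omega>" "strip p > 0" shows "sep p \<noteq> 0"
proof
  assume "sep p = 0"
  then have "line 1 p = 1 \<or> line 2 p = 1" by (rule sep_zero)
  moreover have "line 1 p < 1" "line 2 p < 1"
    using assms k by (auto simp: mem_\<Omega>_iff)
  ultimately show False by auto
qed

text \<open>Only countably many heights belong to the horizontal circles that contain cracks, so a nonempty
  open set of heights contains others.\<close>

lemma generic_point:
  fixes T :: "real set"
  assumes "open T" "T \<noteq> {}"
  obtains t where "t \<in> T" "to_torus (a / 2, t) \<in> \<Omega>" "strip (to_torus (a / 2, t)) > 0"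
proof -
  let ?N = "\<Union>j\<in>{1..k}. {t. [t = y j] (rmod 2 * pi)}"
  have "countable {t. [t = y j] (rmod 2 * pi)}" for j
  proof (rule countable_subset)
    show "{t. [t = y j] (rmod 2 * pi)} \<subseteq> range (\<lambda>n::int. y j + of_int n * (2 * pi))"
      using rcong_altdef rcong_sym by fastforce
  qed simp
  then have "countable ?N" by (intro countable_UN) auto
  then obtain t where t: "t \<in> T" "t \<notin> ?N" using open_minus_countable[OF _ assms(2,1)] by blast
  have "line j (to_torus (a / 2, t)) < 1" if "j \<in> {1..k}" for j
    using t(2) that line_le_1[of j "to_torus (a / 2, t)"] line_eq_1_iff[of j "a / 2" t] by (auto simp: less_le)
  then have "to_torus (a / 2, t) \<in> \<Omega>" by (auto simp: mem_\<Omega>_iff)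
  moreover have "strip (to_torus (a / 2, t)) > 0"
    using strip_pos_iff[of "a / 2" t] a_pos a_small pi_gt3 by auto
  ultimately show thesis using that t(1) by blast
qed

text \<open>On a connected set avoiding the nodal set, \<open>strip\<close> keeps its sign, and where it is positive
  \<open>sep\<close> keeps its sign as well, since there its zeros lie on the cracks. The three possible
  sign patterns all occur.\<close>

lemma three_nodal_domains: "nodal_domain_count \<Omega> strip \<ge> 3"
proof -
  let ?S = "{p \<in> \<Omega>. strip p \<noteq> 0}"
  let ?f = "\<lambda>t. cos (t - (y 1 + y 2) / 2) - cos ((y 1 - y 2) / 2)"
  have cf: "continuous_on UNIV ?f" by (intro continuous_intros) simp_all
  have cos1: "cos ((y 1 - y 2) / 2) \<noteq> 1"
  proof
    assume "cos ((y 1 - y 2) / 2) = 1"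
    then obtain n :: int where "(y 1 - y 2) / 2 = of_int n * 2 * pi" unfolding cos_one_2pi_int by blast
    then have "y 1 = y 2 + of_int (2 * n) * (2 * pi)" by (simp add: field_simps)
    then have "[y 2 = y 1] (rmod 2 * pi)" unfolding rcong_altdef by blast
    then show False using distinct rcong_sym by blast
  qed
  have cos2: "cos ((y 1 - y 2) / 2) \<noteq> - 1"
  proof
    assume "cos ((y 1 - y 2) / 2) = - 1"
    then have "cos ((y 1 - y 2) / 2 + pi) = 1" by simp
    then obtain n :: int where "(y 1 - y 2) / 2 + pi = of_int n * 2 * pi" unfolding cos_one_2pi_int by blast
    then have "y 1 = y 2 + of_int (2 * n - 1) * (2 * pi)" by (simp add: field_simps)
    then have "[y 2 = y 1] (rmod 2 * pi)" unfolding rcong_altdef by blast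
    then show False using distinct rcong_sym by blast
  qed
  have "open {t. ?f t > 0}" by (rule open_Collect_less[OF continuous_on_const cf])
  moreover have "(y 1 + y 2) / 2 \<in> {t. ?f t > 0}" using cos1 cos_le_one[of "(y 1 - y 2) / 2"] by (simp add: less_le)
  ultimately obtain t1 where t1: "?f t1 > 0" "to_torus (a / 2, t1) \<in> \<Omega>" "strip (to_torus (a / 2, t1)) > 0"
    using generic_point[of "{t. ?f t > 0}"] by blast
  have "open {t. ?f t < 0}" by (rule open_Collect_less[OF cf continuous_on_const])
  moreover have "(y 1 + y 2) / 2 + pi \<in> {t. ?f t < 0}" using cos2 cos_ge_minus_one[of "(y 1 - y 2) / 2"] by (simp add: less_le)
  ultimately obtain t2 where t2: "?f t2 < 0" "to_torus (a / 2, t2) \<in> \<Omega>" "strip (to_torus (a / 2, t2)) > 0"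
    using generic_point[of "{t. ?f t < 0}"] by blast
  define p0 where "p0 = to_torus (1, 0)"
  define p1 where "p1 = to_torus (a / 2, t1)"
  define p2 where "p2 = to_torus (a / 2, t2)"
  have n0: "strip p0 < 0" unfolding p0_def using strip_neg_iff[of 1 0] a_small pi_gt3 by simp
  have S: "p0 \<in> ?S" "p1 \<in> ?S" "p2 \<in> ?S"
    using n0 t1 t2 by (auto simp: mem_\<Omega>_iff p1_def p2_def)
  have pos: "strip p1 > 0" "strip p2 > 0" "sep p1 > 0" "sep p2 < 0"
    using t1 t2 by (auto simp: p1_def p2_def sep_to_torus)
  let ?C = "connected_component_set ?S"
  have sub: "?C p \<subseteq> ?S" for p by (rule connected_component_subset)
  have con: "connected (?C p)" for p by (rule connected_connected_component)
  have no_change: "\<not> (strip q < 0 \<and> strip r > 0)" if qr: "q \<in> ?C p" "r \<in> ?C p" for p q r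
  proof
    assume "strip q < 0 \<and> strip r > 0"
    then obtain s where "s \<in> ?C p" "strip s = 0"
      using connected_component_sign[OF con continuous_on_subset[OF strip_continuous subset_UNIV] qr] by blast
    then show False using sub by blast
  qed
  have mem: "p1 \<in> ?C p1" "p2 \<in> ?C p2" "p0 \<in> ?C p0" using S by simp_all
  have ne: "?C p0 \<noteq> ?C q" if q: "q \<in> ?C q" "strip q > 0" for q
  proof
    assume "?C p0 = ?C q"
    then have "q \<in> ?C p0" using q(1) by (simp only:)
    then show False using no_change[OF mem(3)] n0 q(2) by blast
  qed
  note 01 = ne[OF mem(1) pos(1)] and 02 = ne[OF mem(2) pos(2)]
  have 12: "?C p1 \<noteq> ?C p2"
  proof
    assume "?C p1 = ?C p2"
    then have p2: "p2 \<in> ?C p1" using mem(2) by (simp only:)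
    obtain s where s: "s \<in> ?C p1" "sep s = 0"
      using connected_component_sign[OF con continuous_on_subset[OF sep_continuous subset_UNIV] p2 mem(1)] pos by blast
    have "\<not> strip s < 0" using no_change[OF s(1) mem(1)] pos by simp
    then have "strip s > 0" "s \<in> \<Omega>" using s(1) sub[of p1] by auto
    then show False using sep_nonzero s(2) by blast
  qed
  have "{?C p0, ?C p1, ?C p2} \<subseteq> components ?S" using S by (auto simp: components_def)
  then have "3 \<le> card (components ?S)" if "finite (components ?S)"
    using card_mono[OF that, of "{?C p0, ?C p1, ?C p2}"] 01 02 12 by simp
  then show ?thesis
    unfolding nodal_domain_count_def complement_nodal_set by (auto simp: Let_def numeral_eq_enat)
qed

lemma nodal_count_exceeds_kappa:
  "enat (kappa \<Omega> (nth_eigenvalue \<Omega> 2)) < nodal_domain_count \<Omega> strip"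
proof -
  have "enat (kappa \<Omega> (nth_eigenvalue \<Omega> 2)) \<le> enat 2" using kappa_second_eigenvalue by simp
  also have "enat 2 < 3" by (simp add: numeral_eq_enat)
  also have "3 \<le> nodal_domain_count \<Omega> strip" by (rule three_nodal_domains)
  finally show ?thesis .
qed

end

theorem proposition5p1:
  fixes k :: nat and y :: "nat \<Rightarrow> real"
  assumes "k \<ge> 2"
    and "\<And>i j. i \<in> {1..k} \<Longrightarrow> j \<in> {1..k} \<Longrightarrow> i \<noteq> j \<Longrightarrow> \<not> [y i = y j] (rmod 2 * pi)"
  shows "\<forall>\<^sub>F a in at_right 0.
           \<not> extended_courant_property (cracked_torus k y a) \<and>
           (\<exists>m\<ge>1. \<exists>v.
              eigenfunction_combination (cracked_torus k y a)
                (nth_eigenvalue (cracked_torus k y a) m) v \<and>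
              nodal_domain_count (cracked_torus k y a) v >
                enat (kappa (cracked_torus k y a) (nth_eigenvalue (cracked_torus k y a) m)))"
proof -
  have "\<forall>\<^sub>F a in at_right (0 :: real). 0 < a \<and> a < 1 / 10"
    using eventually_at_right_less[of "0 :: real"] eventually_at_right[of 0 "1 / 10 :: real"]
    by (auto simp: eventually_at_filter intro!: eventually_conj exI[of _ "1 / 10"])
  then show ?thesis
  proof eventually_elim
    case (elim a)
    have "1 \<in> {1..k}" "2 \<in> {1..k}" "(1 :: nat) \<noteq> 2" using assms(1) by auto
    then interpret two_cracks k y a
      using elim assms by unfold_locales blast+
    have comb: "eigenfunction_combination \<Omega> (nth_eigenvalue \<Omega> 2) strip"
      unfolding second_eigenvalue by (rule eigenfunction_combination_strip)
    have "\<not> extended_courant_property \<Omega>"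
    proof
      assume "extended_courant_property \<Omega>"
      then have "nodal_domain_count \<Omega> strip \<le> enat (kappa \<Omega> (nth_eigenvalue \<Omega> 2))"
        using comb unfolding extended_courant_property_def by (metis one_le_numeral)
      then show False using nodal_count_exceeds_kappa by simp
    qed
    moreover have "\<exists>m\<ge>1. \<exists>v. eigenfunction_combination \<Omega> (nth_eigenvalue \<Omega> m) v \<and>
        nodal_domain_count \<Omega> v > enat (kappa \<Omega> (nth_eigenvalue \<Omega> m))"
      using comb nodal_count_exceeds_kappa by (intro exI[of _ 2] conjI exI[of _ strip]) simp_all
    ultimately show ?case unfolding \<Omega>_def by blast
  qed
qed

end
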